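(* Let $n\ge 2$, $0\le m\le n$ and let $p_{jk}$ ($1\le j,k\le n$) be real constants. Let $a=\mathrm{diag}(a_1,\dots,a_n)$ and let $b=(b_{jk})$ be an $(n\times n)$-matrix, where $a_j, b_{jk}\in BC^1(\Pi)$ for all $j,k\le n$. Suppose that for some $\Lambda_0>0$ $$\inf_{(x,t)\in\overline\Pi}a_j\ge\Lambda_0\ \text{ for all } j\le m,\qquad \sup_{(x,t)\in\overline\Pi}a_j\le-\Lambda_0\ \text{ for all } j>m .$$ Then the problem $$\partial_t u+a(x,t)\partial_x u+b(x,t)u=0,\quad (x,t)\in\Pi,$$ $$u_j(0,t)=\sum_{k=1}^m p_{jk}u_k(1,t)+\sum_{k=m+1}^n p_{jk}u_k(0,t),\quad 1\le j\le m,$$ $$u_j(1,t)=\sum_{k=1}^m p_{jk}u_k(1,t)+\sum_{k=m+1}^n p_{jk}u_k(0,t),\quad m<j\le n,$$ generates an exponentially bounded evolution family $\{U(t,\tau)\}_{t\ge\tau}$ on the space $L^2(0,1)^n$.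
   Context: $\Pi=\{(x,t):0<x<1,\ t\in\mathbb R\}$ and, for $\tau\in\mathbb R$, $\Pi_\tau=\{(x,t):0<x<1,\ t>\tau\}$. $BC(\Pi)$ is the space of bounded continuous functions $u:\overline\Pi\to\mathbb R$ with the norm $\|u\|_\infty=\sup_{\Pi}|u|$; $BC^1(\Pi)$ is the space of $u\in BC(\Pi)$ with $\partial_xu,\partial_tu\in BC(\Pi)$, with norm $\|u\|_1=\|u\|_\infty+\|\partial_xu\|_\infty+\|\partial_tu\|_\infty$. For a Banach space $X$, $X^n$ carries the norm $\|u\|_{X^n}=\max_{i\le n}\|u_i\|_X$. $\mathcal L(X)$ is the space of bounded linear operators on $X$. Functions $u=(u_1,\dots,u_n)$ are real-valued vectors. A two-parameter family $\{U(t,\tau)\}_{t\ge\tau}$ of bounded linear operators on a Banach space $X$ is an evolution family if $U(\tau,\tau)=I$, $U(t,s)U(s,\tau)=U(t,\tau)$ for all $t\ge s\ge\tau$, and the map $(t,\tau)\mapsto U(t,\tau)\in\mathcal L(X)$ is strongly continuous on $\{t\ge\tau\}$. It is exponentially bounded if there exist $\omega\in\mathbb R$ and $M=M(\omega)\ge1$ such that $\|U(t,\tau)\|_{\mathcal L(X)}\le Me^{\omega(t-\tau)}$ for all $t\ge\tau$. "Generates": under the stated hypotheses it is known that for every $\tau\in\mathbb R$ and every $\varphi\in C_0^\infty([0,1])^n$ (smooth functions compactly supported in $(0,1)$) there is a unique classical solution, i.e. a $u\in C^1(\overline\Pi_\tau)^n$ satisfying the system in $\Pi_\tau$, the boundary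 conditions for $t\ge\tau$ and the initial condition $u(x,\tau)=\varphi(x)$. For $\varphi\in L^2(0,1)^n$, a function $u\in C([\tau,\infty),L^2(0,1))^n$ is an $L^2$-generalized solution with initial condition $u(\cdot,\tau)=\varphi$ if, for a sequence $\varphi^l\in C_0^\infty([0,1])^n$ with $\varphi^l\to\varphi$ in $L^2(0,1)^n$, the classical solutions $u^l$ with initial data $\varphi^l$ satisfy $\|u(\cdot,\theta)-u^l(\cdot,\theta)\|_{L^2(0,1)^n}\to0$ uniformly in $\theta\in[\tau,t]$ for every $t>\tau$. The problem generates the evolution family $\{U(t,\tau)\}_{t\ge\tau}$ on $L^2(0,1)^n$ if, for all $\tau\in\mathbb R$ and $\varphi\in L^2(0,1)^n$, $u(\cdot,t)=U(t,\tau)\varphi$ is the $L^2$-generalized solution, independent of the choice of the sequence $\varphi^l$ (in particular, for $\varphi\in C_0^\infty([0,1])^n$ it is the classical solution). *)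

theory Defs
  imports "HOL-Analysis.Analysis"
begin

section \<open>The Hilbert space \<open>L\<^sup>2(0,1)\<close>\<close>

abbreviation U01 :: "real measure"
  where "U01 \<equiv> lebesgue_on {0<..<1}"

definition square_integrable :: "(real \<Rightarrow> real) \<Rightarrow> bool"
  where "square_integrable f \<longleftrightarrow> f \<in> borel_measurable U01 \<and> integrable U01 (\<lambda>x. (f x)\<^sup>2)"

lemma square_integrableD:
  assumes "square_integrable f"
  shows "f \<in> borel_measurable U01" "integrable U01 (\<lambda>x. (f x)\<^sup>2)"
  using assms by (auto simp: square_integrable_def)

lemma square_integrable_mult:
  assumes "square_integrable f" "square_integrable g"
  shows "integrable U01 (\<lambda>x. f x * g x)"
proof (rule Bochner_Integration.integrable_bound)
  show "integrable U01 (\<lambda>x. (f x)\<^sup>2 + (g x)\<^sup>2)"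
    using assms by (auto simp: square_integrable_def)
  show "(\<lambda>x. f x * g x) \<in> borel_measurable U01"
    using assms by (auto simp: square_integrable_def)
  have "\<bar>u * v\<bar> \<le> u\<^sup>2 + v\<^sup>2" for u v :: real
  proof -
    have "0 \<le> (\<bar>u\<bar> - \<bar>v\<bar>)\<^sup>2" by simp
    then have "2 * (\<bar>u\<bar> * \<bar>v\<bar>) \<le> u\<^sup>2 + v\<^sup>2" by (simp add: power2_diff)
    moreover have "0 \<le> \<bar>u\<bar> * \<bar>v\<bar>" by simp
    ultimately have "\<bar>u\<bar> * \<bar>v\<bar> \<le> u\<^sup>2 + v\<^sup>2" by linarith
    then show ?thesis by (simp add: abs_mult)
  qed
  then show "AE x in U01. norm (f x * g x) \<le> norm ((f x)\<^sup>2 + (g x)\<^sup>2)"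
    by simp
qed

lemma square_integrable_zero: "square_integrable (\<lambda>x. 0)"
  by (simp add: square_integrable_def)

lemma square_integrable_add:
  assumes "square_integrable f" "square_integrable g"
  shows "square_integrable (\<lambda>x. f x + g x)"
proof -
  have "integrable U01 (\<lambda>x. (f x)\<^sup>2 + (g x)\<^sup>2 + 2 * (f x * g x))"
    using assms square_integrable_mult[OF assms]
    by (auto simp: square_integrable_def)
  then show ?thesis
    using assms by (auto simp: square_integrable_def power2_sum mult.assoc)
qed

lemma square_integrable_scale:
  assumes "square_integrable f"
  shows "square_integrable (\<lambda>x. c * f x)"
  using assms by (auto simp: square_integrable_def power_mult_distrib)

lemma square_integrable_uminus:
  assumes "square_integrable f"
  shows "square_integrable (\<lambda>x. - f x)"
  using square_integrable_scale[OF assms, of "-1"] by simp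

lemma square_integrable_diff:
  assumes "square_integrable f" "square_integrable g"
  shows "square_integrable (\<lambda>x. f x - g x)"
  using square_integrable_add[OF assms(1) square_integrable_uminus[OF assms(2)]] by simp

quotient_type L2 = "real \<Rightarrow> real" / partial:
  "\<lambda>f g. square_integrable f \<and> square_integrable g \<and> (AE x in U01. f x = g x)"
proof (rule part_equivpI)
  show "\<exists>f. square_integrable f \<and> square_integrable f \<and> (AE x in U01. f x = f x)"
    using square_integrable_zero by auto
  show "symp (\<lambda>f g. square_integrable f \<and> square_integrable g \<and> (AE x in U01. f x = g x))"
    by (intro sympI) (simp add: eq_commute)
  have "AE x in U01. f x = h x" if "AE x in U01. f x = g x" "AE x in U01. g x = h x"
    for f g h :: "real \<Rightarrow> real"
    using that by eventually_elim simp
  then show "transp (\<lambda>f g. square_integrable f \<and> square_integrable g \<and> (AE x in U01. f x = g x))"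
    by (intro transpI) blast
qed

instantiation L2 :: real_inner
begin

lift_definition zero_L2 :: L2 is "\<lambda>x. 0"
  by (simp add: square_integrable_zero)

lift_definition plus_L2 :: "L2 \<Rightarrow> L2 \<Rightarrow> L2" is "\<lambda>f g x. f x + g x"
  by (auto simp: square_integrable_add)

lift_definition uminus_L2 :: "L2 \<Rightarrow> L2" is "\<lambda>f x. - f x"
  by (auto simp: square_integrable_uminus)

lift_definition minus_L2 :: "L2 \<Rightarrow> L2 \<Rightarrow> L2" is "\<lambda>f g x. f x - g x"
  by (auto simp: square_integrable_diff)

lift_definition scaleR_L2 :: "real \<Rightarrow> L2 \<Rightarrow> L2" is "\<lambda>c f x. c * f x"
  by (auto simp: square_integrable_scale)

lift_definition inner_L2 :: "L2 \<Rightarrow> L2 \<Rightarrow> real" is "\<lambda>f g. \<integral>x. f x * g x \<partial>U01"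
proof -
  fix f f' g g' :: "real \<Rightarrow> real"
  assume A: "square_integrable f \<and> square_integrable f' \<and> (AE x in U01. f x = f' x)"
    "square_integrable g \<and> square_integrable g' \<and> (AE x in U01. g x = g' x)"
  then have "AE x in U01. f x * g x = f' x * g' x" by auto
  then show "(\<integral>x. f x * g x \<partial>U01) = (\<integral>x. f' x * g' x \<partial>U01)"
    using A by (intro integral_cong_AE) (auto simp: square_integrable_def)
qed

lift_definition norm_L2 :: "L2 \<Rightarrow> real" is "\<lambda>f. sqrt (\<integral>x. (f x)\<^sup>2 \<partial>U01)"
proof -
  fix f f' :: "real \<Rightarrow> real"
  assume A: "square_integrable f \<and> square_integrable f' \<and> (AE x in U01. f x = f' x)"
  then have "AE x in U01. (f x)\<^sup>2 = (f' x)\<^sup>2" by auto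
  then have "(\<integral>x. (f x)\<^sup>2 \<partial>U01) = (\<integral>x. (f' x)\<^sup>2 \<partial>U01)"
    using A by (intro integral_cong_AE) (auto simp: square_integrable_def)
  then show "sqrt (\<integral>x. (f x)\<^sup>2 \<partial>U01) = sqrt (\<integral>x. (f' x)\<^sup>2 \<partial>U01)" by simp
qed

definition sgn_L2 :: "L2 \<Rightarrow> L2" where "sgn_L2 f = scaleR (inverse (norm f)) f"

definition dist_L2 :: "L2 \<Rightarrow> L2 \<Rightarrow> real" where "dist_L2 f g = norm (f - g)"

definition uniformity_L2 :: "(L2 \<times> L2) filter"
  where "uniformity_L2 = (INF e\<in>{0 <..}. principal {(x, y). dist x y < e})"

definition open_L2 :: "L2 set \<Rightarrow> bool"
  where "open_L2 S \<longleftrightarrow> (\<forall>x\<in>S. \<forall>\<^sub>F (x', y) in uniformity. x' = x \<longrightarrow> y \<in> S)"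

instance
proof
  fix f g h :: L2 and c d :: real
  show "f + g + h = f + (g + h)"
    by transfer (auto simp: square_integrable_add add.assoc)
  show "f + g = g + f"
    by transfer (auto simp: square_integrable_add add.commute)
  show "0 + f = f" by transfer auto
  show "- f + f = 0" by transfer (auto simp: square_integrable_zero)
  show "f - g = f + - g" by transfer (auto simp: square_integrable_diff)
  show "c *\<^sub>R (f + g) = c *\<^sub>R f + c *\<^sub>R g"
    by transfer (auto simp: square_integrable_add square_integrable_scale distrib_left)
  show "(c + d) *\<^sub>R f = c *\<^sub>R f + d *\<^sub>R f"
    by transfer (auto simp: square_integrable_add square_integrable_scale distrib_right)
  show "c *\<^sub>R d *\<^sub>R f = (c * d) *\<^sub>R f"
    by transfer (auto simp: square_integrable_scale mult.assoc)
  show "1 *\<^sub>R f = f" by transfer auto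
  show "dist f g = norm (f - g)" by (rule dist_L2_def)
  show "sgn f = scaleR (inverse (norm f)) f" by (rule sgn_L2_def)
  show "inner f g = inner g f" by transfer (simp add: mult.commute)
  show "inner (f + g) h = inner f h + inner g h"
    by transfer (simp add: distrib_right square_integrable_mult)
  show "inner (c *\<^sub>R f) g = c * inner f g"
    by transfer (simp add: mult.assoc)
  show "0 \<le> inner f f" by transfer simp
  show "norm f = sqrt (inner f f)"
    by transfer (simp add: power2_eq_square)
  show "inner f f = 0 \<longleftrightarrow> f = 0"
  proof transfer
    fix f :: "real \<Rightarrow> real"
    assume f: "square_integrable f \<and> square_integrable f \<and> (AE x in U01. f x = f x)"
    then have "(\<integral>x. f x * f x \<partial>U01) = 0 \<longleftrightarrow> (AE x in U01. f x * f x = 0)"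
      by (intro integral_nonneg_eq_0_iff_AE square_integrable_mult) auto
    then show "((\<integral>x. f x * f x \<partial>U01) = 0) =
      (square_integrable f \<and> square_integrable (\<lambda>x. 0) \<and> (AE x in U01. f x = 0))"
      using f by (simp add: square_integrable_zero)
  qed
qed (simp_all add: uniformity_L2_def open_L2_def)

end

lift_definition L2_class :: "(real \<Rightarrow> real) \<Rightarrow> L2"
  is "\<lambda>f. if square_integrable f then f else (\<lambda>x. 0)"
  by (simp add: square_integrable_zero)

lemma norm_L2_class:
  "square_integrable f \<Longrightarrow> norm (L2_class f) = sqrt (\<integral>x. (f x)\<^sup>2 \<partial>U01)"
  by transfer simp

lemma L2_class_diff:
  "square_integrable f \<Longrightarrow> square_integrable g \<Longrightarrow>
    L2_class f - L2_class g = L2_class (\<lambda>x. f x - g x)"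
  by transfer (simp add: square_integrable_diff)

lemma L2_class_surj: "\<exists>f. square_integrable f \<and> F = L2_class f"
  by transfer auto

lemma L2_class_eq_iff:
  "square_integrable f \<Longrightarrow> square_integrable g \<Longrightarrow>
    L2_class f = L2_class g \<longleftrightarrow> (AE x in U01. f x = g x)"
  by transfer simp

lemma finite_measure_U01: "finite_measure U01"
  by (rule finite_measure_lebesgue_on) simp

lemma square_integrable_continuous:
  assumes "continuous_on {0..1} f"
  shows "square_integrable f"
proof -
  have sub: "{0<..<1::real} \<subseteq> {0..1}" by auto
  have "f \<in> borel_measurable U01"
    using continuous_on_subset[OF assms sub]
    by (intro continuous_imp_measurable_on_sets_lebesgue) auto
  moreover obtain B where B: "\<And>x. x \<in> {0..1} \<Longrightarrow> norm ((f x)\<^sup>2) \<le> B"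
  proof -
    have "compact ((\<lambda>x. (f x)\<^sup>2) ` {0..1})"
      by (intro compact_continuous_image continuous_intros assms) simp
    then have "bounded ((\<lambda>x. (f x)\<^sup>2) ` {0..1})" by (rule compact_imp_bounded)
    then show ?thesis unfolding bounded_iff using that by blast
  qed
  have "integrable U01 (\<lambda>x. (f x)\<^sup>2)"
  proof (rule finite_measure.integrable_const_bound[OF finite_measure_U01])
    show "AE x in U01. norm ((f x)\<^sup>2) \<le> B" by (rule AE_I2) (rule B, simp)
    show "(\<lambda>x. (f x)\<^sup>2) \<in> borel_measurable U01" using calculation by simp
  qed
  ultimately show ?thesis by (simp add: square_integrable_def)
qed

lemma AE_summable_of_L1:
  fixes g :: "nat \<Rightarrow> 'a \<Rightarrow> real"
  assumes "\<And>k. integrable M (g k)" "summable (\<lambda>k. \<integral>x. \<bar>g k x\<bar> \<partial>M)"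
  shows "AE x in M. summable (\<lambda>k. \<bar>g k x\<bar>)"
proof -
  have "(\<integral>\<^sup>+x. (\<Sum>k. ennreal \<bar>g k x\<bar>) \<partial>M) = (\<Sum>k. \<integral>\<^sup>+x. ennreal \<bar>g k x\<bar> \<partial>M)"
    using assms(1) by (intro nn_integral_suminf) auto
  also have "\<dots> = (\<Sum>k. ennreal (\<integral>x. \<bar>g k x\<bar> \<partial>M))"
    using assms(1) by (intro arg_cong[where f = suminf] ext nn_integral_eq_integral) auto
  also have "\<dots> \<noteq> \<infinity>"
    using assms(2) by (simp add: ennreal_suminf_neq_top)
  finally have "AE x in M. (\<Sum>k. ennreal \<bar>g k x\<bar>) \<noteq> \<infinity>"
    using assms(1) by (intro nn_integral_noteq_infinite) auto
  then show ?thesis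
    by eventually_elim (rule summable_suminf_not_top, auto)
qed

instance L2 :: banach
proof
  fix X :: "nat \<Rightarrow> L2"
  assume X: "Cauchy X"
  have "\<exists>r. strict_mono r \<and> (\<forall>k. \<forall>i\<ge>r k. \<forall>j\<ge>r k. norm (X i - X j) < (1/2)^k)"
  proof -
    have "\<exists>N. \<forall>i\<ge>N. \<forall>j\<ge>N. norm (X i - X j) < (1/2)^k" for k
      using X unfolding Cauchy_def dist_norm by simp
    then obtain N where N: "\<And>k i j. i \<ge> N k \<Longrightarrow> j \<ge> N k \<Longrightarrow> norm (X i - X j) < (1/2)^k"
      by metis
    define r where "r = rec_nat (N 0) (\<lambda>k s. Suc (max s (N (Suc k))))"
    have "strict_mono r"
      by (rule strict_monoI_Suc) (auto simp: r_def)
    moreover have "r k \<ge> N k" for k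
      by (cases k) (auto simp: r_def)
    ultimately show ?thesis using N by (meson le_trans)
  qed
  then obtain r where r: "strict_mono r"
    and rX: "\<And>k i j. i \<ge> r k \<Longrightarrow> j \<ge> r k \<Longrightarrow> norm (X i - X j) < (1/2)^k"
    by blast
  obtain f where f: "\<And>k. square_integrable (f k)" and Xf: "\<And>k. X (r k) = L2_class (f k)"
  proof -
    have "\<exists>f. \<forall>k. square_integrable (f k) \<and> X (r k) = L2_class (f k)"
      by (rule choice) (simp add: L2_class_surj)
    then show ?thesis using that by blast
  qed
  have mf [measurable]: "f k \<in> borel_measurable U01" for k
    using f by (rule square_integrableD)
  have norm_f: "sqrt (\<integral>x. (f k x - f l x)\<^sup>2 \<partial>U01) = norm (X (r k) - X (r l))" for k l
    by (simp add: Xf L2_class_diff norm_L2_class square_integrable_diff f)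
  have sq_le: "(\<integral>x. (f k x - f l x)\<^sup>2 \<partial>U01) \<le> ((1/2)^k)\<^sup>2" if "k \<le> l" for k l
  proof -
    have "sqrt (\<integral>x. (f k x - f l x)\<^sup>2 \<partial>U01) \<le> (1/2)^k"
      unfolding norm_f using rX[of k "r k" "r l"] strict_mono_less_eq[OF r, of k l] that by simp
    then show ?thesis by (rule sqrt_le_D)
  qed
  have one: "square_integrable (\<lambda>x. 1)"
    using square_integrable_continuous[of "\<lambda>x. 1"] by simp
  have L1: "integrable U01 (\<lambda>x. g x)" if "square_integrable g" for g
    using square_integrable_mult[OF that one] by simp
  have abs_sq: "square_integrable (\<lambda>x. \<bar>g x\<bar>)" if "square_integrable g" for g
    using that by (auto simp: square_integrable_def)
  have L1_le: "(\<integral>x. \<bar>g x\<bar> \<partial>U01) \<le> norm (L2_class g) * norm (L2_class (\<lambda>x. 1))"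
    if g: "square_integrable g" for g
  proof -
    have "(\<integral>x. \<bar>g x\<bar> \<partial>U01) = inner (L2_class (\<lambda>x. \<bar>g x\<bar>)) (L2_class (\<lambda>x. 1))"
      using abs_sq[OF g] one by transfer simp
    also have "\<dots> \<le> norm (L2_class (\<lambda>x. \<bar>g x\<bar>)) * norm (L2_class (\<lambda>x. 1))"
      by (rule norm_cauchy_schwarz)
    also have "norm (L2_class (\<lambda>x. \<bar>g x\<bar>)) = norm (L2_class g)"
      using abs_sq[OF g] g by (simp add: norm_L2_class)
    finally show ?thesis .
  qed
  have "AE x in U01. summable (\<lambda>k. \<bar>f (Suc k) x - f k x\<bar>)"
  proof (rule AE_summable_of_L1)
    show "integrable U01 (\<lambda>x. f (Suc k) x - f k x)" for k
      by (intro L1 square_integrable_diff f)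
    show "summable (\<lambda>k. \<integral>x. \<bar>f (Suc k) x - f k x\<bar> \<partial>U01)"
    proof (rule summable_comparison_test)
      show "summable (\<lambda>k. (1/2)^k * norm (L2_class (\<lambda>x. 1)))"
        by (intro summable_mult2 summable_geometric) simp
      have "norm (\<integral>x. \<bar>f (Suc k) x - f k x\<bar> \<partial>U01) \<le> (1/2)^k * norm (L2_class (\<lambda>x. 1))" for k
      proof -
        have "(\<integral>x. \<bar>f (Suc k) x - f k x\<bar> \<partial>U01)
            \<le> norm (L2_class (\<lambda>x. f (Suc k) x - f k x)) * norm (L2_class (\<lambda>x. 1))"
          by (intro L1_le square_integrable_diff f)
        also have "L2_class (\<lambda>x. f (Suc k) x - f k x) = X (r (Suc k)) - X (r k)"
          by (simp add: Xf L2_class_diff f)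
        also have "norm (X (r (Suc k)) - X (r k)) \<le> (1/2)^k"
          using rX[of k "r (Suc k)" "r k"] strict_mono_less_eq[OF r, of k "Suc k"] by simp
        finally show ?thesis by (simp add: mult_right_mono)
      qed
      then show "\<exists>N. \<forall>k\<ge>N. norm (\<integral>x. \<bar>f (Suc k) x - f k x\<bar> \<partial>U01)
          \<le> (1/2)^k * norm (L2_class (\<lambda>x. 1))" by blast
    qed
  qed
  then have conv: "AE x in U01. convergent (\<lambda>k. f k x)"
  proof eventually_elim
    case (elim x)
    then have "summable (\<lambda>k. f (Suc k) x - f k x)" by (rule summable_rabs_cancel)
    then have "convergent (\<lambda>n. \<Sum>k<n. f (Suc k) x - f k x)"
      by (simp add: summable_iff_convergent)
    moreover have "(\<lambda>n. \<Sum>k<n. f (Suc k) x - f k x) = (\<lambda>n. f n x - f 0 x)"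
      by (rule ext) (rule sum_lessThan_telescope)
    ultimately have "convergent (\<lambda>n. f n x - f 0 x)" by simp
    then have "convergent (\<lambda>n. (f n x - f 0 x) + f 0 x)"
      by (rule convergent_add[OF _ convergent_const])
    then show ?case by simp
  qed
  define g where "g = (\<lambda>x. lim (\<lambda>k. f k x))"
  have mg [measurable]: "g \<in> borel_measurable U01"
    unfolding g_def by (rule borel_measurable_lim_metric) simp
  have lim_g: "AE x in U01. (\<lambda>k. f k x) \<longlonglongrightarrow> g x"
    using conv by eventually_elim (simp add: g_def convergent_LIMSEQ_iff)
  have fatou: "(\<integral>\<^sup>+x. ennreal ((f k x - g x)\<^sup>2) \<partial>U01) \<le> ennreal (((1/2)^k)\<^sup>2)" for k
  proof -
    have "(\<integral>\<^sup>+x. ennreal ((f k x - g x)\<^sup>2) \<partial>U01)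
        = (\<integral>\<^sup>+x. liminf (\<lambda>l. ennreal ((f k x - f l x)\<^sup>2)) \<partial>U01)"
    proof (rule nn_integral_cong_AE)
      show "AE x in U01. ennreal ((f k x - g x)\<^sup>2) = liminf (\<lambda>l. ennreal ((f k x - f l x)\<^sup>2))"
        using lim_g
      proof eventually_elim
        case (elim x)
        have "(\<lambda>l. ennreal ((f k x - f l x)\<^sup>2)) \<longlonglongrightarrow> ennreal ((f k x - g x)\<^sup>2)"
          by (intro tendsto_intros tendsto_ennrealI elim)
        then show ?case by (intro lim_imp_Liminf[symmetric]) auto
      qed
    qed
    also have "\<dots> \<le> liminf (\<lambda>l. \<integral>\<^sup>+x. ennreal ((f k x - f l x)\<^sup>2) \<partial>U01)"
      by (rule nn_integral_liminf) measurable
    also have "\<dots> \<le> ennreal (((1/2)^k)\<^sup>2)"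
    proof (rule Liminf_le)
      show "\<forall>\<^sub>F l in sequentially. (\<integral>\<^sup>+x. ennreal ((f k x - f l x)\<^sup>2) \<partial>U01) \<le> ennreal (((1/2)^k)\<^sup>2)"
        using eventually_ge_at_top[of k]
      proof eventually_elim
        case (elim l)
        have "(\<integral>\<^sup>+x. ennreal ((f k x - f l x)\<^sup>2) \<partial>U01) = ennreal (\<integral>x. (f k x - f l x)\<^sup>2 \<partial>U01)"
          using square_integrableD(2)[OF square_integrable_diff[OF f f]]
          by (intro nn_integral_eq_integral) auto
        also have "\<dots> \<le> ennreal (((1/2)^k)\<^sup>2)"
          using sq_le[OF elim] by (rule ennreal_leI)
        finally show ?case .
      qed
    qed simp
    finally show ?thesis .
  qed
  have fg: "square_integrable (\<lambda>x. f k x - g x)" for k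
    unfolding square_integrable_def
  proof (safe intro!: integrableI_bounded)
    show "(\<integral>\<^sup>+x. ennreal (norm ((f k x - g x)\<^sup>2)) \<partial>U01) < \<infinity>"
      using fatou[of k] by (simp add: le_less_trans[OF _ ennreal_less_top])
  qed measurable
  have g: "square_integrable g"
    using square_integrable_diff[OF f[of 0] fg[of 0]] by simp
  have bound: "norm (X (r k) - L2_class g) \<le> (1/2)^k" for k
  proof -
    have "ennreal (\<integral>x. (f k x - g x)\<^sup>2 \<partial>U01) \<le> ennreal (((1/2)^k)\<^sup>2)"
      using fatou[of k] nn_integral_eq_integral[OF square_integrableD(2)[OF fg[of k]]] by simp
    then have "(\<integral>x. (f k x - g x)\<^sup>2 \<partial>U01) \<le> ((1/2)^k)\<^sup>2"
      by (simp add: ennreal_le_iff)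
    then have "sqrt (\<integral>x. (f k x - g x)\<^sup>2 \<partial>U01) \<le> (1/2)^k"
      by (intro real_le_lsqrt) auto
    then show ?thesis
      by (simp add: Xf L2_class_diff norm_L2_class f g fg)
  qed
  have "(\<lambda>k. X (r k)) \<longlonglongrightarrow> L2_class g"
  proof (rule LIM_zero_cancel, rule Lim_null_comparison)
    show "\<forall>\<^sub>F k in sequentially. norm (X (r k) - L2_class g) \<le> (1/2)^k"
      using bound by simp
    show "(\<lambda>k. (1/2::real)^k) \<longlonglongrightarrow> 0" by (rule LIMSEQ_realpow_zero) auto
  qed
  then show "convergent X"
    using Cauchy_converges_subseq[OF X r] by (auto simp: convergent_def o_def)
qed


section \<open>Finite powers with the maximum norm\<close>

text \<open>
  The type \<open>('x, 'n) max_pow\<close> is the space \<open>X\<^sup>n\<close>, \<open>n = CARD('n)\<close>, normed by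
  \<open>max\<^sub>i \<parallel>u\<^sub>i\<parallel>\<close>; the library type \<open>'x ^ 'n\<close> carries the Euclidean norm instead.
\<close>

typedef ('x, 'n) max_pow = "UNIV :: ('n::finite \<Rightarrow> 'x) set"
  morphisms component Max_Pow ..

setup_lifting type_definition_max_pow

instantiation max_pow :: (real_normed_vector, finite) real_normed_vector
begin

lift_definition zero_max_pow :: "('a, 'b) max_pow" is "\<lambda>i. 0" .
lift_definition plus_max_pow :: "('a, 'b) max_pow \<Rightarrow> ('a, 'b) max_pow \<Rightarrow> ('a, 'b) max_pow"
  is "\<lambda>u v i. u i + v i" .
lift_definition uminus_max_pow :: "('a, 'b) max_pow \<Rightarrow> ('a, 'b) max_pow" is "\<lambda>u i. - u i" .
lift_definition minus_max_pow :: "('a, 'b) max_pow \<Rightarrow> ('a, 'b) max_pow \<Rightarrow> ('a, 'b) max_pow"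
  is "\<lambda>u v i. u i - v i" .
lift_definition scaleR_max_pow :: "real \<Rightarrow> ('a, 'b) max_pow \<Rightarrow> ('a, 'b) max_pow"
  is "\<lambda>c u i. c *\<^sub>R u i" .
lift_definition norm_max_pow :: "('a, 'b) max_pow \<Rightarrow> real" is "\<lambda>u. MAX i. norm (u i)" .

definition sgn_max_pow :: "('a, 'b) max_pow \<Rightarrow> ('a, 'b) max_pow"
  where "sgn_max_pow u = scaleR (inverse (norm u)) u"

definition dist_max_pow :: "('a, 'b) max_pow \<Rightarrow> ('a, 'b) max_pow \<Rightarrow> real"
  where "dist_max_pow u v = norm (u - v)"

definition uniformity_max_pow :: "(('a, 'b) max_pow \<times> ('a, 'b) max_pow) filter"
  where "uniformity_max_pow = (INF e\<in>{0 <..}. principal {(x, y). dist x y < e})"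

definition open_max_pow :: "('a, 'b) max_pow set \<Rightarrow> bool"
  where "open_max_pow S \<longleftrightarrow> (\<forall>x\<in>S. \<forall>\<^sub>F (x', y) in uniformity. x' = x \<longrightarrow> y \<in> S)"

instance
proof
  fix u v w :: "('a, 'b) max_pow" and c d :: real
  show "u + v + w = u + (v + w)" by transfer (simp add: add.assoc)
  show "u + v = v + u" by transfer (simp add: add.commute)
  show "0 + u = u" by transfer simp
  show "- u + u = 0" by transfer simp
  show "u - v = u + - v" by transfer simp
  show "c *\<^sub>R (u + v) = c *\<^sub>R u + c *\<^sub>R v" by transfer (simp add: scaleR_add_right)
  show "(c + d) *\<^sub>R u = c *\<^sub>R u + d *\<^sub>R u" by transfer (simp add: scaleR_add_left)
  show "c *\<^sub>R d *\<^sub>R u = (c * d) *\<^sub>R u" by transfer simp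
  show "1 *\<^sub>R u = u" by transfer simp
  show "dist u v = norm (u - v)" by (rule dist_max_pow_def)
  show "sgn u = scaleR (inverse (norm u)) u" by (rule sgn_max_pow_def)
  show "norm u = 0 \<longleftrightarrow> u = 0"
  proof transfer
    fix u :: "'b \<Rightarrow> 'a"
    show "(MAX i. norm (u i)) = 0 \<longleftrightarrow> u = (\<lambda>i. 0)"
    proof
      assume *: "(MAX i. norm (u i)) = 0"
      have "norm (u i) \<le> 0" for i
        unfolding *[symmetric] by (rule Max_ge) auto
      then show "u = (\<lambda>i. 0)" by auto
    qed (simp add: image_constant_conv)
  qed
  show "norm (u + v) \<le> norm u + norm v"
  proof transfer
    fix u v :: "'b \<Rightarrow> 'a"
    have "norm (u i + v i) \<le> (MAX i. norm (u i)) + (MAX i. norm (v i))" for i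
      by (rule order_trans[OF norm_triangle_ineq]) (intro add_mono Max_ge; simp)
    then show "(MAX i. norm (u i + v i)) \<le> (MAX i. norm (u i)) + (MAX i. norm (v i))"
      by (intro Max.boundedI) auto
  qed
  show "norm (c *\<^sub>R u) = \<bar>c\<bar> * norm u"
  proof transfer
    fix c :: real and u :: "'b \<Rightarrow> 'a"
    have "(\<lambda>i. norm (c *\<^sub>R u i)) ` UNIV = (\<lambda>x. \<bar>c\<bar> * x) ` ((\<lambda>i. norm (u i)) ` UNIV)"
      by (auto simp: image_image)
    moreover have "mono (\<lambda>x. \<bar>c\<bar> * x)"
      by (auto intro!: monoI mult_left_mono)
    ultimately show "(MAX i. norm (c *\<^sub>R u i)) = \<bar>c\<bar> * (MAX i. norm (u i))"
      using mono_Max_commute[of "\<lambda>x. \<bar>c\<bar> * x" "(\<lambda>i. norm (u i)) ` UNIV"] by simp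
  qed
qed (simp_all add: uniformity_max_pow_def open_max_pow_def)

end

lemma norm_component_le: "norm (component u i) \<le> norm u"
  unfolding norm_max_pow.rep_eq by (rule Max_ge) auto

lemma norm_max_pow_le_iff: "norm u \<le> c \<longleftrightarrow> (\<forall>i. norm (component u i) \<le> c)"
  unfolding norm_max_pow.rep_eq by (subst Max_le_iff) auto

instance max_pow :: (banach, finite) banach
proof
  fix X :: "nat \<Rightarrow> ('a, 'b) max_pow"
  assume X: "Cauchy X"
  have "Cauchy (\<lambda>k. component (X k) i)" for i
  proof (rule CauchyI)
    fix e :: real assume "0 < e"
    then obtain N where "\<forall>m\<ge>N. \<forall>n\<ge>N. norm (X m - X n) < e"
      using X by (auto simp: Cauchy_def dist_norm)
    then show "\<exists>N. \<forall>m\<ge>N. \<forall>n\<ge>N. norm (component (X m) i - component (X n) i) < e"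
      using norm_component_le[of "X _ - X _" i]
      unfolding minus_max_pow.rep_eq by (meson le_less_trans)
  qed
  then have "\<forall>i. \<exists>l. (\<lambda>k. component (X k) i) \<longlonglongrightarrow> l"
    by (simp add: Cauchy_convergent_iff convergent_def)
  then obtain l where l: "\<And>i. (\<lambda>k. component (X k) i) \<longlonglongrightarrow> l i" by metis
  have "X \<longlonglongrightarrow> Max_Pow l"
  proof (rule metric_LIMSEQ_I)
    fix e :: real assume e: "0 < e"
    have "\<forall>\<^sub>F k in sequentially. \<forall>i. norm (component (X k) i - l i) < e / 2"
    proof (rule eventually_all_finite)
      show "\<forall>\<^sub>F k in sequentially. norm (component (X k) i - l i) < e / 2" for i
        using l[of i] e by (simp add: tendsto_iff dist_norm del: less_divide_eq_numeral1)
    qed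
    then obtain N where N: "\<And>k i. k \<ge> N \<Longrightarrow> norm (component (X k) i - l i) < e / 2"
      by (auto simp: eventually_sequentially)
    have "dist (X k) (Max_Pow l) < e" if "k \<ge> N" for k
    proof -
      have "norm (X k - Max_Pow l) \<le> e / 2"
        unfolding norm_max_pow_le_iff minus_max_pow.rep_eq
        using N[OF that] by (auto simp only: Max_Pow_inverse UNIV_I less_imp_le)
      then show ?thesis using e by (simp add: dist_norm)
    qed
    then show "\<exists>N. \<forall>k\<ge>N. dist (X k) (Max_Pow l) < e" by blast
  qed
  then show "convergent X" by (auto simp: convergent_def)
qed


section \<open>Evolution families\<close>

text \<open>
  \<open>U t \<tau>\<close> is the operator \<open>U(t,\<tau>)\<close>; its values for \<open>t < \<tau>\<close> are irrelevant.
\<close>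

definition evolution_family :: "(real \<Rightarrow> real \<Rightarrow> ('x::banach \<Rightarrow>\<^sub>L 'x)) \<Rightarrow> bool"
  where "evolution_family U \<longleftrightarrow>
    (\<forall>\<tau>. U \<tau> \<tau> = id_blinfun) \<and>
    (\<forall>t s \<tau>. \<tau> \<le> s \<and> s \<le> t \<longrightarrow> U t s o\<^sub>L U s \<tau> = U t \<tau>) \<and>
    (\<forall>\<phi>. continuous_on {(t, \<tau>). \<tau> \<le> t} (\<lambda>(t, \<tau>). blinfun_apply (U t \<tau>) \<phi>))"

definition exponentially_bounded :: "(real \<Rightarrow> real \<Rightarrow> ('x::banach \<Rightarrow>\<^sub>L 'x)) \<Rightarrow> bool"
  where "exponentially_bounded U \<longleftrightarrow>
    (\<exists>\<omega> M. M \<ge> 1 \<and> (\<forall>t \<tau>. \<tau> \<le> t \<longrightarrow> norm (U t \<tau>) \<le> M * exp (\<omega> * (t - \<tau>))))"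


section \<open>Function spaces\<close>

text \<open>Functions of \<open>(x, t)\<close> are functions on \<^typ>\<open>real \<times> real\<close>, space variable first.\<close>

definition strip :: "(real \<times> real) set"
  where "strip = {(x, t). 0 < x \<and> x < 1}"

definition half_strip :: "real \<Rightarrow> (real \<times> real) set"
  where "half_strip \<tau> = {(x, t). 0 < x \<and> x < 1 \<and> \<tau> < t}"

lemma closure_strip: "closure strip = {0..1} \<times> UNIV"
proof -
  have *: "strip = {0<..<1} \<times> UNIV" by (auto simp: strip_def)
  show ?thesis unfolding * closure_Times by simp
qed

lemma closure_half_strip: "closure (half_strip \<tau>) = {0..1} \<times> {\<tau>..}"
proof -
  have "half_strip \<tau> = {0<..<1} \<times> {\<tau><..}" by (auto simp: half_strip_def)
  then show ?thesis by (simp only: closure_Times) simp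
qed

text \<open>
  \<open>ux\<close> and \<open>ut\<close> are the partial derivatives of \<open>u\<close> on \<open>S\<close>; at boundary points of a closed strip
  these are the one-sided ones.
\<close>

definition has_partials_on ::
    "(real \<times> real \<Rightarrow> real) \<Rightarrow> (real \<times> real \<Rightarrow> real) \<Rightarrow> (real \<times> real \<Rightarrow> real) \<Rightarrow> (real \<times> real) set \<Rightarrow> bool"
  where "has_partials_on u ux ut S \<longleftrightarrow> (\<forall>(x, t)\<in>S.
    ((\<lambda>y. u (y, t)) has_real_derivative ux (x, t)) (at x within {y. (y, t) \<in> S}) \<and>
    ((\<lambda>s. u (x, s)) has_real_derivative ut (x, t)) (at t within {s. (x, s) \<in> S}))"

definition C1_on :: "(real \<times> real) set \<Rightarrow> (real \<times> real \<Rightarrow> real) set"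
  where "C1_on S = {u. continuous_on S u \<and>
    (\<exists>ux ut. has_partials_on u ux ut S \<and> continuous_on S ux \<and> continuous_on S ut)}"

definition BC :: "(real \<times> real) set \<Rightarrow> (real \<times> real \<Rightarrow> real) set"
  where "BC D = {u. continuous_on (closure D) u \<and> bounded (u ` closure D)}"

definition BC1 :: "(real \<times> real) set \<Rightarrow> (real \<times> real \<Rightarrow> real) set"
  where "BC1 D = {u \<in> BC D.
    \<exists>ux ut. has_partials_on u ux ut (closure D) \<and> ux \<in> BC D \<and> ut \<in> BC D}"

text \<open>Smooth functions with compact support in \<open>(0,1)\<close>, extended by zero to the real line.\<close>

definition test_functions :: "(real \<Rightarrow> real) set"
  where "test_functions = {\<phi>. (\<forall>k. (deriv ^^ k) \<phi> differentiable_on UNIV) \<and>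
    (\<exists>K. compact K \<and> K \<subseteq> {0<..<1} \<and> (\<forall>x. x \<notin> K \<longrightarrow> \<phi> x = 0))}"


section \<open>The initial-boundary value problem\<close>

text \<open>
  The components are indexed by a finite linear order \<open>'n\<close> with \<open>n\<close> elements; \<open>pos\<close> is the
  order isomorphism onto \<open>{1,\<dots>,n}\<close>.
\<close>

definition pos :: "'n::{finite, linorder} \<Rightarrow> nat"
  where "pos j = card {..j}"

definition boundary_rhs :: "nat \<Rightarrow> ('n::{finite, linorder} \<Rightarrow> 'n \<Rightarrow> real) \<Rightarrow>
    ('n \<Rightarrow> real \<times> real \<Rightarrow> real) \<Rightarrow> 'n \<Rightarrow> real \<Rightarrow> real"
  where "boundary_rhs m p u j t =
    (\<Sum>k | pos k \<le> m. p j k * u k (1, t)) + (\<Sum>k | pos k > m. p j k * u k (0, t))"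

definition classical_solution :: "nat \<Rightarrow> ('n::{finite, linorder} \<Rightarrow> 'n \<Rightarrow> real) \<Rightarrow>
    ('n \<Rightarrow> real \<times> real \<Rightarrow> real) \<Rightarrow> ('n \<Rightarrow> 'n \<Rightarrow> real \<times> real \<Rightarrow> real) \<Rightarrow>
    real \<Rightarrow> ('n \<Rightarrow> real \<Rightarrow> real) \<Rightarrow> ('n \<Rightarrow> real \<times> real \<Rightarrow> real) \<Rightarrow> bool"
  where "classical_solution m p a b \<tau> \<phi> u \<longleftrightarrow>
    (\<forall>j. u j \<in> C1_on (closure (half_strip \<tau>))) \<and>
    (\<forall>j. \<forall>(x, t)\<in>half_strip \<tau>.
      deriv (\<lambda>s. u j (x, s)) t + a j (x, t) * deriv (\<lambda>y. u j (y, t)) x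
        + (\<Sum>k\<in>UNIV. b j k (x, t) * u k (x, t)) = 0) \<and>
    (\<forall>j. \<forall>t\<ge>\<tau>. pos j \<le> m \<longrightarrow> u j (0, t) = boundary_rhs m p u j t) \<and>
    (\<forall>j. \<forall>t\<ge>\<tau>. pos j > m \<longrightarrow> u j (1, t) = boundary_rhs m p u j t) \<and>
    (\<forall>j. \<forall>x\<in>{0..1}. u j (x, \<tau>) = \<phi> j x)"

abbreviation L2_vec :: "('n::finite \<Rightarrow> real \<Rightarrow> real) \<Rightarrow> (L2, 'n) max_pow"
  where "L2_vec \<phi> \<equiv> Max_Pow (\<lambda>j. L2_class (\<phi> j))"

definition approximating_data ::
    "(L2, 'n::finite) max_pow \<Rightarrow> (nat \<Rightarrow> 'n \<Rightarrow> real \<Rightarrow> real) \<Rightarrow> bool"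
  where "approximating_data \<phi> \<psi> \<longleftrightarrow>
    (\<forall>l j. \<psi> l j \<in> test_functions) \<and> (\<lambda>l. L2_vec (\<psi> l)) \<longlonglongrightarrow> \<phi>"

definition locally_uniform_L2_limit ::
    "real \<Rightarrow> (nat \<Rightarrow> 'n::finite \<Rightarrow> real \<times> real \<Rightarrow> real) \<Rightarrow> (real \<Rightarrow> (L2, 'n) max_pow) \<Rightarrow> bool"
  where "locally_uniform_L2_limit \<tau> v u \<longleftrightarrow>
    (\<forall>t>\<tau>. uniform_limit {\<tau>..t} (\<lambda>l \<theta>. L2_vec (\<lambda>j x. v l j (x, \<theta>))) u sequentially)"

definition L2_generalized_solution :: "nat \<Rightarrow> ('n::{finite, linorder} \<Rightarrow> 'n \<Rightarrow> real) \<Rightarrow>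
    ('n \<Rightarrow> real \<times> real \<Rightarrow> real) \<Rightarrow> ('n \<Rightarrow> 'n \<Rightarrow> real \<times> real \<Rightarrow> real) \<Rightarrow>
    real \<Rightarrow> (L2, 'n) max_pow \<Rightarrow> (real \<Rightarrow> (L2, 'n) max_pow) \<Rightarrow> bool"
  where "L2_generalized_solution m p a b \<tau> \<phi> u \<longleftrightarrow>
    continuous_on {\<tau>..} u \<and> u \<tau> = \<phi> \<and>
    (\<exists>\<psi> v. approximating_data \<phi> \<psi> \<and>
      (\<forall>l. classical_solution m p a b \<tau> (\<psi> l) (v l)) \<and> locally_uniform_L2_limit \<tau> v u)"

text \<open>
  The second conjunct is the classical well-posedness for test data on which the notion of an
  \<open>L\<^sup>2\<close>-generalized solution rests; without it the last conjunct could hold vacuously for some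
  approximating sequences. Solutions are compared on the closed half-strip only, since values
  elsewhere carry no meaning. The last conjunct is the independence of the approximating
  sequence.
\<close>

definition generates :: "nat \<Rightarrow> ('n::{finite, linorder} \<Rightarrow> 'n \<Rightarrow> real) \<Rightarrow>
    ('n \<Rightarrow> real \<times> real \<Rightarrow> real) \<Rightarrow> ('n \<Rightarrow> 'n \<Rightarrow> real \<times> real \<Rightarrow> real) \<Rightarrow>
    (real \<Rightarrow> real \<Rightarrow> ((L2, 'n) max_pow \<Rightarrow>\<^sub>L (L2, 'n) max_pow)) \<Rightarrow> bool"
  where "generates m p a b U \<longleftrightarrow>
    evolution_family U \<and>
    (\<forall>\<tau> \<phi>. (\<forall>j. \<phi> j \<in> test_functions) \<longrightarrow>
      (\<exists>u. classical_solution m p a b \<tau> \<phi> u \<and>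
        (\<forall>v. classical_solution m p a b \<tau> \<phi> v \<longrightarrow>
          (\<forall>j. \<forall>z\<in>closure (half_strip \<tau>). v j z = u j z)))) \<and>
    (\<forall>\<tau> \<phi>. L2_generalized_solution m p a b \<tau> \<phi> (\<lambda>t. blinfun_apply (U t \<tau>) \<phi>)) \<and>
    (\<forall>\<tau> \<phi> \<psi> v. approximating_data \<phi> \<psi> \<and> (\<forall>l. classical_solution m p a b \<tau> (\<psi> l) (v l)) \<longrightarrow>
      locally_uniform_L2_limit \<tau> v (\<lambda>t. blinfun_apply (U t \<tau>) \<phi>))"

end

theory Submission
  imports Defs "HOL-Real_Asymp.Real_Asymp"
begin

text \<open>
  Weighting the \<open>L\<^sup>2\<close>-norm so that the weight is large at the outflow ends makes the boundary
  terms of the energy identity dissipative; Gronwall's inequality then bounds every \<open>C\<^sup>1\<close>-solution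
  by its initial state, uniformly in the initial time. This yields uniqueness, the exponential
  bound, the extension of the solution operators from test data to \<open>L\<^sup>2\<close>, the cocycle identity
  and, with a source term, uniform continuity at the initial time for smooth data.

  Classical solutions come from the method of characteristics. Reflecting the components with
  negative speed lets every component enter at \<open>x = 0\<close>, and the characteristics, written as
  \<open>t = \<Omega>(x, s)\<close> with \<open>s\<close> the entry time, turn each equation into an ordinary one in \<open>x\<close>. Subtracting
  a first-order Taylor approximation in time leaves a problem with zero past, which a Neumann
  series solves: weights \<open>e\<^bsup>\<nu>(t-\<tau>)-\<kappa>x\<^esup>\<close> make the solution operator contract functions and their
  \<open>t\<close>-derivatives simultaneously.
\<close>

section \<open>Test functions are dense in \<open>L\<^sup>2\<close>\<close>

text \<open>The matrices \<open>p\<close> and \<open>b\<close> have arbitrary size, so neither the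
  feedback through the boundary nor the coupling is a small perturbation. The two weights separate
  these effects. At the outflow end the spatial weight has dropped to
  \<open>exp (- \<kappa>)\<close>, which absorbs \<open>p\<close>. With \<kappa> fixed, a large
  \<nu> makes integrals along characteristics small, which absorbs the coupling even after the loss
  of a factor \<open>exp \<kappa>\<close>. Only a function and its t-derivative are iterated; the
  equation itself returns the x-derivative.

  A \<open>C1\<close> solution requires initial and boundary data that are compatible to first order
  at the two corners. Test data vanish near both ends, so both coefficients of the Taylor
  approximation vanish at the ends and the remainder can be posed for all real t with zero past.
  What survives is a jump of the t-derivative of the source across t = \<tau>, which integration
  along characteristics transversal to that line smooths out.

  Joint strong continuity on the diagonal does not follow from continuity for each fixed \<tau>: the
  small-time estimate must be uniform in \<tau>. It is, because the coefficient bounds are global in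
  time.\<close>

definition smooth :: "(real \<Rightarrow> real) \<Rightarrow> bool"
  where "smooth f \<longleftrightarrow> (\<forall>k. (deriv ^^ k) f differentiable_on UNIV)"

text \<open>All iterated derivatives stay in \<open>S\<close>, by induction on their order.
  Smoothness of sums, products and the flat functions thereby reduces to finding a class that is
  closed under one differentiation.\<close>

lemma smooth_coinduct:
  assumes "f \<in> S"
    and S: "\<And>f. f \<in> S \<Longrightarrow> \<exists>f'\<in>S. \<forall>x. (f has_real_derivative f' x) (at x)"
  shows "smooth f"
proof -
  have *: "g differentiable_on UNIV \<and> deriv g \<in> S" if gS: "g \<in> S" for g
  proof -
    obtain g' where g': "g' \<in> S" "\<And>x. (g has_real_derivative g' x) (at x)"
      using S[OF gS] by blast
    then have "deriv g = g'" by (intro ext DERIV_imp_deriv)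
    then show ?thesis
      using g' by (auto simp: differentiable_on_def real_differentiable_def)
  qed
  have "(deriv ^^ k) f \<in> S" for k
    by (induction k) (use assms(1) * in auto)
  then show ?thesis using * by (simp add: smooth_def)
qed

lemma smooth_has_derivative:
  assumes "smooth f"
  shows "(f has_real_derivative deriv f x) (at x)"
proof -
  have "(deriv ^^ 0) f differentiable_on UNIV" using assms unfolding smooth_def by blast
  then show ?thesis
    by (simp add: differentiable_on_def real_differentiable_def DERIV_deriv_iff_real_differentiable)
qed

lemma smooth_deriv: "smooth f \<Longrightarrow> smooth (deriv f)"
  unfolding smooth_def by (metis funpow_Suc_right o_apply)

lemma smooth_add:
  assumes "smooth f" "smooth g"
  shows "smooth (\<lambda>x. f x + g x)"
proof (rule smooth_coinduct[where S = "{\<lambda>x. f x + g x |f g. smooth f \<and> smooth g}"])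
  fix u assume "u \<in> {\<lambda>x. f x + g x |f g. smooth f \<and> smooth g}"
  then obtain f g where u: "u = (\<lambda>x. f x + g x)" "smooth f" "smooth g" by blast
  show "\<exists>f'\<in>{\<lambda>x. f x + g x |f g. smooth f \<and> smooth g}. \<forall>x. (u has_real_derivative f' x) (at x)"
    using u by (intro bexI[of _ "\<lambda>x. deriv f x + deriv g x"])
      (auto intro!: DERIV_add smooth_has_derivative smooth_deriv)
next
  show "(\<lambda>x. f x + g x) \<in> {\<lambda>x. f x + g x |f g. smooth f \<and> smooth g}"
    unfolding mem_Collect_eq using assms by (intro exI[of _ f] exI[of _ g]) simp
qed

lemma smooth_affine:
  assumes "smooth f"
  shows "smooth (\<lambda>x. C * f (a * x + b))"
proof (rule smooth_coinduct[where S = "{\<lambda>x. C * f (a * x + b) |f C. smooth f}"])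
  fix u assume "u \<in> {\<lambda>x. C * f (a * x + b) |f C. smooth f}"
  then obtain f C where u: "u = (\<lambda>x. C * f (a * x + b))" "smooth f" by blast
  have "(u has_real_derivative (C * a) * deriv f (a * x + b)) (at x)" for x
    unfolding u by (rule derivative_eq_intros DERIV_chain'[OF _ smooth_has_derivative[OF u(2)]] refl)+ simp
  then show "\<exists>f'\<in>{\<lambda>x. C * f (a * x + b) |f C. smooth f}. \<forall>x. (u has_real_derivative f' x) (at x)"
    using smooth_deriv[OF u(2)] by (intro bexI[of _ "\<lambda>x. C * a * deriv f (a * x + b)"]) auto
next
  show "(\<lambda>x. C * f (a * x + b)) \<in> {\<lambda>x. C * f (a * x + b) |f C. smooth f}"
    unfolding mem_Collect_eq using assms by (intro exI[of _ f] exI[of _ C]) simp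
qed

text \<open>Products alone are not closed under differentiation, since the Leibniz rule produces a
  sum; closing them under addition yields a class for \<open>smooth_coinduct\<close>.\<close>

inductive_set product_sums :: "(real \<Rightarrow> real) set"
  where mult: "smooth f \<Longrightarrow> smooth g \<Longrightarrow> (\<lambda>x. f x * g x) \<in> product_sums"
  | add: "f \<in> product_sums \<Longrightarrow> g \<in> product_sums \<Longrightarrow> (\<lambda>x. f x + g x) \<in> product_sums"

lemma smooth_mult:
  assumes "smooth f" "smooth g"
  shows "smooth (\<lambda>x. f x * g x)"
proof (rule smooth_coinduct[OF product_sums.mult[OF assms]])
  fix u assume "u \<in> product_sums"
  then show "\<exists>f'\<in>product_sums. \<forall>x. (u has_real_derivative f' x) (at x)"
  proof induction
    case (mult f g)
    have "((\<lambda>x. f x * g x) has_real_derivative f x * deriv g x + deriv f x * g x) (at x)" for x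
      using DERIV_mult'[OF smooth_has_derivative[OF mult(1)] smooth_has_derivative[OF mult(2)]] .
    then show ?case
      by (intro bexI[of _ "\<lambda>x. f x * deriv g x + deriv f x * g x"] allI)
        (auto intro!: product_sums.intros mult smooth_deriv)
  next
    case (add f g)
    then obtain f' g' where "f' \<in> product_sums" "\<forall>x. (f has_real_derivative f' x) (at x)"
      "g' \<in> product_sums" "\<forall>x. (g has_real_derivative g' x) (at x)" by blast
    then show ?case
      by (intro bexI[of _ "\<lambda>x. f' x + g' x"]) (auto intro!: DERIV_add product_sums.intros)
  qed
qed

text \<open>\<open>flat 0\<close> is the classical function exp(-1/x), extended by zero. The powers
  of 1/x are those that differentiation creates, so the linear span of the family is closed under
  it.\<close>

definition flat :: "nat \<Rightarrow> real \<Rightarrow> real"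
  where "flat k x = (if x > 0 then (1 / x) ^ k * exp (- (1 / x)) else 0)"

lemma flat_tendsto_0: "(flat k \<longlongrightarrow> 0) (at 0)"
proof -
  have "((\<lambda>y::real. y ^ k / exp y) \<longlongrightarrow> 0) at_top" by (rule tendsto_power_div_exp_0)
  from filterlim_compose[OF this filterlim_inverse_at_top_right]
  have "((\<lambda>x::real. inverse x ^ k / exp (inverse x)) \<longlongrightarrow> 0) (at_right 0)" .
  then have "(flat k \<longlongrightarrow> 0) (at_right 0)"
    by (rule Lim_transform_eventually)
      (auto simp: eventually_at_right_less flat_def exp_minus divide_simps
        eventually_at_filter)
  moreover have "(flat k \<longlongrightarrow> 0) (at_left 0)"
    by (rule tendsto_eventually) (auto simp: eventually_at_filter flat_def)
  ultimately show ?thesis by (simp add: filterlim_split_at)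
qed

lemma flat_derivative:
  "(flat k has_real_derivative - real k * flat (Suc k) x + flat (Suc (Suc k)) x) (at x)"
proof -
  consider "x > 0" | "x < 0" | "x = 0" by linarith
  then show ?thesis
  proof cases
    case 1
    have "((\<lambda>x. (1 / x) ^ k * exp (- (1 / x))) has_real_derivative
        - real k * flat (Suc k) x + flat (Suc (Suc k)) x) (at x)"
      using 1 by (auto intro!: derivative_eq_intros simp: flat_def)
        (cases k; simp add: field_simps power2_eq_square)
    then show ?thesis
      by (rule has_field_derivative_transform_within_open[where S = "{0<..}"])
        (use 1 in \<open>auto simp: flat_def\<close>)
  next
    case 2
    have "((\<lambda>x. 0) has_real_derivative - real k * flat (Suc k) x + flat (Suc (Suc k)) x) (at x)"
      using 2 by (auto simp: flat_def)
    then show ?thesis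
      by (rule has_field_derivative_transform_within_open[where S = "{..<0}"])
        (use 2 in \<open>auto simp: flat_def\<close>)
  next
    case 3
    \<comment> \<open>At the origin the difference quotient of \<open>flat k\<close> is
      \<open>flat (Suc k)\<close>, whose limit is already known to be zero.\<close>
    have "((\<lambda>y. (flat k y - flat k 0) / (y - 0)) \<longlongrightarrow> 0) (at 0)"
      by (rule Lim_transform_eventually[OF flat_tendsto_0[of "Suc k"]])
        (auto simp: eventually_at_filter flat_def field_simps)
    then show ?thesis using 3 by (simp add: has_field_derivative_iff flat_def)
  qed
qed

inductive_set flat_sums :: "(real \<Rightarrow> real) set"
  where scale: "(\<lambda>x. c * flat k x) \<in> flat_sums"
  | add: "f \<in> flat_sums \<Longrightarrow> g \<in> flat_sums \<Longrightarrow> (\<lambda>x. f x + g x) \<in> flat_sums"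

lemma smooth_flat: "smooth (flat k)"
proof (rule smooth_coinduct[where S = flat_sums])
  show "flat k \<in> flat_sums" using flat_sums.scale[of 1 k] by simp
  fix u assume "u \<in> flat_sums"
  then show "\<exists>f'\<in>flat_sums. \<forall>x. (u has_real_derivative f' x) (at x)"
  proof induction
    case (scale c k)
    have "((\<lambda>x. c * flat k x) has_real_derivative
        - (c * real k) * flat (Suc k) x + c * flat (Suc (Suc k)) x) (at x)" for x
      using DERIV_cmult[OF flat_derivative[of k x], of c] by (simp add: algebra_simps)
    then show ?case
      by (intro bexI[of _ "\<lambda>x. - (c * real k) * flat (Suc k) x + c * flat (Suc (Suc k)) x"] allI)
        (assumption | intro flat_sums.intros)+
  next
    case (add f g)
    then obtain f' g' where "f' \<in> flat_sums" "\<forall>x. (f has_real_derivative f' x) (at x)"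
      "g' \<in> flat_sums" "\<forall>x. (g has_real_derivative g' x) (at x)" by blast
    then show ?case
      by (intro bexI[of _ "\<lambda>x. f' x + g' x"]) (auto intro!: DERIV_add flat_sums.intros)
  qed
qed

section \<open>Linear structure and derivatives of test functions\<close>

lemma test_functions_iff: "\<phi> \<in> test_functions \<longleftrightarrow>
    smooth \<phi> \<and> (\<exists>K. compact K \<and> K \<subseteq> {0<..<1} \<and> (\<forall>x. x \<notin> K \<longrightarrow> \<phi> x = 0))"
  by (simp add: test_functions_def smooth_def)

lemma test_functions_add:
  assumes "f \<in> test_functions" "g \<in> test_functions"
  shows "(\<lambda>x. f x + g x) \<in> test_functions"
proof -
  obtain K L where "compact K" "K \<subseteq> {0<..<1}" "\<forall>x. x \<notin> K \<longrightarrow> f x = 0"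
    "compact L" "L \<subseteq> {0<..<1}" "\<forall>x. x \<notin> L \<longrightarrow> g x = 0"
    using assms by (auto simp: test_functions_iff)
  then have "compact (K \<union> L) \<and> K \<union> L \<subseteq> {0<..<1} \<and> (\<forall>x. x \<notin> K \<union> L \<longrightarrow> f x + g x = 0)"
    by auto
  then show ?thesis
    using smooth_add[of f g] assms unfolding test_functions_iff by blast
qed

lemma test_functions_scale:
  assumes "f \<in> test_functions"
  shows "(\<lambda>x. c * f x) \<in> test_functions"
proof -
  obtain K where "compact K" "K \<subseteq> {0<..<1}" "\<forall>x. x \<notin> K \<longrightarrow> f x = 0"
    using assms by (auto simp: test_functions_iff)
  then have "compact K \<and> K \<subseteq> {0<..<1} \<and> (\<forall>x. x \<notin> K \<longrightarrow> c * f x = 0)" by simp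
  moreover have "smooth (\<lambda>x. c * f x)"
    using smooth_affine[of f c 1 0] assms by (simp add: test_functions_iff)
  ultimately show ?thesis unfolding test_functions_iff by blast
qed

lemma test_functions_zero: "(\<lambda>x. 0) \<in> test_functions"
  using smooth_affine[OF smooth_flat, of 0 0 0 0] by (auto simp: test_functions_iff)

lemma test_function_derivative:
  assumes "\<phi> \<in> test_functions"
  shows "(\<phi> has_real_derivative deriv \<phi> x) (at x)"
  using assms by (auto simp: test_functions_iff intro: smooth_has_derivative)

lemma test_functions_deriv:
  assumes "\<phi> \<in> test_functions"
  shows "deriv \<phi> \<in> test_functions"
proof -
  obtain K where K: "compact K" "K \<subseteq> {0<..<1}" "\<forall>x. x \<notin> K \<longrightarrow> \<phi> x = 0"
    using assms by (auto simp: test_functions_iff)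
  have "deriv \<phi> x = 0" if "x \<notin> K" for x
  proof -
    have "((\<lambda>x. 0) has_real_derivative deriv \<phi> x) (at x)"
      by (rule has_field_derivative_transform_within_open[OF test_function_derivative[OF assms],
            where S = "- K"]) (use K compact_imp_closed that in auto)
    then show ?thesis by (rule DERIV_unique) simp
  qed
  then show ?thesis
    using K assms unfolding test_functions_iff by (blast intro: smooth_deriv)
qed

lemma test_function_continuous:
  assumes "\<phi> \<in> test_functions"
  shows "continuous_on S \<phi>"
  by (meson DERIV_isCont assms continuous_at_imp_continuous_on test_function_derivative)

lemma test_function_boundary:
  assumes "\<phi> \<in> test_functions"
  shows "\<phi> 0 = 0" "\<phi> 1 = 0"
  using assms by (force simp: test_functions_iff)+

lemma test_function_square_integrable:
  "\<phi> \<in> test_functions \<Longrightarrow> square_integrable \<phi>"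
  by (intro square_integrable_continuous test_function_continuous)

lemma L2_class_add:
  "square_integrable f \<Longrightarrow> square_integrable g \<Longrightarrow>
    L2_class (\<lambda>x. f x + g x) = L2_class f + L2_class g"
  by transfer (simp add: square_integrable_add)

lemma L2_class_scale:
  "square_integrable f \<Longrightarrow> L2_class (\<lambda>x. c * f x) = c *\<^sub>R L2_class f"
  by transfer (simp add: square_integrable_scale)

text \<open>The squared distance to the limit is at most \<open>4 * (G x)\<^sup>2\<close>, so the
  scalar dominated convergence theorem applies to it. Every passage to the limit in the density
  proof goes through this lemma: from bumps to intervals, from partial to countable disjoint unions,
  from simple to Borel functions.\<close>

lemma L2_dominated_convergence:
  assumes G: "square_integrable G"
    and meas: "g \<in> borel_measurable U01" "\<And>l. f l \<in> borel_measurable U01"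
    and le: "\<And>l x. x \<in> {0<..<1} \<Longrightarrow> \<bar>f l x\<bar> \<le> G x"
    and lim: "\<And>x. x \<in> {0<..<1} \<Longrightarrow> (\<lambda>l. f l x) \<longlonglongrightarrow> g x"
  shows "square_integrable g" "\<And>l. square_integrable (f l)"
    "(\<lambda>l. L2_class (f l)) \<longlonglongrightarrow> L2_class g"
proof -
  have sq: "square_integrable h" if "h \<in> borel_measurable U01"
    "\<And>x. x \<in> {0<..<1} \<Longrightarrow> \<bar>h x\<bar> \<le> G x" for h
    unfolding square_integrable_def
  proof
    show "integrable U01 (\<lambda>x. (h x)\<^sup>2)"
    proof (rule Bochner_Integration.integrable_bound)
      show "integrable U01 (\<lambda>x. (G x)\<^sup>2)" using G by (simp add: square_integrable_def)
      show "(\<lambda>x. (h x)\<^sup>2) \<in> borel_measurable U01" using that by simp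
      show "AE x in U01. norm ((h x)\<^sup>2) \<le> norm ((G x)\<^sup>2)"
      proof (rule AE_I2)
        fix x assume "x \<in> space U01"
        then have "\<bar>h x\<bar> \<le> \<bar>G x\<bar>" using that(2)[of x] by simp
        then show "norm ((h x)\<^sup>2) \<le> norm ((G x)\<^sup>2)" by (simp add: abs_le_square_iff)
      qed
    qed
  qed (use that in auto)
  have gG: "\<bar>g x\<bar> \<le> G x" if "x \<in> {0<..<1}" for x
    by (rule LIMSEQ_le_const2[OF tendsto_rabs[OF lim[OF that]]]) (use le[OF that] in auto)
  show g: "square_integrable g" and f: "square_integrable (f l)" for l
    using sq meas le gG by auto
  have "(\<lambda>l. \<integral>x. (f l x - g x)\<^sup>2 \<partial>U01) \<longlonglongrightarrow> (\<integral>x. 0 \<partial>U01)"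
  proof (rule integral_dominated_convergence[where w = "\<lambda>x. 4 * (G x)\<^sup>2"])
    show "integrable U01 (\<lambda>x. 4 * (G x)\<^sup>2)" using G by (simp add: square_integrable_def)
    show "AE x in U01. (\<lambda>l. (f l x - g x)\<^sup>2) \<longlonglongrightarrow> 0"
    proof (rule AE_I2)
      fix x assume "x \<in> space U01"
      then have "(\<lambda>l. f l x - g x) \<longlonglongrightarrow> 0" using lim[of x] by (simp add: LIM_zero)
      from tendsto_power[OF this, of 2] show "(\<lambda>l. (f l x - g x)\<^sup>2) \<longlonglongrightarrow> 0" by simp
    qed
    show "AE x in U01. norm ((f l x - g x)\<^sup>2) \<le> 4 * (G x)\<^sup>2" for l
    proof (rule AE_I2)
      fix x assume "x \<in> space U01"
      then have "\<bar>f l x\<bar> \<le> G x" "\<bar>g x\<bar> \<le> G x" using le gG by auto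
      then have "\<bar>f l x - g x\<bar> \<le> 2 * G x" by linarith
      then have "(f l x - g x)\<^sup>2 \<le> (2 * G x)\<^sup>2" using abs_le_square_iff[of "f l x - g x" "2 * G x"] by linarith
      then show "norm ((f l x - g x)\<^sup>2) \<le> 4 * (G x)\<^sup>2" by simp
    qed
  qed (use meas in auto)
  then have "(\<lambda>l. sqrt (\<integral>x. (f l x - g x)\<^sup>2 \<partial>U01)) \<longlonglongrightarrow> sqrt 0"
    by (intro tendsto_real_sqrt) simp
  then have "(\<lambda>l. norm (L2_class (f l) - L2_class g)) \<longlonglongrightarrow> 0"
    by (simp add: L2_class_diff norm_L2_class f g square_integrable_diff)
  then show "(\<lambda>l. L2_class (f l)) \<longlonglongrightarrow> L2_class g"
    by (simp add: LIM_zero_cancel tendsto_norm_zero_iff)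
qed

section \<open>The closure of the test functions in L2\<close>

abbreviation "test_closure \<equiv> closure (L2_class ` test_functions)"

lemma test_closure_iff:
  "F \<in> test_closure \<longleftrightarrow> (\<exists>f. (\<forall>n::nat. f n \<in> test_functions) \<and> (\<lambda>n. L2_class (f n)) \<longlonglongrightarrow> F)"
proof
  assume "F \<in> test_closure"
  then obtain y where y: "\<And>n. y n \<in> L2_class ` test_functions" "y \<longlonglongrightarrow> F"
    unfolding closure_sequential by blast
  then have "\<forall>n. \<exists>f. f \<in> test_functions \<and> y n = L2_class f" by blast
  then obtain f where "\<And>n. f n \<in> test_functions" "y = (\<lambda>n. L2_class (f n))" by metis
  then show "\<exists>f. (\<forall>n::nat. f n \<in> test_functions) \<and> (\<lambda>n. L2_class (f n)) \<longlonglongrightarrow> F"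
    using y(2) by blast
next
  assume "\<exists>f. (\<forall>n::nat. f n \<in> test_functions) \<and> (\<lambda>n. L2_class (f n)) \<longlonglongrightarrow> F"
  then obtain f where "\<And>n::nat. f n \<in> test_functions" "(\<lambda>n. L2_class (f n)) \<longlonglongrightarrow> F" by blast
  then show "F \<in> test_closure"
    unfolding closure_sequential by (intro exI[of _ "\<lambda>n. L2_class (f n)"]) auto
qed

lemma test_closure_add:
  assumes "F \<in> test_closure" "H \<in> test_closure"
  shows "F + H \<in> test_closure"
proof -
  obtain f h where fh: "\<And>n::nat. f n \<in> test_functions" "(\<lambda>n. L2_class (f n)) \<longlonglongrightarrow> F"
    "\<And>n. h n \<in> test_functions" "(\<lambda>n. L2_class (h n)) \<longlonglongrightarrow> H"
    using assms unfolding test_closure_iff by blast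
  have "(\<lambda>n. L2_class (\<lambda>x. f n x + h n x)) \<longlonglongrightarrow> F + H"
    using tendsto_add[OF fh(2,4)] fh by (simp add: L2_class_add test_function_square_integrable)
  then show ?thesis
    unfolding test_closure_iff using fh
    by (intro exI[of _ "\<lambda>n x. f n x + h n x"]) (auto intro: test_functions_add)
qed

lemma test_closure_scale:
  assumes "F \<in> test_closure"
  shows "c *\<^sub>R F \<in> test_closure"
proof -
  obtain f where f: "\<And>n::nat. f n \<in> test_functions" "(\<lambda>n. L2_class (f n)) \<longlonglongrightarrow> F"
    using assms unfolding test_closure_iff by blast
  have "(\<lambda>n. L2_class (\<lambda>x. c * f n x)) \<longlonglongrightarrow> c *\<^sub>R F"
    using tendsto_scaleR[OF tendsto_const f(2), of c] f
    by (simp add: L2_class_scale test_function_square_integrable)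
  then show ?thesis
    unfolding test_closure_iff using f
    by (intro exI[of _ "\<lambda>n x. c * f n x"]) (auto intro: test_functions_scale)
qed

lemma test_closure_sum:
  assumes "finite I" "\<And>i. i \<in> I \<Longrightarrow> square_integrable (f i) \<and> L2_class (f i) \<in> test_closure"
  shows "square_integrable (\<lambda>x. \<Sum>i\<in>I. f i x) \<and> L2_class (\<lambda>x. \<Sum>i\<in>I. f i x) \<in> test_closure"
  using assms
proof (induction I)
  case empty
  then show ?case
    using test_functions_zero by (auto simp: square_integrable_zero intro: subsetD[OF closure_subset])
next
  case (insert i I)
  then show ?case
    by (simp add: square_integrable_add L2_class_add test_closure_add)
qed

lemma test_closure_dominated:
  assumes "square_integrable G" "g \<in> borel_measurable U01" "\<And>l. f l \<in> borel_measurable U01"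
    and "\<And>l x. x \<in> {0<..<1} \<Longrightarrow> \<bar>f l x\<bar> \<le> G x"
    and "\<And>x. x \<in> {0<..<1} \<Longrightarrow> (\<lambda>l. f l x) \<longlonglongrightarrow> g x"
    and "\<And>l::nat. L2_class (f l) \<in> test_closure"
  shows "square_integrable g \<and> L2_class g \<in> test_closure"
proof -
  note * = L2_dominated_convergence[OF assms(1-5)]
  have "L2_class g \<in> test_closure"
    by (rule closed_sequentially[OF closed_closure assms(6) *(3)])
  then show ?thesis using *(1) by simp
qed

lemma square_integrable_one: "square_integrable (\<lambda>x. 1)"
  by (intro square_integrable_continuous continuous_intros)

lemma smooth_flat_affine:
  "smooth (\<lambda>x. flat k (r * (x - c) - e))" "smooth (\<lambda>x. flat k (r * (c - x) - e))"
proof -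
  have "1 * flat k (r * x + (- (r * c) - e)) = flat k (r * (x - c) - e)"
    "1 * flat k ((- r) * x + (r * c - e)) = flat k (r * (c - x) - e)" for x
    by (rule trans[OF mult_1 arg_cong[where f = "flat k"]], simp add: right_diff_distrib)+
  then show "smooth (\<lambda>x. flat k (r * (x - c) - e))" "smooth (\<lambda>x. flat k (r * (c - x) - e))"
    using smooth_affine[OF smooth_flat, of 1 k r "- (r * c) - e"]
      smooth_affine[OF smooth_flat, of 1 k "- r" "r * c - e"] by presburger+
qed

lemma indicator_interval_closure:
  fixes a b :: real
  shows "square_integrable (indicator {a<..<b}) \<and> L2_class (indicator {a<..<b}) \<in> test_closure"
proof -
  define c d where "c = max a 0" and "d = min b 1"
  \<comment> \<open>Subtracting 1 makes \<open>f l\<close> vanish within distance 1/(l+1) of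
    \<open>c\<close> and of \<open>d\<close>, which gives compact support inside (0,1) even if (a,b)
    reaches beyond it. The factor l+1 drives the argument of \<open>flat 0\<close> to infinity at
    each point between \<open>c\<close> and \<open>d\<close>, hence the value to 1.\<close>
  define f where "f l x = flat 0 (real (Suc l) * (x - c) - 1) * flat 0 (real (Suc l) * (d - x) - 1)"
    for l x
  have smooth_f: "smooth (f l)" for l
    unfolding f_def by (rule smooth_mult[OF smooth_flat_affine])
  have f_test: "f l \<in> test_functions" for l
  proof -
    define q where "q = 1 / real (Suc l)"
    define K where "K = {c + q..d - q}"
    have "0 < q" "c \<ge> 0" "d \<le> 1" by (simp_all add: c_def d_def q_def del: of_nat_Suc)
    then have "compact K" "K \<subseteq> {0<..<1}" by (auto simp: K_def)
    moreover have "f l x = 0" if "x \<notin> K" for x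
    proof -
      have "x - c < 1 / real (Suc l) \<or> d - x < 1 / real (Suc l)"
        using that by (auto simp: K_def q_def simp del: of_nat_Suc)
      then have "real (Suc l) * (x - c) < 1 \<or> real (Suc l) * (d - x) < 1"
        by (simp add: pos_less_divide_eq mult.commute del: of_nat_Suc)
      then show ?thesis by (auto simp: f_def flat_def)
    qed
    ultimately show ?thesis using smooth_f unfolding test_functions_iff by blast
  qed
  have flat01: "0 \<le> flat 0 x \<and> flat 0 x \<le> 1" for x by (simp add: flat_def)
  have flat_lim: "(\<lambda>l. flat 0 (real (Suc l) * y - 1)) \<longlonglongrightarrow> 1" if "y > 0" for y
  proof -
    have *: "filterlim (\<lambda>l. real (Suc l) * y - 1) at_top sequentially"
      using that by real_asymp
    have "(\<lambda>l. exp (- (1 / (real (Suc l) * y - 1)))) \<longlonglongrightarrow> exp (- 0)"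
      by (intro tendsto_intros tendsto_divide_0[OF tendsto_const] filterlim_at_top_imp_at_infinity *)
    moreover have "\<forall>\<^sub>F l in sequentially. real (Suc l) * y - 1 > 0"
      using * by (rule filterlim_at_top_dense[THEN iffD1, rule_format])
    then have "\<forall>\<^sub>F l in sequentially. exp (- (1 / (real (Suc l) * y - 1))) = flat 0 (real (Suc l) * y - 1)"
      by eventually_elim (simp add: flat_def)
    ultimately show ?thesis by (auto intro: Lim_transform_eventually)
  qed
  show ?thesis
  proof (rule test_closure_dominated[OF square_integrable_one])
    show "f l \<in> borel_measurable U01" for l
      using test_function_square_integrable[OF f_test] by (rule square_integrableD)
    show "(indicator {a<..<b} :: real \<Rightarrow> real) \<in> borel_measurable U01"
      by (intro measurable_restrict_space1 measurable_completion borel_measurable_indicator) simp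
    show "L2_class (f l) \<in> test_closure" for l
      using f_test closure_subset by blast
    show "\<bar>f l x\<bar> \<le> 1" for l x
      unfolding f_def abs_mult using flat01 by (intro mult_le_one) auto
    show "(\<lambda>l. f l x) \<longlonglongrightarrow> indicator {a<..<b} x" if "x \<in> {0<..<1}" for x
    proof (cases "x \<in> {a<..<b}")
      case True
      then have "x - c > 0" "d - x > 0" using that by (auto simp: c_def d_def)
      from tendsto_mult[OF flat_lim[OF this(1)] flat_lim[OF this(2)]] True
      show ?thesis by (simp add: f_def)
    next
      case False
      then have "x - c \<le> 0 \<or> d - x \<le> 0" using that by (auto simp: c_def d_def)
      then have "real (Suc l) * (x - c) \<le> 0 \<or> real (Suc l) * (d - x) \<le> 0" for l
        by (meson mult_nonneg_nonpos of_nat_0_le_iff)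
      then have "f l x = 0" for l
        by (smt (verit, ccfv_SIG) f_def flat_def mult_eq_0_iff)
      then show ?thesis using False by simp
    qed
  qed
qed

text \<open>A Dynkin argument: open intervals form an intersection-stable generator of the Borel
  sets, and the sets whose indicator is approximable are closed under complements and countable
  disjoint unions.\<close>

lemma indicator_borel_closure:
  fixes A :: "real set"
  assumes "A \<in> sets borel"
  shows "square_integrable (indicator A) \<and> L2_class (indicator A) \<in> test_closure"
proof -
  let ?G = "range (\<lambda>(a, b). {a<..<b}) :: real set set"
  have borel_G: "sets borel = sigma_sets UNIV ?G"
  proof -
    have "borel = sigma UNIV ?G" using borel_eq_box[where 'a = real] by (simp only: box_real)
    then show ?thesis by (rule ssubst) (rule sets_measure_of, simp)
  qed
  have meas: "(indicator A :: real \<Rightarrow> real) \<in> borel_measurable U01" if "A \<in> sets borel" for A :: "real set"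
    using that
    by (intro measurable_restrict_space1 measurable_completion borel_measurable_indicator) simp
  have "Int_stable ?G"
    unfolding Int_stable_def by (auto simp: image_iff)
  moreover have "?G \<subseteq> Pow UNIV" by simp
  moreover have "A \<in> sigma_sets UNIV ?G"
    using assms borel_G by simp
  ultimately show ?thesis
  proof (induction rule: sigma_sets_induct_disjoint)
    case (basic A)
    then show ?case using indicator_interval_closure by auto
  next
    case empty
    have "{0<..<0::real} = {}" by simp
    then show ?case using indicator_interval_closure[of 0 0] by metis
  next
    case (compl A)
    note A = conjunct1[OF compl(2)] conjunct2[OF compl(2)]
    have eq: "indicator (UNIV - A) = (\<lambda>x. indicator UNIV x + (-1) * indicator A x :: real)"
      by (auto simp: indicator_def)
    have one: "L2_class (indicator UNIV) \<in> test_closure" "square_integrable (indicator UNIV)"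
    proof -
      \<comment> \<open>The constant 1, from which a complement is subtracted, is the indicator of
        an open interval as far as the measure on (0,1) can see.\<close>
      have "L2_class (indicator {-1<..<2}) = L2_class (indicator UNIV)"
        using indicator_interval_closure[of "-1" 2] square_integrable_one
        by (subst L2_class_eq_iff) (auto simp: indicator_def[abs_def] intro!: AE_I2)
      then show "L2_class (indicator UNIV) \<in> test_closure"
        using indicator_interval_closure[of "-1" 2] by simp
      show "square_integrable (indicator UNIV)"
        using square_integrable_one by (simp add: indicator_def[abs_def])
    qed
    show ?case
      unfolding eq
      using square_integrable_add[OF one(2) square_integrable_scale[OF A(1), of "-1"]]
        test_closure_add[OF one(1) test_closure_scale[OF A(2), of "-1"]]
      unfolding L2_class_add[OF one(2) square_integrable_scale[OF A(1), of "-1"]] L2_class_scale[OF A(1)]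
      by (rule conjI)
  next
    case (union A)
    have A_borel: "A i \<in> sets borel" for i
      using union(2) borel_G by auto
    show ?case
    proof (rule test_closure_dominated[OF square_integrable_one])
      show "(indicator (\<Union> (range A)) :: real \<Rightarrow> real) \<in> borel_measurable U01"
        using A_borel by (intro meas) auto
      show "(\<lambda>x. \<Sum>i<l. indicator (A i) x :: real) \<in> borel_measurable U01" for l
        by (intro borel_measurable_sum meas A_borel)
      have disj: "disjoint_family_on A I" for I
        using union(1) unfolding disjoint_family_on_def by blast
      \<comment> \<open>Disjointness identifies the partial sums with indicators of finite unions,
        so that the constant 1 is a majorant.\<close>
      have eq: "(\<Sum>i<l. indicator (A i) x) = (indicator (\<Union>i<l. A i) x :: real)" for l x
        by (rule indicator_UN_disjoint[OF finite_lessThan disj, symmetric])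
      show "\<bar>\<Sum>i<l. indicator (A i) x\<bar> \<le> (1::real)" for l x
        unfolding eq by (simp add: indicator_def)
      show "(\<lambda>l. \<Sum>i<l. indicator (A i) x) \<longlonglongrightarrow> (indicator (\<Union> (range A)) x :: real)" for x
        unfolding eq by (rule LIMSEQ_indicator_UN)
      show "L2_class (\<lambda>x. \<Sum>i<l. indicator (A i) x) \<in> test_closure" for l
        using test_closure_sum[of "{..<l}" "\<lambda>i. indicator (A i)", OF finite_lessThan union(3)]
        by (rule conjunct2)
    qed
  qed
qed

text \<open>Elements of \<open>L2\<close> are classes of Lebesgue measurable functions, while the
  Dynkin argument reaches Borel sets only. A Borel representative bridges the gap; it is then
  approximated by simple functions.\<close>

lemma test_closure_UNIV: "test_closure = UNIV"
proof -
  have "F \<in> test_closure" for F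
  proof -
    obtain f where f: "square_integrable f" "F = L2_class f" using L2_class_surj by blast
    \<comment> \<open>Cutting off outside (0,1) turns measurability on the subspace into
      measurability on the line, where the completion supplies a Borel function that agrees almost
      everywhere.\<close>
    define f0 where "f0 x = f x * indicator {0<..<1} x" for x
    have "f0 \<in> borel_measurable lebesgue"
      using square_integrableD(1)[OF f(1)] unfolding f0_def
      by (simp add: borel_measurable_restrict_space_iff mult.commute)
    then obtain g where g: "g \<in> borel_measurable lborel" "AE x in lborel. f0 x = g x"
      using completion_ex_borel_measurable_real by blast
    have AE_lebesgue: "AE x in lebesgue. f0 x = g x" using g(2) by (simp add: AE_completion)
    have ae: "AE x in U01. f x = g x"
      using AE_lebesgue by (subst AE_restrict_space_iff) (auto simp: f0_def)
    have meas: "h \<in> borel_measurable U01" if "h \<in> borel_measurable borel" for h :: "real \<Rightarrow> real"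
      using that by (intro measurable_restrict_space1 measurable_completion) simp
    have g_meas: "g \<in> borel_measurable borel" using g by simp
    have sq: "square_integrable g"
    proof -
      have "AE x in U01. (f x)\<^sup>2 = (g x)\<^sup>2" using ae by eventually_elim simp
      then show ?thesis
        using f(1) meas[OF g_meas] integrable_cong_AE[of "\<lambda>x. (f x)\<^sup>2" U01 "\<lambda>x. (g x)\<^sup>2"]
        by (auto simp: square_integrable_def)
    qed
    \<comment> \<open>Approximation in a metric space towards the base point 0 yields simple
      functions that satisfy \<open>\<bar>s i x\<bar> \<le> 2 * \<bar>g x\<bar>\<close>, hence a
      square integrable majorant.\<close>
    obtain s where s: "\<And>i. simple_function borel (s i)" "\<And>x. (\<lambda>i. s i x) \<longlonglongrightarrow> g x"
      "\<And>i x. dist (s i x) 0 \<le> 2 * dist (g x) 0"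
      using borel_measurable_implies_sequence_metric[OF g_meas, of 0] by auto
    have "square_integrable g \<and> L2_class g \<in> test_closure"
    proof (rule test_closure_dominated[where G = "\<lambda>x. 2 * \<bar>g x\<bar>" and f = s])
      show "square_integrable (\<lambda>x. 2 * \<bar>g x\<bar>)"
        using sq by (auto simp: square_integrable_def power_mult_distrib)
      show "s l \<in> borel_measurable U01" for l
        using s(1) by (intro meas borel_measurable_simple_function)
      show "L2_class (s l) \<in> test_closure" for l
      proof -
        have "s l = (\<lambda>x. \<Sum>y\<in>range (s l). y * indicator (s l -` {y}) x)"
        proof
          fix x
          have "s l x = (\<Sum>y\<in>range (s l). if s l x = y then y else 0)"
            using simple_functionD(1)[OF s(1)[of l]] by (simp add: sum.delta)
          also have "\<dots> = (\<Sum>y\<in>range (s l). y * indicator (s l -` {y}) x)"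
            by (intro sum.cong) (auto simp: indicator_def)
          finally show "s l x = (\<Sum>y\<in>range (s l). y * indicator (s l -` {y}) x)" .
        qed
        moreover have "L2_class (\<lambda>x. \<Sum>y\<in>range (s l). y * indicator (s l -` {y}) x) \<in> test_closure"
        proof (rule test_closure_sum[THEN conjunct2])
          show "finite (range (s l))" using simple_functionD(1)[OF s(1)[of l]] by simp
          show "square_integrable (\<lambda>x. y * indicator (s l -` {y}) x) \<and>
              L2_class (\<lambda>x. y * indicator (s l -` {y}) x) \<in> test_closure" for y
            using indicator_borel_closure[of "s l -` {y}"] simple_functionD(2)[OF s(1)[of l], of "{y}"]
            by (auto simp: L2_class_scale square_integrable_scale test_closure_scale)
        qed
        ultimately show ?thesis by simp
      qed
      show "\<bar>s l x\<bar> \<le> 2 * \<bar>g x\<bar>" for l x using s(3)[of l x] by (simp add: dist_real_def)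
      show "(\<lambda>l. s l x) \<longlonglongrightarrow> g x" for x by (rule s(2))
    qed (use meas[OF g_meas] in auto)
    moreover have "L2_class g = F" using f sq ae by (simp add: L2_class_eq_iff eq_commute)
    ultimately show ?thesis by simp
  qed
  then show ?thesis by auto
qed

section \<open>Characteristics\<close>

lemma integral_scale01:
  fixes g :: "real \<Rightarrow> real"
  assumes "0 \<le> x" "continuous_on {0..x} g"
  shows "integral {0..x} g = x * integral {0..1} (\<lambda>\<theta>. g (x * \<theta>))"
proof (cases "x = 0")
  case False
  have "(g has_integral integral {0..x} g) {0..x}"
    using assms(2) by (intro integrable_integral integrable_continuous_real)
  from has_integral_stretch_real[OF this, of x] False
  have "((\<lambda>\<theta>. g (x * \<theta>)) has_integral (1 / \<bar>x\<bar>) * integral {0..x} g) ((\<lambda>y. y / x) ` {0..x})"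
    by simp
  moreover have "(\<lambda>y. y / x) ` {0..x} = {0..1}"
  proof -
    have "y \<in> (\<lambda>y. y / x) ` {0..x}" if "y \<in> {0..1}" for y
      using that False assms(1) by (intro image_eqI[of _ _ "x * y"]) (auto simp: mult_left_le)
    then show ?thesis using False assms(1) by (auto simp: divide_le_eq_1)
  qed
  ultimately have "integral {0..1} (\<lambda>\<theta>. g (x * \<theta>)) = (1 / \<bar>x\<bar>) * integral {0..x} g"
    by (simp add: integral_unique)
  then show ?thesis using False assms(1) by simp
qed simp

text \<open>Rescaling the integration variable by x moves the variable upper limit into the
  integrand over the fixed interval [0,1], where continuity of integrals depending on a parameter
  applies.\<close>

lemma integral_upper_continuous:
  fixes g :: "real \<Rightarrow> 'a::topological_space \<Rightarrow> real"
  assumes g: "continuous_on ({0..1} \<times> U) (\<lambda>(\<xi>, p). g \<xi> p)"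
  shows "continuous_on ({0..1} \<times> U) (\<lambda>(x, p). integral {0..x} (\<lambda>\<xi>. g \<xi> p))"
proof -
  have "continuous_on (({0..1} \<times> U) \<times> cbox 0 1) (\<lambda>(z, \<theta>). g (fst z * \<theta>) (snd z))"
    unfolding case_prod_beta
    by (rule continuous_on_compose2[OF g, unfolded case_prod_beta, of _ "\<lambda>w. (fst (fst w) * snd w, snd (fst w))", simplified])
      (auto intro!: continuous_intros mult_le_one)
  then have "continuous_on ({0..1} \<times> U) (\<lambda>z. integral (cbox 0 1) (\<lambda>\<theta>. g (fst z * \<theta>) (snd z)))"
    by (rule integral_continuous_on_param)
  then have "continuous_on ({0..1} \<times> U)
      (\<lambda>z. fst z * integral (cbox 0 1) (\<lambda>\<theta>. g (fst z * \<theta>) (snd z)))"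
    by (intro continuous_intros)
  then show ?thesis
  proof (rule continuous_on_cong[THEN iffD1, rotated -1])
    fix z assume "z \<in> {0..1::real} \<times> U"
    then obtain x p where z: "z = (x, p)" "x \<in> {0..1}" "p \<in> U" by auto
    have "continuous_on {0..x} (\<lambda>\<xi>. g \<xi> p)"
      using z by (intro continuous_on_compose2[OF g, of _ "\<lambda>\<xi>. (\<xi>, p)", simplified] continuous_intros) auto
    then show "fst z * integral (cbox 0 1) (\<lambda>\<theta>. g (fst z * \<theta>) (snd z))
        = (case z of (x, p) \<Rightarrow> integral {0..x} (\<lambda>\<xi>. g \<xi> p))"
      using z integral_scale01[of x "\<lambda>\<xi>. g \<xi> p"] by simp
  qed simp
qed

lemma continuous_on_strip_compose:
  assumes "continuous_on (X \<times> UNIV) (\<lambda>(x, t). u x t)"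
    and "continuous_on A g" "continuous_on A h" "g ` A \<subseteq> X"
  shows "continuous_on A (\<lambda>z. u (g z) (h z))"
  using continuous_on_compose2[OF assms(1) continuous_on_Pair[OF assms(2,3)]] assms(4)
  by auto

lemma continuous_on_strip_fst:
  assumes "continuous_on (X \<times> UNIV) (\<lambda>(x, t). u x t)" "x \<in> X"
  shows "continuous_on T (u x)"
  by (rule continuous_on_strip_compose[OF assms(1), of T "\<lambda>_. x" "\<lambda>t. t"]) (use assms(2) in auto)

lemma continuous_on_strip_snd:
  assumes "continuous_on (X \<times> UNIV) (\<lambda>(x, t). u x t)"
  shows "continuous_on X (\<lambda>x. u x t)"
  by (rule continuous_on_strip_compose[OF assms(1), of X "\<lambda>x. x" "\<lambda>_. t"]) auto

lemma continuous_on_triple_compose: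
  assumes "continuous_on (X \<times> UNIV) (\<lambda>(x, t, t'). u x t t')"
    and "continuous_on A g" "continuous_on A h" "continuous_on A k" "g ` A \<subseteq> X"
  shows "continuous_on A (\<lambda>z. u (g z) (h z) (k z))"
  using continuous_on_compose2[OF assms(1) continuous_on_Pair[OF assms(2)
        continuous_on_Pair[OF assms(3,4)]]] assms(5)
  by auto

text \<open>The slope of the chord of a function with derivative \<open>u'\<close>, extended continuously to
  the diagonal.\<close>

definition mean_slope :: "(real \<Rightarrow> real) \<Rightarrow> real \<Rightarrow> real \<Rightarrow> real"
  where "mean_slope u' t t' = integral {0..1} (\<lambda>\<theta>. u' (t + \<theta> * (t' - t)))"

lemma mean_slope_diff:
  assumes "\<And>t. (u has_real_derivative u' t) (at t)"
  shows "u t' - u t = (t' - t) * mean_slope u' t t'"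
proof -
  have "((\<lambda>\<theta>. (t' - t) * u' (t + \<theta> * (t' - t))) has_integral
      u (t + 1 * (t' - t)) - u (t + 0 * (t' - t))) {0..1}"
  proof (rule fundamental_theorem_of_calculus)
    fix \<theta> :: real
    have "((\<lambda>\<theta>. u (t + \<theta> * (t' - t))) has_real_derivative u' (t + \<theta> * (t' - t)) * (t' - t))
        (at \<theta>)"
      by (rule DERIV_chain2[OF assms]) (auto intro!: derivative_eq_intros)
    then show "((\<lambda>\<theta>. u (t + \<theta> * (t' - t))) has_vector_derivative (t' - t) * u' (t + \<theta> * (t' - t)))
        (at \<theta> within {0..1})"
      by (simp add: has_real_derivative_iff_has_vector_derivative mult.commute
          has_vector_derivative_at_within)
  qed simp
  then show ?thesis by (simp add: mean_slope_def integral_unique flip: integral_mult_right)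
qed

lemma mean_slope_same [simp]: "mean_slope u' t t = u' t"
  by (simp add: mean_slope_def)

lemma mean_slope_continuous:
  assumes u': "continuous_on (X \<times> UNIV) (\<lambda>(x, t). u' x t)"
  shows "continuous_on (X \<times> UNIV) (\<lambda>(x, t, t'). mean_slope (u' x) t t')"
proof -
  have "continuous_on ((X \<times> (UNIV :: (real \<times> real) set)) \<times> cbox 0 1)
      (\<lambda>(z, \<theta>::real). u' (fst z) (fst (snd z) + \<theta> * (snd (snd z) - fst (snd z))))"
    unfolding case_prod_beta
    by (rule continuous_on_strip_compose[OF u']) (auto intro!: continuous_intros)
  from integral_continuous_on_param[OF this]
  show ?thesis by (simp add: mean_slope_def case_prod_beta)
qed

lemma mean_slope_bound:
  assumes "\<And>t. \<bar>u' t\<bar> \<le> L" "continuous_on UNIV u'"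
  shows "\<bar>mean_slope u' t t'\<bar> \<le> L"
proof -
  have "norm (integral {0..1} (\<lambda>\<theta>. u' (t + \<theta> * (t' - t)))) \<le> L * (1 - 0)"
    by (rule integral_bound)
      (auto intro!: continuous_on_compose2[OF assms(2)] continuous_intros assms(1))
  then show ?thesis by (simp add: mean_slope_def)
qed

lemma lipschitz_continuous_on_strip:
  fixes g :: "real \<Rightarrow> real \<Rightarrow> real"
  assumes "\<And>x x' s. x \<in> {0..1} \<Longrightarrow> x' \<in> {0..1} \<Longrightarrow> \<bar>g x' s - g x s\<bar> \<le> A * \<bar>x' - x\<bar>"
    and "\<And>x s s'. x \<in> {0..1} \<Longrightarrow> \<bar>g x s' - g x s\<bar> \<le> B * \<bar>s' - s\<bar>"
  shows "continuous_on ({0..1} \<times> UNIV) (\<lambda>(x, s). g x s)"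
proof -
  have AB: "0 \<le> A" "0 \<le> B"
    using assms(1)[of 0 1 0] assms(2)[of 0 1 0] by auto
  have "\<bar>g x' s' - g x s\<bar> \<le> (A + B) * dist (x', s') (x, s)" if "x \<in> {0..1}" "x' \<in> {0..1}" for x x' s s'
  proof -
    have "\<bar>g x' s' - g x s\<bar> \<le> A * \<bar>x' - x\<bar> + B * \<bar>s' - s\<bar>"
      using assms(1)[OF that, of s'] assms(2)[OF that(1), of s' s] by linarith
    also have "\<dots> \<le> A * dist (x', s') (x, s) + B * dist (x', s') (x, s)"
      using AB dist_fst_le[of "(x', s')" "(x, s)"] dist_snd_le[of "(x', s')" "(x, s)"]
      by (intro add_mono mult_left_mono) (auto simp: dist_real_def)
    finally show ?thesis by (simp add: distrib_right)
  qed
  then show ?thesis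
    by (intro lipschitz_on_continuous_on[of "A + B"] lipschitz_onI) (use AB in \<open>auto simp: dist_real_def[of "g _ _"]\<close>)
qed

text \<open>The choice is made for the whole curve with entry time \<open>s\<close> and evaluated at
  \<open>x\<close> only afterwards, so that all values for one \<open>s\<close> lie on a single
  solution of the integral equation. The curve gives time as a function of position.\<close>

definition char_curve :: "(real \<Rightarrow> real \<Rightarrow> real) \<Rightarrow> real \<Rightarrow> real \<Rightarrow> real"
  where "char_curve f x s = (SOME y. continuous_on {0..1} y \<and>
    (\<forall>x\<in>{0..1}. y x = s + integral {0..x} (\<lambda>\<xi>. f \<xi> (y \<xi>)))) x"

text \<open>The backward flow: the time at which the characteristic through \<open>(x, t)\<close>
  enters at x = 0.\<close>

definition char_start :: "(real \<Rightarrow> real \<Rightarrow> real) \<Rightarrow> real \<Rightarrow> real \<Rightarrow> real"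
  where "char_start f x t = (THE s. char_curve f x s = t)"

text \<open>\<open>f\<close> is the slowness dt/dx, the reciprocal of a positive speed. Thus
  \<open>c0\<close> and \<open>c1\<close> bound the time needed to cross the unit interval, and
  \<open>L\<close> controls how fast neighbouring characteristics spread or approach each
  other.\<close>

locale flow =
  fixes f ft :: "real \<Rightarrow> real \<Rightarrow> real" and c0 c1 L :: real
  assumes f_cont: "continuous_on ({0..1} \<times> UNIV) (\<lambda>(x, t). f x t)"
    and ft_cont: "continuous_on ({0..1} \<times> UNIV) (\<lambda>(x, t). ft x t)"
    and f_deriv: "\<And>x t. x \<in> {0..1} \<Longrightarrow> (f x has_real_derivative ft x t) (at t)"
    and c0_pos: "0 < c0"
    and f_ge: "\<And>x t. x \<in> {0..1} \<Longrightarrow> c0 \<le> f x t"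
    and f_le: "\<And>x t. x \<in> {0..1} \<Longrightarrow> f x t \<le> c1"
    and ft_le: "\<And>x t. x \<in> {0..1} \<Longrightarrow> \<bar>ft x t\<bar> \<le> L"
begin

abbreviation "Om \<equiv> char_curve f"
abbreviation "S \<equiv> char_start f"

lemma c0_le_c1: "c0 \<le> c1"
  using f_ge[of 0 0] f_le[of 0 0] by simp

lemma c1_pos: "0 < c1" using c0_pos c0_le_c1 by simp

lemma L_nonneg: "0 \<le> L" using ft_le[of 0 0] by simp

lemma f_abs_le: "x \<in> {0..1} \<Longrightarrow> \<bar>f x t\<bar> \<le> c1"
  using f_ge[of x t] f_le[of x t] c0_pos by auto

lemma f_lipschitz:
  assumes "x \<in> {0..1}"
  shows "\<bar>f x t' - f x t\<bar> \<le> L * \<bar>t' - t\<bar>"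
  unfolding mean_slope_diff[OF f_deriv[OF assms]] abs_mult
  using mean_slope_bound[of "ft x" L t t'] ft_le[OF assms] continuous_on_strip_fst[OF ft_cont assms]
  by (subst mult.commute) (auto intro: mult_right_mono)

lemma f_compose_continuous:
  assumes "continuous_on A y" "A \<subseteq> {0..1}"
  shows "continuous_on A (\<lambda>\<xi>. f \<xi> (y \<xi>))"
  using assms by (intro continuous_on_strip_compose[OF f_cont]) (auto intro!: continuous_intros)

lemma solution_exists:
  "\<exists>y. continuous_on {0..1} y \<and> (\<forall>x\<in>{0..1}. y x = s + integral {0..x} (\<lambda>\<xi>. f \<xi> (y \<xi>)))"
proof -
  define K where "K = L + 1"
  have K: "0 < K" "L \<le> K" using L_nonneg by (auto simp: K_def)
  define P where "P = rec_nat (\<lambda>x. s) (\<lambda>n y x. s + integral {0..x} (\<lambda>\<xi>. f \<xi> (y \<xi>)))"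
  have P_Suc: "P (Suc n) x = s + integral {0..x} (\<lambda>\<xi>. f \<xi> (P n \<xi>))" for n x
    by (simp add: P_def)
  have P_cont: "continuous_on {0..1} (P n)" for n
  proof (induction n)
    case 0
    then show ?case by (simp add: P_def)
  next
    case (Suc n)
    have "continuous_on {0..1} (\<lambda>x. integral {0..x} (\<lambda>\<xi>. f \<xi> (P n \<xi>)))"
      by (intro indefinite_integral_continuous_1 integrable_continuous_real
          f_compose_continuous[OF Suc]) simp
    then have "continuous_on {0..1} (\<lambda>x. s + integral {0..x} (\<lambda>\<xi>. f \<xi> (P n \<xi>)))"
      by (intro continuous_intros)
    then show ?case by (simp add: P_Suc cong: continuous_on_cong)
  qed
  have int: "(\<lambda>\<xi>. f \<xi> (P n \<xi>)) integrable_on {0..x}" if "x \<in> {0..1}" for n x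
    using that
    by (intro integrable_continuous_real f_compose_continuous continuous_on_subset[OF P_cont]) auto
  \<comment> \<open>Picard iteration in an exponentially weighted norm: integrating
    \<open>K * exp (2 * K * \<xi>)\<close> yields at most half of \<open>exp (2 * K * x)\<close>, so
    every step gains a factor 1/2 on the whole interval, however large \<open>L\<close> is.\<close>
  have step: "\<bar>P (Suc n) x - P n x\<bar> \<le> c1 * exp (2 * K * x) * (1/2) ^ n"
    if "x \<in> {0..1}" for n x
    using that
  proof (induction n arbitrary: x)
    case 0
    have "norm (integral {0..x} (\<lambda>\<xi>. f \<xi> (P 0 \<xi>))) \<le> c1 * (x - 0)"
      using 0 f_abs_le by (intro integral_bound)
        (auto intro!: f_compose_continuous continuous_on_subset[OF P_cont])
    also have "\<dots> \<le> c1 * exp (2 * K * x)"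
    proof -
      have "x \<le> 1" "1 \<le> exp (2 * K * x)" using 0 K by auto
      then have "x - 0 \<le> exp (2 * K * x)" by linarith
      then show ?thesis using c1_pos by (intro mult_left_mono) auto
    qed
    finally show ?case by (simp add: P_Suc) (simp add: P_def)
  next
    case (Suc n)
    define C where "C = c1 * (1/2) ^ n"
    have C: "0 \<le> C" using c1_pos by (simp add: C_def)
    have "P (Suc (Suc n)) x - P (Suc n) x
        = integral {0..x} (\<lambda>\<xi>. f \<xi> (P (Suc n) \<xi>) - f \<xi> (P n \<xi>))"
      unfolding P_Suc[of "Suc n"] P_Suc[of n x]
      using integral_diff[OF int int, OF Suc.prems Suc.prems, of "Suc n" n] by simp
    also have "norm \<dots> \<le> integral {0..x} (\<lambda>\<xi>. C / 2 * (exp (2 * K * \<xi>) * (2 * K)))"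
    proof (rule integral_norm_bound_integral)
      show "(\<lambda>\<xi>. f \<xi> (P (Suc n) \<xi>) - f \<xi> (P n \<xi>)) integrable_on {0..x}"
        by (intro integrable_diff int Suc.prems)
      show "(\<lambda>\<xi>. C / 2 * (exp (2 * K * \<xi>) * (2 * K))) integrable_on {0..x}"
        by (intro integrable_continuous_real continuous_intros)
      fix \<xi> assume "\<xi> \<in> {0..x}"
      then have \<xi>: "\<xi> \<in> {0..1}" using Suc.prems by auto
      have "norm (f \<xi> (P (Suc n) \<xi>) - f \<xi> (P n \<xi>)) \<le> L * \<bar>P (Suc n) \<xi> - P n \<xi>\<bar>"
        using f_lipschitz[OF \<xi>] by simp
      also have "\<dots> \<le> K * (c1 * exp (2 * K * \<xi>) * (1/2) ^ n)"
        using Suc.IH[OF \<xi>] K by (intro mult_mono) auto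
      finally show "norm (f \<xi> (P (Suc n) \<xi>) - f \<xi> (P n \<xi>)) \<le> C / 2 * (exp (2 * K * \<xi>) * (2 * K))"
        by (simp add: C_def mult_ac)
    qed
    also have "\<dots> = C / 2 * (exp (2 * K * x) - exp (2 * K * 0))"
    proof -
      have "((\<lambda>\<xi>. exp (2 * K * \<xi>) * (2 * K)) has_integral exp (2 * K * x) - exp (2 * K * 0)) {0..x}"
        using Suc.prems by (intro fundamental_theorem_of_calculus)
          (auto intro!: derivative_eq_intros simp flip: has_real_derivative_iff_has_vector_derivative)
      from has_integral_mult_right[OF this, of "C / 2"] show ?thesis by (rule integral_unique)
    qed
    also have "\<dots> \<le> C / 2 * exp (2 * K * x)"
      using C by (intro mult_left_mono) auto
    finally show ?case by (simp add: C_def mult_ac)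
  qed
  have "uniform_limit {0..1} (\<lambda>n x. \<Sum>i<n. P (Suc i) x - P i x)
      (\<lambda>x. \<Sum>i. P (Suc i) x - P i x) sequentially"
  proof (rule Weierstrass_m_test)
    show "norm (P (Suc n) x - P n x) \<le> c1 * exp (2 * K) * (1/2) ^ n" if "x \<in> {0..1}" for n x
    proof -
      have "exp (2 * K * x) \<le> exp (2 * K)" using that K by (simp add: mult_left_le)
      then have "c1 * exp (2 * K * x) * (1/2) ^ n \<le> c1 * exp (2 * K) * (1/2) ^ n"
        using c1_pos by (intro mult_right_mono mult_left_mono) auto
      then show ?thesis using step[OF that, of n] by simp
    qed
    show "summable (\<lambda>n. c1 * exp (2 * K) * (1/2) ^ n)"
      by (intro summable_mult summable_geometric) simp
  qed
  moreover have "(\<Sum>i<n. P (Suc i) x - P i x) = P n x - s" for n x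
    by (subst sum_lessThan_telescope) (simp add: P_def)
  ultimately have ul: "uniform_limit {0..1} (\<lambda>n x. P n x - s) (\<lambda>x. \<Sum>i. P (Suc i) x - P i x) sequentially"
    by simp
  define y where "y x = s + (\<Sum>i. P (Suc i) x - P i x)" for x
  have ul: "uniform_limit {0..1} P y sequentially"
  proof -
    have "uniform_limit {0..1} (\<lambda>n x. s + (P n x - s)) (\<lambda>x. s + (\<Sum>i. P (Suc i) x - P i x)) sequentially"
      by (intro uniform_limit_intros ul)
    then show ?thesis by (simp add: y_def[abs_def])
  qed
  have y_cont: "continuous_on {0..1} y"
    using P_cont by (intro uniform_limit_theorem[OF _ ul]) auto
  have "y x = s + integral {0..x} (\<lambda>\<xi>. f \<xi> (y \<xi>))" if x: "x \<in> {0..1}" for x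
  proof -
    have "(\<lambda>n. integral {0..x} (\<lambda>\<xi>. f \<xi> (P n \<xi>))) \<longlonglongrightarrow> integral {0..x} (\<lambda>\<xi>. f \<xi> (y \<xi>))"
    proof (rule dominated_convergence(2)[OF int[OF x]])
      show "(\<lambda>\<xi>. c1) integrable_on {0..x}" by (rule integrable_const_ivl)
      show "norm (f \<xi> (P n \<xi>)) \<le> c1" if "\<xi> \<in> {0..x}" for n \<xi>
        using f_abs_le[of \<xi>] that x by auto
      show "(\<lambda>n. f \<xi> (P n \<xi>)) \<longlonglongrightarrow> f \<xi> (y \<xi>)" if "\<xi> \<in> {0..x}" for \<xi>
      proof -
        have \<xi>: "\<xi> \<in> {0..1}" using that x by auto
        have "isCont (f \<xi>) (y \<xi>)" using f_deriv[OF \<xi>] by (rule DERIV_isCont)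
        then show ?thesis
          by (rule isCont_tendsto_compose) (rule tendsto_uniform_limitI[OF ul \<xi>])
      qed
    qed
    then have "(\<lambda>n. P (Suc n) x) \<longlonglongrightarrow> s + integral {0..x} (\<lambda>\<xi>. f \<xi> (y \<xi>))"
      unfolding P_Suc by (intro tendsto_intros)
    moreover have "(\<lambda>n. P (Suc n) x) \<longlonglongrightarrow> y x"
      using tendsto_uniform_limitI[OF ul x] by (rule LIMSEQ_Suc)
    ultimately show ?thesis by (rule LIMSEQ_unique[symmetric])
  qed
  then show ?thesis using y_cont by blast
qed

section \<open>Dependence of the characteristics on position and entry time\<close>

lemma Om_cont_x: "continuous_on {0..1} (\<lambda>x. Om x s)"
  and Om_eq: "x \<in> {0..1} \<Longrightarrow> Om x s = s + integral {0..x} (\<lambda>\<xi>. f \<xi> (Om \<xi> s))"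
  using someI_ex[OF solution_exists[of s]] by (auto simp: char_curve_def)

lemma Om_0: "Om 0 s = s"
  using Om_eq[of 0 s] by simp

lemma Om_deriv_x:
  assumes "x \<in> {0..1}"
  shows "((\<lambda>x. Om x s) has_real_derivative f x (Om x s)) (at x within {0..1})"
proof -
  have "((\<lambda>x. integral {0..x} (\<lambda>\<xi>. f \<xi> (Om \<xi> s))) has_real_derivative f x (Om x s))
      (at x within {0..1})"
    using assms by (intro integral_has_real_derivative f_compose_continuous Om_cont_x) auto
  then have "((\<lambda>x. s + integral {0..x} (\<lambda>\<xi>. f \<xi> (Om \<xi> s))) has_real_derivative f x (Om x s))
      (at x within {0..1})"
    by (auto intro!: derivative_eq_intros)
  then show ?thesis
    unfolding has_field_derivative_def
    by (rule has_derivative_transform[OF assms, rotated]) (rule Om_eq)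
qed

lemma Om_diff_x:
  assumes "0 \<le> x" "x \<le> x'" "x' \<le> 1"
  shows "c0 * (x' - x) \<le> Om x' s - Om x s" "Om x' s - Om x s \<le> c1 * (x' - x)"
proof -
  have "Om x' s - Om x s = integral {x..x'} (\<lambda>\<xi>. f \<xi> (Om \<xi> s))"
  proof -
    have "integral {0..x} (\<lambda>\<xi>. f \<xi> (Om \<xi> s)) + integral {x..x'} (\<lambda>\<xi>. f \<xi> (Om \<xi> s))
        = integral {0..x'} (\<lambda>\<xi>. f \<xi> (Om \<xi> s))"
      using assms by (intro Henstock_Kurzweil_Integration.integral_combine integrable_continuous_real
          f_compose_continuous continuous_on_subset[OF Om_cont_x]) auto
    then show ?thesis using Om_eq[of x s] Om_eq[of x' s] assms by simp
  qed
  moreover have int: "(\<lambda>\<xi>. f \<xi> (Om \<xi> s)) integrable_on {x..x'}"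
    using assms by (intro integrable_continuous_real
        f_compose_continuous continuous_on_subset[OF Om_cont_x]) auto
  moreover have "integral {x..x'} (\<lambda>\<xi>. c0) \<le> integral {x..x'} (\<lambda>\<xi>. f \<xi> (Om \<xi> s))"
    using assms by (intro integral_le int f_ge) auto
  moreover have "integral {x..x'} (\<lambda>\<xi>. f \<xi> (Om \<xi> s)) \<le> integral {x..x'} (\<lambda>\<xi>. c1)"
    using assms by (intro integral_le int f_le) auto
  ultimately show "c0 * (x' - x) \<le> Om x' s - Om x s" "Om x' s - Om x s \<le> c1 * (x' - x)"
    using assms by (simp_all add: mult.commute)
qed

definition "slope \<xi> s s' = mean_slope (ft \<xi>) (Om \<xi> s) (Om \<xi> s')"

definition "Om_slope x s s' = exp (integral {0..x} (\<lambda>\<xi>. slope \<xi> s s'))"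

lemma slope_bound: "\<xi> \<in> {0..1} \<Longrightarrow> \<bar>slope \<xi> s s'\<bar> \<le> L"
  unfolding slope_def
  by (intro mean_slope_bound ft_le continuous_on_strip_fst[OF ft_cont])

lemma slope_cont_x: "continuous_on {0..1} (\<lambda>\<xi>. slope \<xi> s s')"
  unfolding slope_def
  by (intro continuous_on_triple_compose[OF mean_slope_continuous[OF ft_cont]] continuous_intros
      Om_cont_x) simp

text \<open>The difference of two characteristics solves a linear equation whose coefficient is a
  chord slope of \<open>f\<close>, so the chord slopes of \<open>Om x\<close> are explicit and positive.\<close>

lemma Om_diff_s:
  assumes x: "x \<in> {0..1}"
  shows "Om x s' - Om x s = (s' - s) * Om_slope x s s'"
proof -
  let ?I = "\<lambda>x. integral {0..x} (\<lambda>\<xi>. slope \<xi> s s')"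
  define \<Delta> where "\<Delta> x = Om x s' - Om x s" for x
  \<comment> \<open>Multiplication by the integrating factor makes the difference of the two
    characteristics constant in x.\<close>
  have "((\<lambda>x. \<Delta> x * exp (- ?I x)) has_real_derivative 0) (at x within {0..1})"
    if x: "x \<in> {0..1}" for x
  proof -
    have "(\<Delta> has_real_derivative f x (Om x s') - f x (Om x s)) (at x within {0..1})"
      unfolding \<Delta>_def by (intro derivative_intros Om_deriv_x x)
    moreover have "f x (Om x s') - f x (Om x s) = \<Delta> x * slope x s s'"
      unfolding \<Delta>_def slope_def by (rule mean_slope_diff[OF f_deriv[OF x]])
    ultimately have \<Delta>': "(\<Delta> has_real_derivative \<Delta> x * slope x s s') (at x within {0..1})"
      by simp
    have I': "(?I has_real_derivative slope x s s') (at x within {0..1})"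
      by (rule integral_has_real_derivative[OF slope_cont_x x])
    show ?thesis
      by (rule derivative_eq_intros \<Delta>' I' refl)+ simp
  qed
  then have "\<exists>c. \<forall>x\<in>{0..1}. \<Delta> x * exp (- ?I x) = c"
    by (intro has_field_derivative_zero_constant) auto
  then obtain c where c: "\<And>x. x \<in> {0..1} \<Longrightarrow> \<Delta> x * exp (- ?I x) = c" by blast
  from c[of 0] have "c = s' - s" by (simp add: \<Delta>_def Om_0)
  with c[OF x] have "\<Delta> x * exp (- ?I x) * exp (?I x) = (s' - s) * exp (?I x)" by simp
  then show ?thesis
    by (simp add: \<Delta>_def Om_slope_def mult.assoc flip: exp_add)
qed

lemma Om_slope_bounds:
  assumes "x \<in> {0..1}"
  shows "exp (- L) \<le> Om_slope x s s'" "Om_slope x s s' \<le> exp L"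
proof -
  have "norm (integral {0..x} (\<lambda>\<xi>. slope \<xi> s s')) \<le> L * (x - 0)"
    using assms slope_bound by (intro integral_bound continuous_on_subset[OF slope_cont_x]) auto
  also have "\<dots> \<le> L" using assms L_nonneg by (simp add: mult_left_le)
  finally show "exp (- L) \<le> Om_slope x s s'" "Om_slope x s s' \<le> exp L"
    by (auto simp: Om_slope_def)
qed

lemma Om_slope_pos: "0 < Om_slope x s s'" by (simp add: Om_slope_def)

lemma Om_cont: "continuous_on ({0..1} \<times> UNIV) (\<lambda>(x, s). Om x s)"
proof (rule lipschitz_continuous_on_strip)
  show "\<bar>Om x' s - Om x s\<bar> \<le> c1 * \<bar>x' - x\<bar>" if "x \<in> {0..1}" "x' \<in> {0..1}" for x x' s
    using Om_diff_x[of x x' s] Om_diff_x[of x' x s] that c0_pos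
    by (cases "x \<le> x'") (auto simp: abs_if, (smt (verit) mult_nonneg_nonneg)+)
  show "\<bar>Om x s' - Om x s\<bar> \<le> exp L * \<bar>s' - s\<bar>" if "x \<in> {0..1}" for x s s'
    unfolding Om_diff_s[OF that] abs_mult
    using Om_slope_bounds[OF that, of s s'] Om_slope_pos[of x s s']
    by (subst mult.commute) (auto intro!: mult_right_mono)
qed

lemma Om_slope_cont: "continuous_on ({0..1} \<times> UNIV) (\<lambda>(x, s, s'). Om_slope x s s')"
proof -
  have "continuous_on ({0..1} \<times> UNIV) (\<lambda>(\<xi>, p). slope \<xi> (fst p) (snd p))"
    unfolding slope_def case_prod_beta
    by (rule continuous_on_compose2[OF mean_slope_continuous[OF ft_cont],
          of _ "\<lambda>z. (fst z, Om (fst z) (fst (snd z)), Om (fst z) (snd (snd z)))", simplified])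
      (auto intro!: continuous_intros continuous_on_strip_compose[OF Om_cont])
  from integral_upper_continuous[OF this]
  show ?thesis
    unfolding Om_slope_def by (auto intro!: continuous_intros simp: case_prod_beta)
qed

text \<open>Caratheodory's criterion: the chord slope is an explicit continuous function of its
  second endpoint, so its value on the diagonal is the derivative. The inverse map
  \<open>S x\<close> is treated in the same way with the reciprocal slope.\<close>

lemma Om_deriv_s:
  assumes x: "x \<in> {0..1}"
  shows "(Om x has_real_derivative Om_slope x s s) (at s)"
proof -
  have "continuous_on UNIV (\<lambda>s'. Om_slope x s s')"
    by (rule continuous_on_triple_compose[OF Om_slope_cont]) (use x in \<open>auto intro!: continuous_intros\<close>)
  then have "isCont (\<lambda>s'. Om_slope x s s') s"
    by (simp add: continuous_on_eq_continuous_at)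
  then show ?thesis
    unfolding CARAT_DERIV using Om_diff_s[OF x, of _ s] by (auto simp: mult.commute)
qed

lemma Om_strict_mono:
  assumes "x \<in> {0..1}" "s < s'"
  shows "Om x s < Om x s'"
  using Om_diff_s[OF assms(1), of s' s] Om_slope_pos[of x s s'] assms(2)
  by (smt (verit) mult_pos_pos)

lemma Om_S [simp]: "x \<in> {0..1} \<Longrightarrow> Om x (S x t) = t"
  and S_Om [simp]: "x \<in> {0..1} \<Longrightarrow> S x (Om x s) = s"
proof -
  assume x: "x \<in> {0..1}"
  have uniq: "s = s'" if "Om x s = Om x s'" for s s'
    using Om_strict_mono[OF x, of s s'] Om_strict_mono[OF x, of s' s] that
    by (metis less_irrefl linorder_neqE_linordered_idom)
  \<comment> \<open>A crossing takes a time between 0 and \<open>c1\<close>. Entry at t - c1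
    therefore arrives no later than t, entry at t no earlier, and the intermediate value theorem
    finds an entry time in between.\<close>
  have "Om x (t - c1) \<le> t - c1 + c1 * x"
    using Om_diff_x(2)[of 0 x "t - c1"] x by (simp add: Om_0)
  also have "\<dots> \<le> t" using x c1_pos mult_left_le[of x c1] by simp
  finally have "Om x (t - c1) \<le> t" .
  moreover have "t \<le> Om x t"
    using Om_diff_x(1)[of 0 x t] x c0_pos by (simp add: Om_0) (smt (verit) mult_nonneg_nonneg)
  moreover have "continuous_on {t - c1..t} (Om x)"
    using Om_deriv_s[OF x] by (meson DERIV_isCont continuous_at_imp_continuous_on)
  ultimately obtain s0 where "Om x s0 = t"
    using IVT'[of "Om x" "t - c1" t t] c1_pos by auto
  then show "Om x (S x t) = t"
    unfolding char_start_def by (rule theI) (use uniq \<open>Om x s0 = t\<close> in auto)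
  show "S x (Om x s) = s"
    unfolding char_start_def by (rule the_equality) (use uniq in auto)
qed

lemma S_0 [simp]: "S 0 t = t"
  using S_Om[of 0 t] by (simp add: Om_0)

lemma S_le: "x \<in> {0..1} \<Longrightarrow> S x t \<le> t"
  using Om_diff_x(1)[of 0 x "S x t"] c0_pos
  by (simp add: Om_0) (smt (verit) mult_nonneg_nonneg)

lemma S_diff_t:
  assumes "x \<in> {0..1}"
  shows "S x t' - S x t = (t' - t) * inverse (Om_slope x (S x t) (S x t'))"
  using Om_diff_s[OF assms, of "S x t'" "S x t"] Om_slope_pos[of x "S x t" "S x t'"] assms
  by (simp add: field_simps)

lemma S_cont: "continuous_on ({0..1} \<times> UNIV) (\<lambda>(x, s). S x s)"
proof (rule lipschitz_continuous_on_strip)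
  have lip_t: "\<bar>S x t' - S x t\<bar> \<le> exp L * \<bar>t' - t\<bar>" if "x \<in> {0..1}" for x t t'
  proof -
    have "inverse (Om_slope x (S x t) (S x t')) \<le> inverse (exp (- L))"
      using Om_slope_bounds[OF that] by (intro le_imp_inverse_le) auto
    then show ?thesis
      unfolding S_diff_t[OF that] abs_mult
      using Om_slope_pos[of x "S x t" "S x t'"]
      by (subst mult.commute) (auto intro!: mult_right_mono simp: exp_minus)
  qed
  then show "\<bar>S x s' - S x s\<bar> \<le> exp L * \<bar>s' - s\<bar>" if "x \<in> {0..1}" for x s s'
    using that .
  fix x x' t assume x: "x \<in> {0..1::real}" "x' \<in> {0..1::real}"
  \<comment> \<open>Continue the characteristic through (x,t) to the position x'. There its entry
    time is still \<open>S x t\<close>, and it passes within time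
    \<open>c1 * \<bar>x' - x\<bar>\<close> of t; Lipschitz continuity of \<open>S x'\<close> in time
    does the rest.\<close>
  have "\<bar>S x' t - S x' (Om x' (S x t))\<bar> \<le> exp L * \<bar>t - Om x' (S x t)\<bar>"
    by (rule lip_t[OF x(2)])
  moreover have "\<bar>Om x (S x t) - Om x' (S x t)\<bar> \<le> c1 * \<bar>x' - x\<bar>"
    using Om_diff_x[of x x' "S x t"] Om_diff_x[of x' x "S x t"] x c0_pos
    by (cases "x \<le> x'") (auto simp: abs_if simp del: Om_S, (smt (verit) mult_nonneg_nonneg)+)
  ultimately show "\<bar>S x' t - S x t\<bar> \<le> exp L * c1 * \<bar>x' - x\<bar>"
    using x by (simp add: mult.assoc) (smt (verit) exp_ge_zero mult_left_mono)
qed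

definition "S_deriv x t = inverse (Om_slope x (S x t) (S x t))"

lemma S_deriv_cont: "continuous_on ({0..1} \<times> UNIV) (\<lambda>(x, t). S_deriv x t)"
  unfolding S_deriv_def case_prod_beta
  using Om_slope_pos
  by (intro continuous_on_inverse continuous_on_compose2[OF Om_slope_cont,
        of _ "\<lambda>z. (fst z, S (fst z) (snd z), S (fst z) (snd z))", simplified])
    (auto intro!: continuous_intros continuous_on_strip_compose[OF S_cont] simp: less_imp_neq[THEN not_sym])

lemma S_deriv_bounds: "x \<in> {0..1} \<Longrightarrow> 0 < S_deriv x t" "x \<in> {0..1} \<Longrightarrow> S_deriv x t \<le> exp L"
  using Om_slope_bounds(1)[of x "S x t" "S x t"] Om_slope_pos[of x "S x t" "S x t"]
    le_imp_inverse_le[of "exp (- L)" "Om_slope x (S x t) (S x t)"]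
  by (auto simp: S_deriv_def exp_minus)

lemma S_has_deriv:
  assumes x: "x \<in> {0..1}"
  shows "(S x has_real_derivative S_deriv x t) (at t)"
proof -
  have "continuous_on UNIV (S x)" by (rule continuous_on_strip_fst[OF S_cont x])
  then have "continuous_on UNIV (\<lambda>t'. Om_slope x (S x t) (S x t'))"
    by (intro continuous_on_triple_compose[OF Om_slope_cont] continuous_intros) (use x in auto)
  then have "continuous_on UNIV (\<lambda>t'. inverse (Om_slope x (S x t) (S x t')))"
    using Om_slope_pos by (intro continuous_on_inverse) (auto simp: less_imp_neq[THEN not_sym])
  then have "isCont (\<lambda>t'. inverse (Om_slope x (S x t) (S x t'))) t"
    by (simp add: continuous_on_eq_continuous_at)
  then show ?thesis
    unfolding CARAT_DERIV S_deriv_def using S_diff_t[OF x, of _ t]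
    by (intro exI[of _ "\<lambda>t'. inverse (Om_slope x (S x t) (S x t'))"]) (auto simp: mult.commute)
qed

end

section \<open>Transport along characteristics\<close>

text \<open>In the application the exceptional points are those where a characteristic meets the
  kink line and a pointwise limit may fail. Setting all functions to zero there changes no
  integral.\<close>

lemma dominated_convergence_except_finite:
  fixes h :: "nat \<Rightarrow> real \<Rightarrow> real"
  assumes N: "finite N"
    and int: "\<And>n. h n integrable_on {a..b}"
    and bound: "\<And>n \<xi>. \<xi> \<in> {a..b} \<Longrightarrow> \<bar>h n \<xi>\<bar> \<le> C"
    and lim: "\<And>\<xi>. \<xi> \<in> {a..b} \<Longrightarrow> \<xi> \<notin> N \<Longrightarrow> (\<lambda>n. h n \<xi>) \<longlonglongrightarrow> g \<xi>"
  shows "g integrable_on {a..b}" "(\<lambda>n. integral {a..b} (h n)) \<longlonglongrightarrow> integral {a..b} g"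
proof -
  define h' where "h' n \<xi> = (if \<xi> \<in> N then 0 else h n \<xi>)" for n \<xi>
  define g' where "g' \<xi> = (if \<xi> \<in> N then 0 else g \<xi>)" for \<xi>
  have h': "h' n integrable_on {a..b}" for n
    by (rule integrable_spike_finite[OF N _ int[of n]]) (simp add: h'_def)
  have C: "(\<lambda>\<xi>. \<bar>C\<bar>) integrable_on {a..b}" by (rule integrable_const_ivl)
  have b': "norm (h' n \<xi>) \<le> \<bar>C\<bar>" if "\<xi> \<in> {a..b}" for n \<xi>
    using bound[OF that, of n] by (auto simp: h'_def)
  have l': "(\<lambda>n. h' n \<xi>) \<longlonglongrightarrow> g' \<xi>" if "\<xi> \<in> {a..b}" for \<xi>
    using lim[OF that] by (simp add: h'_def g'_def)
  note * = dominated_convergence[OF h' C b' l']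
  show "g integrable_on {a..b}"
    by (rule integrable_spike_finite[OF N _ *(1)]) (simp add: g'_def)
  have "integral {a..b} (h' n) = integral {a..b} (h n)" for n
    by (rule integral_spike[OF negligible_finite[OF N]]) (simp add: h'_def)
  moreover have "integral {a..b} g' = integral {a..b} g"
    by (rule integral_spike[OF negligible_finite[OF N]]) (simp add: g'_def)
  ultimately show "(\<lambda>n. integral {a..b} (h n)) \<longlonglongrightarrow> integral {a..b} g"
    using *(2) by simp
qed

text \<open>Where one factor vanishes, the difference quotient of the product is that factor's own
  quotient times the other factor, of which mere continuity is asked. The other factor will be a
  mean slope, which is continuous but has no derivative at hand.\<close>

lemma DERIV_mult_zero:
  fixes g h :: "real \<Rightarrow> real"
  assumes "(g has_real_derivative d) (at x within A)" "g x = 0" "continuous (at x within A) h"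
  shows "((\<lambda>y. g y * h y) has_real_derivative d * h x) (at x within A)"
proof -
  have "((\<lambda>y. (g y - g x) / (y - x) * h y) \<longlongrightarrow> d * h x) (at x within A)"
    using assms by (intro tendsto_mult) (auto simp: has_field_derivative_iff continuous_within)
  then show ?thesis using assms(2) by (simp add: has_field_derivative_iff)
qed

text \<open>For integrals up to x with an integrand that is bounded but jumps: boundedness gives the
  Lipschitz estimate in x, dominated convergence the continuity in the other variable.\<close>

lemma continuous_on_strip_lipschitz_fst:
  fixes g :: "real \<Rightarrow> real \<Rightarrow> real"
  assumes lip: "\<And>x x' s. x \<in> {0..1} \<Longrightarrow> x' \<in> {0..1} \<Longrightarrow> \<bar>g x' s - g x s\<bar> \<le> C * \<bar>x' - x\<bar>"
    and cont: "\<And>x. x \<in> {0..1} \<Longrightarrow> continuous_on UNIV (g x)"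
  shows "continuous_on ({0..1} \<times> UNIV) (\<lambda>(x, s). g x s)"
  unfolding continuous_on_def
proof
  fix z :: "real \<times> real" assume z: "z \<in> {0..1} \<times> UNIV"
  let ?F = "at z within {0..1} \<times> UNIV"
  have "isCont (g (fst z)) (snd z)"
    using cont[of "fst z"] z by (auto simp: continuous_on_eq_continuous_at)
  then have "((\<lambda>w. g (fst z) (snd w)) \<longlongrightarrow> g (fst z) (snd z)) ?F"
    by (rule isCont_tendsto_compose) (intro tendsto_intros)
  then have "((\<lambda>w. C * \<bar>fst w - fst z\<bar> + \<bar>g (fst z) (snd w) - g (fst z) (snd z)\<bar>) \<longlongrightarrow>
      C * \<bar>fst z - fst z\<bar> + \<bar>g (fst z) (snd z) - g (fst z) (snd z)\<bar>) ?F"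
    by (intro tendsto_intros)
  then have lim: "((\<lambda>w. C * \<bar>fst w - fst z\<bar> + \<bar>g (fst z) (snd w) - g (fst z) (snd z)\<bar>) \<longlongrightarrow> 0) ?F"
    by simp
  have ev: "\<forall>\<^sub>F w in ?F. norm ((case w of (x, s) \<Rightarrow> g x s) - (case z of (x, s) \<Rightarrow> g x s))
      \<le> C * \<bar>fst w - fst z\<bar> + \<bar>g (fst z) (snd w) - g (fst z) (snd z)\<bar>"
    unfolding eventually_at_filter
  proof (intro always_eventually allI impI)
    fix w :: "real \<times> real" assume "w \<in> {0..1} \<times> UNIV"
    then show "norm ((case w of (x, s) \<Rightarrow> g x s) - (case z of (x, s) \<Rightarrow> g x s))
      \<le> C * \<bar>fst w - fst z\<bar> + \<bar>g (fst z) (snd w) - g (fst z) (snd z)\<bar>"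
      using lip[of "fst z" "fst w" "snd w"] z by (auto simp: case_prod_beta)
  qed
  show "((\<lambda>(x, s). g x s) \<longlongrightarrow> (case z of (x, s) \<Rightarrow> g x s)) ?F"
    by (rule LIM_zero_cancel) (rule Lim_null_comparison[OF ev lim])
qed

context flow
begin

definition path_integral :: "(real \<Rightarrow> real \<Rightarrow> real) \<Rightarrow> real \<Rightarrow> real \<Rightarrow> real"
  where "path_integral F x s = integral {0..x} (\<lambda>\<xi>. F \<xi> (Om \<xi> s))"

definition path_integral_deriv :: "(real \<Rightarrow> real \<Rightarrow> real) \<Rightarrow> real \<Rightarrow> real \<Rightarrow> real"
  where "path_integral_deriv Ft x s = integral {0..x} (\<lambda>\<xi>. Ft \<xi> (Om \<xi> s) * Om_slope \<xi> s s)"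

text \<open>What is asked of a source is that its integral along characteristics be continuously
  differentiable in the entry time, with the derivative suggested by the chain rule.
  \<open>Ft\<close> itself may jump, so both smooth sources and sources with a kink qualify.\<close>

definition transportable :: "(real \<Rightarrow> real \<Rightarrow> real) \<Rightarrow> (real \<Rightarrow> real \<Rightarrow> real) \<Rightarrow> bool"
  where "transportable F Ft \<longleftrightarrow>
    continuous_on ({0..1} \<times> UNIV) (\<lambda>(x, t). F x t) \<and>
    (\<forall>x\<in>{0..1}. \<forall>s. (\<lambda>\<xi>. Ft \<xi> (Om \<xi> s) * Om_slope \<xi> s s) integrable_on {0..x}) \<and>
    (\<forall>x\<in>{0..1}. \<forall>s. (path_integral F x has_real_derivative path_integral_deriv Ft x s) (at s)) \<and>
    continuous_on ({0..1} \<times> UNIV) (\<lambda>(x, s). path_integral_deriv Ft x s)"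

lemma along_path_cont:
  fixes F :: "real \<Rightarrow> real \<Rightarrow> real"
  assumes "continuous_on ({0..1} \<times> UNIV) (\<lambda>(x, t). F x t)"
  shows "continuous_on ({0..1} \<times> UNIV) (\<lambda>(\<xi>, s). F \<xi> (Om \<xi> s))"
  unfolding case_prod_beta
  by (rule continuous_on_strip_compose[OF assms])
    (auto intro!: continuous_intros continuous_on_strip_compose[OF Om_cont])

lemma Om_slope_diag_cont: "continuous_on ({0..1} \<times> UNIV) (\<lambda>(\<xi>, s). Om_slope \<xi> s s)"
  unfolding case_prod_beta
  by (rule continuous_on_triple_compose[OF Om_slope_cont]) (auto intro!: continuous_intros)

lemma along_path_integrable:
  fixes F :: "real \<Rightarrow> real \<Rightarrow> real"
  assumes "continuous_on ({0..1} \<times> UNIV) (\<lambda>(x, t). F x t)" "x \<in> {0..1}"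
  shows "(\<lambda>\<xi>. F \<xi> (Om \<xi> s)) integrable_on {0..x}"
  using continuous_on_strip_snd[OF along_path_cont[OF assms(1)], of s] assms(2)
  by (intro integrable_continuous_real) (auto elim: continuous_on_subset)

lemma path_integral_cont:
  assumes "continuous_on ({0..1} \<times> UNIV) (\<lambda>(x, t). F x t)"
  shows "continuous_on ({0..1} \<times> UNIV) (\<lambda>(x, s). path_integral F x s)"
  unfolding path_integral_def by (rule integral_upper_continuous[OF along_path_cont[OF assms]])

lemma transportable_C1:
  assumes F: "continuous_on ({0..1} \<times> UNIV) (\<lambda>(x, t). F x t)"
    and Ft: "continuous_on ({0..1} \<times> UNIV) (\<lambda>(x, t). Ft x t)"
    and deriv: "\<And>x t. x \<in> {0..1} \<Longrightarrow> (F x has_real_derivative Ft x t) (at t)"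
  shows "transportable F Ft"
proof -
  have H: "continuous_on ({0..1} \<times> UNIV) (\<lambda>(\<xi>, s). Ft \<xi> (Om \<xi> s) * Om_slope \<xi> s s)"
    using along_path_cont[OF Ft] Om_slope_diag_cont
    by (auto intro!: continuous_intros simp: case_prod_beta)
  have "(path_integral F x has_real_derivative path_integral_deriv Ft x s) (at s)"
    if x: "x \<in> {0..1}" for x s
    unfolding path_integral_def[abs_def] path_integral_deriv_def cbox_interval[symmetric]
  proof (rule leibniz_rule_field_derivative[where U = UNIV])
    fix s \<xi> assume "\<xi> \<in> cbox 0 x"
    then have \<xi>: "\<xi> \<in> {0..1}" using x by auto
    show "((\<lambda>s. F \<xi> (Om \<xi> s)) has_real_derivative Ft \<xi> (Om \<xi> s) * Om_slope \<xi> s s) (at s)"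
      by (rule DERIV_chain2[OF deriv[OF \<xi>] Om_deriv_s[OF \<xi>]])
  next
    show "(\<lambda>\<xi>. F \<xi> (Om \<xi> s)) integrable_on cbox 0 x" for s
      using along_path_integrable[OF F x] by simp
    show "continuous_on (UNIV \<times> cbox 0 x) (\<lambda>(s, \<xi>). Ft \<xi> (Om \<xi> s) * Om_slope \<xi> s s)"
      using x unfolding case_prod_beta
      by (intro continuous_on_strip_compose[OF H]) (auto intro!: continuous_intros)
  qed auto
  moreover have "(\<lambda>\<xi>. Ft \<xi> (Om \<xi> s) * Om_slope \<xi> s s) integrable_on {0..x}" if "x \<in> {0..1}" for x s
    using continuous_on_strip_snd[OF H, of s] that
    by (intro integrable_continuous_real) (auto elim: continuous_on_subset)
  moreover have "continuous_on ({0..1} \<times> UNIV) (\<lambda>(x, s). path_integral_deriv Ft x s)"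
    unfolding path_integral_deriv_def by (rule integral_upper_continuous[OF H])
  ultimately show ?thesis unfolding transportable_def using F by blast
qed

text \<open>A kink of \<open>F\<close> across the line \<open>t = \<tau>\<close> is harmless because every characteristic crosses
  this line at most once.\<close>

lemma transportable_kink:
  assumes k: "continuous_on ({0..1} \<times> UNIV) (\<lambda>(x, t). k x t)"
    and kt: "continuous_on ({0..1} \<times> UNIV) (\<lambda>(x, t). kt x t)"
    and deriv: "\<And>x t. x \<in> {0..1} \<Longrightarrow> (k x has_real_derivative kt x t) (at t)"
    and zero: "\<And>x. x \<in> {0..1} \<Longrightarrow> k x \<tau> = 0"
    and bound: "\<And>x t. x \<in> {0..1} \<Longrightarrow> \<bar>kt x t\<bar> \<le> B"
  shows "transportable (\<lambda>x t. if t > \<tau> then k x t else 0) (\<lambda>x t. if t > \<tau> then kt x t else 0)"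
proof -
  define F where "F x t = (if t > \<tau> then k x t else 0)" for x t
  define Ft where "Ft x t = (if t > \<tau> then kt x t else 0)" for x t
  define H where "H \<xi> s = Ft \<xi> (Om \<xi> s) * Om_slope \<xi> s s" for \<xi> s
  define C where "C = B * exp L"
  have B: "0 \<le> B" using bound[of 0 0] by simp
  \<comment> \<open>Because \<open>k\<close> vanishes at \<tau>, switching it off earlier amounts to
    freezing time at \<tau>. Continuity and the Lipschitz bound of \<open>F\<close> are thus
    inherited from \<open>k\<close>.\<close>
  have F_max: "F x t = k x (max t \<tau>)" if "x \<in> {0..1}" for x t
    using zero[OF that] by (simp add: F_def max_def)
  have F_cont: "continuous_on ({0..1} \<times> UNIV) (\<lambda>(x, t). F x t)"
  proof -
    have "continuous_on ({0..1} \<times> UNIV) (\<lambda>z. k (fst z) (max (snd z) \<tau>))"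
      by (rule continuous_on_strip_compose[OF k]) (auto intro!: continuous_intros)
    then show ?thesis
      by (rule continuous_on_cong[THEN iffD1, rotated -1]) (auto simp: F_max)
  qed
  have F_lip: "\<bar>F x t' - F x t\<bar> \<le> B * \<bar>t' - t\<bar>" if x: "x \<in> {0..1}" for x t t'
  proof -
    have "\<bar>F x t' - F x t\<bar> = \<bar>max t' \<tau> - max t \<tau>\<bar> * \<bar>mean_slope (kt x) (max t \<tau>) (max t' \<tau>)\<bar>"
      unfolding F_max[OF x] mean_slope_diff[OF deriv[OF x]] by (simp add: abs_mult)
    also have "\<dots> \<le> \<bar>t' - t\<bar> * B"
      by (intro mult_mono mean_slope_bound bound x continuous_on_strip_fst[OF kt]) auto
    finally show ?thesis by (simp add: mult.commute)
  qed
  have H_bound: "\<bar>H \<xi> s\<bar> \<le> C" if "\<xi> \<in> {0..1}" for \<xi> s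
    unfolding H_def C_def abs_mult
    using bound[OF that] Om_slope_bounds[OF that, of s s] Om_slope_pos[of \<xi> s s] B
    by (intro mult_mono) (auto simp: Ft_def)
  have exceptional: "finite {\<xi> \<in> {0..1}. Om \<xi> s = \<tau>}" for s
  proof -
    have less: False if "\<xi> \<in> {0..1}" "\<eta> \<in> {0..1}" "Om \<xi> s = \<tau>" "Om \<eta> s = \<tau>" "\<xi> < \<eta>" for \<xi> \<eta>
    proof -
      have "0 < c0 * (\<eta> - \<xi>)" using that c0_pos by simp
      also have "\<dots> \<le> Om \<eta> s - Om \<xi> s" using that by (intro Om_diff_x(1)) auto
      finally show False using that by simp
    qed
    have "\<xi> = \<eta>" if "\<xi> \<in> {0..1}" "\<eta> \<in> {0..1}" "Om \<xi> s = \<tau>" "Om \<eta> s = \<tau>" for \<xi> \<eta>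
      using less[of \<xi> \<eta>] less[of \<eta> \<xi>] that by fastforce
    then show ?thesis
      by (cases "\<exists>\<xi>. \<xi> \<in> {0..1} \<and> Om \<xi> s = \<tau>") (auto intro: finite_subset[of _ "{_}"])
  qed
  have F_deriv: "(F x has_real_derivative Ft x t) (at t)" if x: "x \<in> {0..1}" and "t \<noteq> \<tau>" for x t
  proof (cases "t > \<tau>")
    case True
    have "(k x has_real_derivative Ft x t) (at t)"
      using deriv[OF x, of t] True by (simp add: Ft_def)
    then show ?thesis
      by (rule has_field_derivative_transform_within_open[where S = "{\<tau><..}"])
        (use True in \<open>auto simp: F_def\<close>)
  next
    case False
    have "((\<lambda>_. 0) has_real_derivative Ft x t) (at t)"
      using False by (simp add: Ft_def)
    then show ?thesis
      by (rule has_field_derivative_transform_within_open[where S = "{..<\<tau>}"])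
        (use False that in \<open>auto simp: F_def\<close>)
  qed
  have Om_lim: "(\<lambda>n. Om \<xi> (\<sigma> n)) \<longlonglongrightarrow> Om \<xi> s" if "\<xi> \<in> {0..1}" "\<sigma> \<longlonglongrightarrow> s" for \<xi> \<sigma> s
    using DERIV_isCont[OF Om_deriv_s[OF that(1), of s]] that(2) by (rule isCont_tendsto_compose)
  \<comment> \<open>The difference quotients in the entry time are bounded by \<open>C\<close> and
    converge off the finite exceptional set. Dominated convergence along a sequence yields the
    integrability of the limit and the derivative at once.\<close>
  have key: "(\<lambda>\<xi>. H \<xi> s) integrable_on {0..x}"
    "(\<lambda>n. (path_integral F x (\<sigma> n) - path_integral F x s) / (\<sigma> n - s))
      \<longlonglongrightarrow> integral {0..x} (\<lambda>\<xi>. H \<xi> s)"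
    if x: "x \<in> {0..1}" and \<sigma>: "\<And>n. \<sigma> n \<noteq> s" "\<sigma> \<longlonglongrightarrow> s" for x s \<sigma>
  proof -
    define h where "h n \<xi> = (F \<xi> (Om \<xi> (\<sigma> n)) - F \<xi> (Om \<xi> s)) / (\<sigma> n - s)" for n \<xi>
    have int: "(\<lambda>\<xi>. F \<xi> (Om \<xi> (\<sigma> n)) - F \<xi> (Om \<xi> s)) integrable_on {0..x}" for n
      by (intro integrable_diff along_path_integrable[OF F_cont x])
    have hb: "\<bar>h n \<xi>\<bar> \<le> C" if "\<xi> \<in> {0..x}" for n \<xi>
    proof -
      have \<xi>: "\<xi> \<in> {0..1}" using that x by auto
      have "\<bar>F \<xi> (Om \<xi> (\<sigma> n)) - F \<xi> (Om \<xi> s)\<bar> \<le> B * \<bar>Om \<xi> (\<sigma> n) - Om \<xi> s\<bar>"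
        by (rule F_lip[OF \<xi>])
      also have "\<dots> = B * (Om_slope \<xi> s (\<sigma> n) * \<bar>\<sigma> n - s\<bar>)"
        unfolding Om_diff_s[OF \<xi>] abs_mult using Om_slope_pos[of \<xi> s "\<sigma> n"] by simp
      also have "\<dots> \<le> B * (exp L * \<bar>\<sigma> n - s\<bar>)"
        using B Om_slope_bounds[OF \<xi>] by (intro mult_left_mono mult_right_mono) auto
      finally show ?thesis
        using \<sigma>(1)[of n] by (simp add: h_def C_def divide_le_eq mult.assoc)
    qed
    have hl: "(\<lambda>n. h n \<xi>) \<longlonglongrightarrow> H \<xi> s"
      if "\<xi> \<in> {0..x}" "\<xi> \<notin> {\<xi> \<in> {0..1}. Om \<xi> s = \<tau>}" for \<xi>
    proof -
      have \<xi>: "\<xi> \<in> {0..1}" "Om \<xi> s \<noteq> \<tau>" using that x by auto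
      have "((\<lambda>s. F \<xi> (Om \<xi> s)) has_real_derivative H \<xi> s) (at s)"
        unfolding H_def by (rule DERIV_chain2[OF F_deriv[OF \<xi>] Om_deriv_s[OF \<xi>(1)]])
      then have "((\<lambda>y. (F \<xi> (Om \<xi> y) - F \<xi> (Om \<xi> s)) / (y - s)) \<longlongrightarrow> H \<xi> s) (at s)"
        by (simp add: has_field_derivative_iff)
      moreover have "filterlim \<sigma> (at s) sequentially"
        using \<sigma> by (simp add: filterlim_at)
      ultimately show ?thesis unfolding h_def by (rule filterlim_compose)
    qed
    have hi: "h n integrable_on {0..x}" for n
      unfolding h_def by (intro integrable_on_divide int)
    have eq: "integral {0..x} (h n) = (path_integral F x (\<sigma> n) - path_integral F x s) / (\<sigma> n - s)" for n
      unfolding h_def path_integral_def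
      using integral_diff[OF along_path_integrable[OF F_cont x] along_path_integrable[OF F_cont x]]
      by simp
    show "(\<lambda>\<xi>. H \<xi> s) integrable_on {0..x}"
      "(\<lambda>n. (path_integral F x (\<sigma> n) - path_integral F x s) / (\<sigma> n - s))
        \<longlonglongrightarrow> integral {0..x} (\<lambda>\<xi>. H \<xi> s)"
      using dominated_convergence_except_finite[OF exceptional hi hb hl] by (simp_all add: eq)
  qed
  have H_int: "(\<lambda>\<xi>. H \<xi> s) integrable_on {0..x}" if "x \<in> {0..1}" for x s
  proof (rule key(1)[OF that])
    \<comment> \<open>One concrete sequence tending to \<open>s\<close> without reaching it suffices
      to extract the integrability.\<close>
    show "(\<lambda>n. s + 1 / real (Suc n)) \<longlonglongrightarrow> s"
      using tendsto_add[OF tendsto_const LIMSEQ_inverse_real_of_nat, of s]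
      by (simp add: inverse_eq_divide)
  qed (simp del: of_nat_Suc)
  have d: "(path_integral F x has_real_derivative path_integral_deriv Ft x s) (at s)"
    if x: "x \<in> {0..1}" for x s
    unfolding has_field_derivative_iff tendsto_at_iff_sequentially
    using key(2)[OF x, of _ s] by (auto simp: o_def path_integral_deriv_def H_def)
  have c: "continuous_on ({0..1} \<times> UNIV) (\<lambda>(x, s). path_integral_deriv Ft x s)"
  proof (rule continuous_on_strip_lipschitz_fst)
    fix x x' s :: real assume x: "x \<in> {0..1}" "x' \<in> {0..1}"
    have *: "\<bar>path_integral_deriv Ft y' s - path_integral_deriv Ft y s\<bar> \<le> C * (y' - y)"
      if "0 \<le> y" "y \<le> y'" "y' \<le> 1" for y y'
    proof -
      have "path_integral_deriv Ft y s + integral {y..y'} (\<lambda>\<xi>. H \<xi> s) = path_integral_deriv Ft y' s"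
        unfolding path_integral_deriv_def H_def[symmetric]
        using that by (intro Henstock_Kurzweil_Integration.integral_combine H_int) auto
      moreover have "norm (integral {y..y'} (\<lambda>\<xi>. H \<xi> s)) \<le> integral {y..y'} (\<lambda>\<xi>. C)"
        using that H_bound
        by (intro integral_norm_bound_integral integrable_subinterval_real[OF H_int[of y']]) auto
      ultimately have "\<bar>path_integral_deriv Ft y' s - path_integral_deriv Ft y s\<bar> \<le> (y' - y) * C"
        using that by (simp flip: add_diff_eq)
      then show ?thesis by (simp add: mult.commute)
    qed
    show "\<bar>path_integral_deriv Ft x' s - path_integral_deriv Ft x s\<bar> \<le> C * \<bar>x' - x\<bar>"
      using *[of x x'] *[of x' x] x by (cases "x \<le> x'") (auto simp: abs_minus_commute)
  next
    fix x :: real assume x: "x \<in> {0..1}"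
    have "((path_integral_deriv Ft x) \<longlongrightarrow> path_integral_deriv Ft x s) (at s)" for s
      unfolding tendsto_at_iff_sequentially
    proof (intro allI impI)
      fix \<sigma> assume "\<forall>i. \<sigma> i \<in> UNIV - {s}" and \<sigma>: "\<sigma> \<longlonglongrightarrow> s"
      have "(\<lambda>n. integral {0..x} (\<lambda>\<xi>. H \<xi> (\<sigma> n))) \<longlonglongrightarrow> integral {0..x} (\<lambda>\<xi>. H \<xi> s)"
      proof (rule dominated_convergence_except_finite(2)[OF exceptional H_int[OF x]])
        show "\<bar>H \<xi> (\<sigma> n)\<bar> \<le> C" if "\<xi> \<in> {0..x}" for n \<xi>
          using H_bound[of \<xi>] that x by auto
        fix \<xi> assume that: "\<xi> \<in> {0..x}" "\<xi> \<notin> {\<xi> \<in> {0..1}. Om \<xi> s = \<tau>}"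
        then have \<xi>: "\<xi> \<in> {0..1}" "Om \<xi> s \<noteq> \<tau>" using x by auto
        have "continuous_on UNIV (\<lambda>t. Om_slope \<xi> t t)"
          by (rule continuous_on_strip_fst[OF Om_slope_diag_cont \<xi>(1)])
        then have "isCont (\<lambda>t. Om_slope \<xi> t t) s" by (simp add: continuous_on_eq_continuous_at)
        then have 1: "(\<lambda>n. Om_slope \<xi> (\<sigma> n) (\<sigma> n)) \<longlonglongrightarrow> Om_slope \<xi> s s"
          using \<sigma> by (rule isCont_tendsto_compose)
        have "isCont (kt \<xi>) t" for t
          using continuous_on_strip_fst[OF kt \<xi>(1), of UNIV] by (simp add: continuous_on_eq_continuous_at)
        \<comment> \<open>Away from the exceptional set the characteristic is strictly before or
          strictly after \<tau>, where \<open>Ft\<close> agrees locally with 0 or with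
          \<open>kt\<close>.\<close>
        then have "isCont (Ft \<xi>) (Om \<xi> s)"
        proof (cases "Om \<xi> s > \<tau>")
          case True
          then have "\<forall>\<^sub>F t in nhds (Om \<xi> s). t \<in> {\<tau><..}"
            by (intro eventually_nhds_in_open) auto
          then have "\<forall>\<^sub>F t in nhds (Om \<xi> s). kt \<xi> t = Ft \<xi> t"
            by eventually_elim (simp add: Ft_def)
          then show ?thesis using \<open>\<And>t. isCont (kt \<xi>) t\<close> isCont_cong by blast
        next
          case False
          then have "Om \<xi> s < \<tau>" using \<xi> by simp
          then have "\<forall>\<^sub>F t in nhds (Om \<xi> s). t \<in> {..<\<tau>}"
            by (intro eventually_nhds_in_open) auto
          then have "\<forall>\<^sub>F t in nhds (Om \<xi> s). 0 = Ft \<xi> t"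
            by eventually_elim (simp add: Ft_def)
          then have "isCont (\<lambda>_. 0::real) (Om \<xi> s) = isCont (Ft \<xi>) (Om \<xi> s)" by (rule isCont_cong)
          then show ?thesis by simp
        qed
        then have "(\<lambda>n. Ft \<xi> (Om \<xi> (\<sigma> n))) \<longlonglongrightarrow> Ft \<xi> (Om \<xi> s)"
          by (rule isCont_tendsto_compose) (rule Om_lim[OF \<xi>(1) \<sigma>])
        then show "(\<lambda>n. H \<xi> (\<sigma> n)) \<longlonglongrightarrow> H \<xi> s"
          unfolding H_def using 1 by (rule tendsto_mult)
      qed
      then show "((path_integral_deriv Ft x) \<circ> \<sigma>) \<longlonglongrightarrow> path_integral_deriv Ft x s"
        by (simp add: o_def path_integral_deriv_def H_def)
    qed
    then show "continuous_on UNIV (path_integral_deriv Ft x)"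
      by (simp add: continuous_on_def)
  qed
  have "transportable F Ft"
    unfolding transportable_def using F_cont H_int[unfolded H_def] d c by blast
  then show ?thesis unfolding F_def[abs_def] Ft_def[abs_def] .
qed

text \<open>The solution w of w_x + f w_t = F with w = G at x = 0: the value carried in from the
  boundary plus the source collected on the way.\<close>

definition "transport G F x t = G (S x t) + path_integral F x (S x t)"

definition "transport_deriv G' Ft x t = (G' (S x t) + path_integral_deriv Ft x (S x t)) * S_deriv x t"

lemma transport_cont:
  assumes "continuous_on UNIV G" "continuous_on ({0..1} \<times> UNIV) (\<lambda>(x, t). F x t)"
  shows "continuous_on ({0..1} \<times> UNIV) (\<lambda>(x, t). transport G F x t)"
  unfolding transport_def case_prod_beta
  by (intro continuous_intros continuous_on_compose2[OF assms(1)]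
      continuous_on_strip_compose[OF path_integral_cont[OF assms(2)]]
      continuous_on_strip_compose[OF S_cont]) auto

lemma transport_deriv_cont:
  assumes "continuous_on UNIV G'" "transportable F Ft"
  shows "continuous_on ({0..1} \<times> UNIV) (\<lambda>(x, t). transport_deriv G' Ft x t)"
proof -
  have D: "continuous_on ({0..1} \<times> UNIV) (\<lambda>(x, s). path_integral_deriv Ft x s)"
    using assms(2) by (simp add: transportable_def)
  have S: "continuous_on ({0..1} \<times> UNIV) (\<lambda>z. S (fst z) (snd z))"
    using S_cont by (simp add: case_prod_beta)
  have "continuous_on ({0..1} \<times> UNIV) (\<lambda>z. G' (S (fst z) (snd z)))"
    by (rule continuous_on_compose2[OF assms(1) S]) simp
  moreover have "continuous_on ({0..1} \<times> UNIV) (\<lambda>z. path_integral_deriv Ft (fst z) (S (fst z) (snd z)))"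
    by (rule continuous_on_strip_compose[OF D _ S]) (auto intro!: continuous_intros)
  ultimately show ?thesis
    using S_deriv_cont unfolding transport_deriv_def case_prod_beta
    by (intro continuous_intros)
qed

lemma transport_has_deriv_t:
  assumes "\<And>s. (G has_real_derivative G' s) (at s)" "transportable F Ft" "x \<in> {0..1}"
  shows "(transport G F x has_real_derivative transport_deriv G' Ft x t) (at t)"
proof -
  have "((\<lambda>s. G s + path_integral F x s) has_real_derivative
      G' (S x t) + path_integral_deriv Ft x (S x t)) (at (S x t))"
    using assms by (intro DERIV_add) (auto simp: transportable_def)
  from DERIV_chain2[OF this S_has_deriv[OF assms(3)]]
  show ?thesis unfolding transport_def[abs_def] transport_deriv_def .
qed

lemma transport_0: "transport G F 0 t = G t"
  by (simp add: transport_def path_integral_def)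

text \<open>Moving in \<open>x\<close> is split into moving along the characteristic and moving back in \<open>t\<close>;
  this way no derivative of \<open>S\<close> in \<open>x\<close> is needed.\<close>

lemma transport_has_deriv_x:
  assumes G: "\<And>s. (G has_real_derivative G' s) (at s)" "continuous_on UNIV G'"
    and F: "transportable F Ft" and x: "x \<in> {0..1}"
  shows "((\<lambda>y. transport G F y t) has_real_derivative
    F x t - f x t * transport_deriv G' Ft x t) (at x within {0..1})"
proof -
  let ?w = "transport G F" and ?wt = "transport_deriv G' Ft"
  define s where "s = S x t"
  have Om_x: "Om x s = t" using x by (simp add: s_def)
  have F_cont: "continuous_on ({0..1} \<times> UNIV) (\<lambda>(x, t). F x t)"
    using F by (simp add: transportable_def)
  define h where "h y = mean_slope (?wt y) t (Om y s)" for y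
  have h_cont: "continuous_on {0..1} h"
    unfolding h_def
    by (intro continuous_on_triple_compose[OF mean_slope_continuous[OF transport_deriv_cont[OF G(2) F]]]
        continuous_intros Om_cont_x) simp
  have w_eq: "?w y t = G s + path_integral F y s - (Om y s - t) * h y" if y: "y \<in> {0..1}" for y
  proof -
    have "?w y (Om y s) - ?w y t = (Om y s - t) * h y"
      unfolding h_def by (rule mean_slope_diff[OF transport_has_deriv_t[OF G(1) F y]])
    moreover have "?w y (Om y s) = G s + path_integral F y s"
      using y by (simp add: transport_def)
    ultimately show ?thesis by simp
  qed
  have d1: "((\<lambda>y. path_integral F y s) has_real_derivative F x t) (at x within {0..1})"
    using integral_has_real_derivative[OF continuous_on_strip_snd[OF along_path_cont[OF F_cont], of s] x]
    by (simp add: path_integral_def Om_x)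
  have d2: "((\<lambda>y. (Om y s - t) * h y) has_real_derivative f x t * h x) (at x within {0..1})"
  proof (rule DERIV_mult_zero)
    show "((\<lambda>y. Om y s - t) has_real_derivative f x t) (at x within {0..1})"
      using Om_deriv_x[OF x, of s] by (auto intro!: derivative_eq_intros simp: Om_x)
    show "continuous (at x within {0..1}) h"
      using h_cont x by (simp add: continuous_on_eq_continuous_within)
  qed (simp add: Om_x)
  have "((\<lambda>y. G s + path_integral F y s - (Om y s - t) * h y) has_real_derivative
      F x t - f x t * ?wt x t) (at x within {0..1})"
    using DERIV_diff[OF DERIV_add[OF DERIV_const d1] d2] by (simp add: h_def Om_x)
  then show ?thesis
    unfolding has_field_derivative_def
    by (rule has_derivative_transform[OF x, rotated]) (rule w_eq)
qed

text \<open>Time increases along characteristics, so a point with t \<le> \<tau> is reached only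
  from boundary values and sources that lie before \<tau> as well.\<close>

lemma transport_zero:
  assumes "\<And>s. s \<le> \<tau> \<Longrightarrow> G s = 0" "\<And>x t. x \<in> {0..1} \<Longrightarrow> t \<le> \<tau> \<Longrightarrow> F x t = 0"
    and x: "x \<in> {0..1}" and "t \<le> \<tau>"
  shows "transport G F x t = 0"
proof -
  have "Om \<xi> (S x t) \<le> \<tau>" if "\<xi> \<in> {0..x}" for \<xi>
    using Om_diff_x(1)[of \<xi> x "S x t"] that x assms(4) c0_pos
    by (simp, smt (verit) mult_nonneg_nonneg)
  then have "path_integral F x (S x t) = integral {0..x} (\<lambda>_. 0)"
    unfolding path_integral_def using x assms(2) by (intro integral_cong) auto
  moreover have "G (S x t) = 0" using S_le[OF x, of t] assms by simp
  ultimately show ?thesis by (simp add: transport_def)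
qed

lemma transport_diff:
  assumes F: "continuous_on ({0..1} \<times> UNIV) (\<lambda>(x, t). F x t)"
    "continuous_on ({0..1} \<times> UNIV) (\<lambda>(x, t). F' x t)" and x: "x \<in> {0..1}"
  shows "transport (\<lambda>s. G s - G' s) (\<lambda>x t. F x t - F' x t) x t = transport G F x t - transport G' F' x t"
  using integral_diff[OF along_path_integrable[OF F(1) x] along_path_integrable[OF F(2) x], of "S x t" "S x t"]
  by (simp add: transport_def path_integral_def)

text \<open>Going back from x to \<xi> along a characteristic takes time at least
  \<open>c0 * (x - \<xi>)\<close>. The exponential weight therefore decays backwards at rate
  \<open>\<nu> * c0\<close>, and its integral is smaller than its final value by that
  factor.\<close>

lemma exp_path_integral:
  assumes x: "x \<in> {0..1}" and lam: "0 < \<nu>"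
  shows "integral {0..x} (\<lambda>\<xi>. exp (\<nu> * (Om \<xi> s - \<tau>))) \<le> exp (\<nu> * (Om x s - \<tau>)) / (\<nu> * c0)"
proof -
  let ?E = "exp (\<nu> * (Om x s - \<tau>))"
  have lc: "0 < \<nu> * c0" using lam c0_pos by simp
  have "((\<lambda>\<xi>. ?E * exp (- (\<nu> * c0) * (x - \<xi>))) has_integral
      ?E / (\<nu> * c0) * exp (- (\<nu> * c0) * (x - x)) - ?E / (\<nu> * c0) * exp (- (\<nu> * c0) * (x - 0))) {0..x}"
    using x lc c0_pos lam
    by (intro fundamental_theorem_of_calculus)
      (auto intro!: derivative_eq_intros simp flip: has_real_derivative_iff_has_vector_derivative)
  then have E: "((\<lambda>\<xi>. ?E * exp (- (\<nu> * c0) * (x - \<xi>))) has_integral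
      ?E / (\<nu> * c0) - ?E / (\<nu> * c0) * exp (- (\<nu> * c0) * x)) {0..x}"
    by simp
  have "integral {0..x} (\<lambda>\<xi>. exp (\<nu> * (Om \<xi> s - \<tau>)))
      \<le> integral {0..x} (\<lambda>\<xi>. ?E * exp (- (\<nu> * c0) * (x - \<xi>)))"
  proof (rule integral_le)
    show "(\<lambda>\<xi>. exp (\<nu> * (Om \<xi> s - \<tau>))) integrable_on {0..x}"
      using x by (intro integrable_continuous_real continuous_intros continuous_on_subset[OF Om_cont_x]) auto
    show "(\<lambda>\<xi>. ?E * exp (- (\<nu> * c0) * (x - \<xi>))) integrable_on {0..x}" using E by blast
    fix \<xi> assume "\<xi> \<in> {0..x}"
    then have "\<nu> * (c0 * (x - \<xi>)) \<le> \<nu> * (Om x s - Om \<xi> s)"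
      using Om_diff_x(1)[of \<xi> x s] x lam by (intro mult_left_mono) auto
    then show "exp (\<nu> * (Om \<xi> s - \<tau>)) \<le> ?E * exp (- (\<nu> * c0) * (x - \<xi>))"
      by (simp add: algebra_simps flip: exp_add)
  qed
  also have "\<dots> = ?E / (\<nu> * c0) - ?E / (\<nu> * c0) * exp (- (\<nu> * c0) * x)"
    using E by (rule integral_unique)
  also have "\<dots> \<le> ?E / (\<nu> * c0)" using lc by simp
  finally show ?thesis .
qed

text \<open>Two gains are recorded separately. Boundary values arrive with a delay of at least
  \<open>c0 * x\<close>, hence the factor \<open>exp (- (\<nu> * c0 * x))\<close>; a source gains
  \<open>1 / (\<nu> * c0)\<close> by \<open>exp_path_integral\<close>. In the derivative one factor
  \<open>exp L\<close> comes from \<open>Om_slope\<close> and one from \<open>S_deriv\<close>; the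
  same constant is kept for the function, so that a single weight controls both.\<close>

lemma transport_bound:
  assumes lam: "0 < \<nu>" and A: "0 \<le> A" and D: "0 \<le> D"
    and G: "\<And>s. \<bar>G s\<bar> \<le> A * exp (\<nu> * (s - \<tau>))" "\<And>s. \<bar>G' s\<bar> \<le> A * exp (\<nu> * (s - \<tau>))"
    and F: "\<And>x t. x \<in> {0..1} \<Longrightarrow> \<bar>F x t\<bar> \<le> D * exp (\<nu> * (t - \<tau>))"
      "\<And>x t. x \<in> {0..1} \<Longrightarrow> \<bar>Ft x t\<bar> \<le> D * exp (\<nu> * (t - \<tau>))"
    and tr: "transportable F Ft" and x: "x \<in> {0..1}"
  shows "\<bar>transport G F x t\<bar> \<le> exp (2 * L) * (A * exp (- (\<nu> * c0 * x)) + D / (\<nu> * c0)) * exp (\<nu> * (t - \<tau>))"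
    "\<bar>transport_deriv G' Ft x t\<bar> \<le> exp (2 * L) * (A * exp (- (\<nu> * c0 * x)) + D / (\<nu> * c0)) * exp (\<nu> * (t - \<tau>))"
proof -
  let ?s = "S x t" and ?E = "exp (\<nu> * (t - \<tau>))"
  have eL: "1 \<le> exp L" "exp (2 * L) = exp L * exp L"
    using L_nonneg by (auto simp flip: exp_add)
  have lc: "0 < \<nu> * c0" using lam c0_pos by simp
  define Q where "Q = D / (\<nu> * c0)"
  have Q: "0 \<le> Q" using D lc by (simp add: Q_def)
  have exp_int: "(\<lambda>\<xi>. C * exp (\<nu> * (Om \<xi> ?s - \<tau>))) integrable_on {0..x}" for C
    using x by (intro integrable_continuous_real continuous_intros continuous_on_subset[OF Om_cont_x]) auto
  have int_le: "integral {0..x} (\<lambda>\<xi>. D * exp (\<nu> * (Om \<xi> ?s - \<tau>))) \<le> Q * ?E"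
    using mult_left_mono[OF exp_path_integral[OF x lam, of ?s \<tau>] D] x by (simp add: Q_def)
  have "\<nu> * (c0 * x) \<le> \<nu> * (t - ?s)"
    using Om_diff_x(1)[of 0 x ?s] x lam by (intro mult_left_mono) (auto simp: Om_0)
  then have "exp (\<nu> * (?s - \<tau>)) \<le> exp (- (\<nu> * c0 * x)) * ?E"
    by (simp add: algebra_simps flip: exp_add)
  then have AE: "A * exp (\<nu> * (?s - \<tau>)) \<le> A * exp (- (\<nu> * c0 * x)) * ?E"
    using A mult_left_mono by (fastforce simp: mult.assoc)
  define R where "R = A * exp (- (\<nu> * c0 * x)) + Q"
  have R: "0 \<le> R" using A Q by (simp add: R_def)
  have F_cont: "continuous_on ({0..1} \<times> UNIV) (\<lambda>(x, t). F x t)"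
    using tr by (simp add: transportable_def)
  have "norm (path_integral F x ?s) \<le> integral {0..x} (\<lambda>\<xi>. D * exp (\<nu> * (Om \<xi> ?s - \<tau>)))"
    unfolding path_integral_def
    using x F(1) exp_int by (intro integral_norm_bound_integral along_path_integrable[OF F_cont]) auto
  then have p: "\<bar>path_integral F x ?s\<bar> \<le> Q * ?E" using int_le by simp
  have "\<bar>transport G F x t\<bar> \<le> R * ?E"
    using p G(1)[of ?s] AE unfolding transport_def R_def distrib_right by linarith
  also have "\<dots> \<le> exp (2 * L) * (R * ?E)"
    using eL R mult_right_mono[of 1 "exp L * exp L" "R * ?E"] mult_mono[of 1 "exp L" 1 "exp L"] by simp
  finally show "\<bar>transport G F x t\<bar> \<le> exp (2 * L) * (A * exp (- (\<nu> * c0 * x)) + D / (\<nu> * c0)) * ?E"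
    by (simp add: R_def Q_def mult.assoc)
  have "norm (path_integral_deriv Ft x ?s)
      \<le> integral {0..x} (\<lambda>\<xi>. exp L * (D * exp (\<nu> * (Om \<xi> ?s - \<tau>))))"
    unfolding path_integral_deriv_def
  proof (rule integral_norm_bound_integral)
    show "(\<lambda>\<xi>. Ft \<xi> (Om \<xi> ?s) * Om_slope \<xi> ?s ?s) integrable_on {0..x}"
      using tr x by (simp add: transportable_def)
    show "(\<lambda>\<xi>. exp L * (D * exp (\<nu> * (Om \<xi> ?s - \<tau>)))) integrable_on {0..x}"
      using exp_int[of "exp L * D"] by (simp only: mult.assoc)
    fix \<xi> assume "\<xi> \<in> {0..x}"
    then have \<xi>: "\<xi> \<in> {0..1}" using x by auto
    show "norm (Ft \<xi> (Om \<xi> ?s) * Om_slope \<xi> ?s ?s) \<le> exp L * (D * exp (\<nu> * (Om \<xi> ?s - \<tau>)))"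
      using F(2)[OF \<xi>, of "Om \<xi> ?s"] Om_slope_bounds[OF \<xi>, of ?s ?s] Om_slope_pos[of \<xi> ?s ?s] D
      unfolding real_norm_def abs_mult by (subst mult.commute) (intro mult_mono; simp)
  qed
  also have "\<dots> \<le> exp L * (Q * ?E)"
    using int_le by simp
  finally have p': "\<bar>path_integral_deriv Ft x ?s\<bar> \<le> exp L * (Q * ?E)" by simp
  have "\<bar>G' ?s + path_integral_deriv Ft x ?s\<bar> \<le> A * exp (- (\<nu> * c0 * x)) * ?E + exp L * (Q * ?E)"
    using p' G(2)[of ?s] AE by linarith
  also have "\<dots> \<le> exp L * (A * exp (- (\<nu> * c0 * x)) * ?E) + exp L * (Q * ?E)"
    using eL A mult_right_mono[of 1 "exp L" "A * exp (- (\<nu> * c0 * x)) * ?E"] by simp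
  also have "\<dots> = exp L * (R * ?E)" by (simp add: R_def algebra_simps)
  finally have "\<bar>transport_deriv G' Ft x t\<bar> \<le> exp L * (R * ?E) * exp L"
    unfolding transport_deriv_def abs_mult
    using S_deriv_bounds[OF x, of t] R by (intro mult_mono) auto
  then show "\<bar>transport_deriv G' Ft x t\<bar> \<le> exp (2 * L) * (A * exp (- (\<nu> * c0 * x)) + D / (\<nu> * c0)) * ?E"
    unfolding eL(2) R_def Q_def by (simp only: mult_ac)
qed

end

section \<open>The forced problem with zero past\<close>

text \<open>The weight grows exponentially in time, so the series below converge uniformly only up
  to each finite time. Continuity is local and does not mind.\<close>

lemma continuous_on_strip_from_below:
  fixes u :: "real \<Rightarrow> real \<Rightarrow> real"
  assumes "\<And>T. continuous_on ({0..1} \<times> {..<T}) (\<lambda>(x, t). u x t)"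
  shows "continuous_on ({0..1} \<times> UNIV) (\<lambda>(x, t). u x t)"
  unfolding continuous_on_eq_continuous_within
proof
  fix z :: "real \<times> real" assume z: "z \<in> {0..1} \<times> UNIV"
  define T where "T = snd z + 1"
  have "continuous (at z within {0..1} \<times> {..<T}) (\<lambda>(x, t). u x t)"
    using assms[of T] z by (auto simp: continuous_on_eq_continuous_within T_def)
  moreover have "at z within {0..1} \<times> {..<T} = at z within {0..1} \<times> UNIV"
    by (rule at_within_nhd[of _ "UNIV \<times> {..<T}"]) (use z in \<open>auto simp: T_def open_Times\<close>)
  ultimately show "continuous (at z within {0..1} \<times> UNIV) (\<lambda>(x, t). u x t)" by simp
qed

text \<open>The derivative \<open>ut\<close> is carried along as a second family because the
  iteration must estimate it together with \<open>u\<close>. Zero values up to \<tau> take the place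
  of an initial condition, so no corner occurs.\<close>

definition null_before :: "real \<Rightarrow> ('n \<Rightarrow> real \<Rightarrow> real \<Rightarrow> real) \<Rightarrow> ('n \<Rightarrow> real \<Rightarrow> real \<Rightarrow> real) \<Rightarrow> bool"
  where "null_before \<tau> u ut \<longleftrightarrow> (\<forall>j.
    continuous_on ({0..1} \<times> UNIV) (\<lambda>(x, t). u j x t) \<and>
    continuous_on ({0..1} \<times> UNIV) (\<lambda>(x, t). ut j x t) \<and>
    (\<forall>x\<in>{0..1}. \<forall>t. (u j x has_real_derivative ut j x t) (at t)) \<and>
    (\<forall>x\<in>{0..1}. \<forall>t\<le>\<tau>. u j x t = 0))"

lemma null_beforeD:
  assumes "null_before \<tau> u ut"
  shows "continuous_on ({0..1} \<times> UNIV) (\<lambda>(x, t). u j x t)"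
    "continuous_on ({0..1} \<times> UNIV) (\<lambda>(x, t). ut j x t)"
    "x \<in> {0..1} \<Longrightarrow> (u j x has_real_derivative ut j x t) (at t)"
    "x \<in> {0..1} \<Longrightarrow> t \<le> \<tau> \<Longrightarrow> u j x t = 0"
  using assms by (auto simp: null_before_def)

lemma null_before_zero: "null_before \<tau> (\<lambda>j x t. 0) (\<lambda>j x t. 0)"
  by (simp add: null_before_def)

lemma null_before_add:
  assumes "null_before \<tau> u ut" "null_before \<tau> w wt"
  shows "null_before \<tau> (\<lambda>j x t. u j x t + w j x t) (\<lambda>j x t. ut j x t + wt j x t)"
  using assms unfolding null_before_def case_prod_beta
  by (auto intro!: continuous_intros derivative_intros)

lemma null_before_diff:
  assumes "null_before \<tau> u ut" "null_before \<tau> w wt"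
  shows "null_before \<tau> (\<lambda>j x t. u j x t - w j x t) (\<lambda>j x t. ut j x t - wt j x t)"
  using assms unfolding null_before_def case_prod_beta
  by (auto intro!: continuous_intros derivative_intros)

text \<open>The system after reflection: all components move towards increasing x, and
  \<open>f\<close> and \<open>g\<close> result from dividing each equation by its speed. Components
  reflected differently use different coordinates for the same physical point;
  \<open>\<rho> j k\<close> translates the coordinate of component j into that of component
  k.\<close>

locale hyperbolic =
  fixes f ft :: "'n::finite \<Rightarrow> real \<Rightarrow> real \<Rightarrow> real" and c0 c1 L :: real
    and g gt :: "'n \<Rightarrow> 'n \<Rightarrow> real \<Rightarrow> real \<Rightarrow> real" and B :: real
    and \<rho> :: "'n \<Rightarrow> 'n \<Rightarrow> real \<Rightarrow> real" and p :: "'n \<Rightarrow> 'n \<Rightarrow> real"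
  assumes flows: "\<And>j. flow (f j) (ft j) c0 c1 L"
    and g_cont: "\<And>j k. continuous_on ({0..1} \<times> UNIV) (\<lambda>(x, t). g j k x t)"
    and gt_cont: "\<And>j k. continuous_on ({0..1} \<times> UNIV) (\<lambda>(x, t). gt j k x t)"
    and g_deriv: "\<And>j k x t. x \<in> {0..1} \<Longrightarrow> (g j k x has_real_derivative gt j k x t) (at t)"
    and g_le: "\<And>j k x t. x \<in> {0..1} \<Longrightarrow> \<bar>g j k x t\<bar> \<le> B"
    and gt_le: "\<And>j k x t. x \<in> {0..1} \<Longrightarrow> \<bar>gt j k x t\<bar> \<le> B"
    and \<rho>_cont: "\<And>j k. continuous_on {0..1} (\<rho> j k)"
    and \<rho>_range: "\<And>j k x. x \<in> {0..1} \<Longrightarrow> \<rho> j k x \<in> {0..1}"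
begin

definition "coupling u j x t = - (\<Sum>k\<in>UNIV. g j k x t * u k (\<rho> j k x) t)"

definition "coupling_t u ut j x t =
  - (\<Sum>k\<in>UNIV. gt j k x t * u k (\<rho> j k x) t + g j k x t * ut k (\<rho> j k x) t)"

definition "inflow u j s = (\<Sum>k\<in>UNIV. p j k * u k 1 s)"

text \<open>One sweep of the iteration: each component is transported on its own, with its inflow
  and its coupling term taken from the previous iterate.\<close>

definition "step u j = flow.transport (f j) (inflow u j) (coupling u j)"

definition "step_t u ut j = flow.transport_deriv (f j) (ft j) (inflow ut j) (coupling_t u ut j)"

lemma c0_pos: "0 < c0"
  using flows[of undefined] by (simp add: flow_def)

lemma B_nonneg: "0 \<le> B"
  using g_le[of 0 undefined undefined 0] by simp

section \<open>The iteration map on families with zero past\<close>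

lemma reflected_cont:
  assumes "continuous_on ({0..1} \<times> UNIV) (\<lambda>(x, t). u x t)"
  shows "continuous_on ({0..1} \<times> UNIV) (\<lambda>(x, t). u (\<rho> j k x) t)"
  unfolding case_prod_beta
  by (rule continuous_on_strip_compose[OF assms])
    (use \<rho>_range in \<open>auto intro!: continuous_intros continuous_on_compose2[OF \<rho>_cont]\<close>)

lemma coupling_cont:
  assumes "null_before \<tau> u ut"
  shows "continuous_on ({0..1} \<times> UNIV) (\<lambda>(x, t). coupling u j x t)"
    "continuous_on ({0..1} \<times> UNIV) (\<lambda>(x, t). coupling_t u ut j x t)"
  using reflected_cont[OF null_beforeD(1)[OF assms]] reflected_cont[OF null_beforeD(2)[OF assms]]
    g_cont gt_cont
  unfolding coupling_def coupling_t_def case_prod_beta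
  by (auto intro!: continuous_intros)

lemma coupling_deriv:
  assumes "null_before \<tau> u ut" and x: "x \<in> {0..1}"
  shows "(coupling u j x has_real_derivative coupling_t u ut j x t) (at t)"
proof -
  have "((\<lambda>t. g j k x t * u k (\<rho> j k x) t) has_real_derivative
      gt j k x t * u k (\<rho> j k x) t + g j k x t * ut k (\<rho> j k x) t) (at t)" for k
    using DERIV_mult[OF g_deriv[OF x] null_beforeD(3)[OF assms(1) \<rho>_range[OF x]]]
    by (simp add: mult.commute)
  then show ?thesis
    unfolding coupling_def[abs_def] coupling_t_def
    by (intro DERIV_minus DERIV_sum)
qed

lemma coupling_transportable:
  assumes "null_before \<tau> u ut"
  shows "flow.transportable (f j) (ft j) (coupling u j) (coupling_t u ut j)"
  by (intro flow.transportable_C1[OF flows] coupling_cont[OF assms] coupling_deriv[OF assms])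

lemma inflow_deriv:
  assumes "null_before \<tau> u ut"
  shows "(inflow u j has_real_derivative inflow ut j s) (at s)"
  unfolding inflow_def[abs_def]
  by (intro DERIV_sum DERIV_cmult null_beforeD(3)[OF assms]) simp

lemma inflow_cont:
  assumes "null_before \<tau> u ut"
  shows "continuous_on UNIV (inflow u j)" "continuous_on UNIV (inflow ut j)"
  unfolding inflow_def[abs_def]
  using continuous_on_strip_fst[OF null_beforeD(1)[OF assms], of 1 UNIV]
    continuous_on_strip_fst[OF null_beforeD(2)[OF assms], of 1 UNIV]
  by (auto intro!: continuous_intros)

lemma null_before_step:
  assumes u: "null_before \<tau> u ut"
  shows "null_before \<tau> (step u) (step_t u ut)"
  unfolding null_before_def
proof (intro allI conjI ballI impI)
  fix j
  show "continuous_on ({0..1} \<times> UNIV) (\<lambda>(x, t). step u j x t)"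
    unfolding step_def
    by (intro flow.transport_cont[OF flows] inflow_cont[OF u] coupling_cont[OF u])
  show "continuous_on ({0..1} \<times> UNIV) (\<lambda>(x, t). step_t u ut j x t)"
    unfolding step_t_def
    by (rule flow.transport_deriv_cont[OF flows inflow_cont(2)[OF u] coupling_transportable[OF u]])
  show "(step u j x has_real_derivative step_t u ut j x t) (at t)" if "x \<in> {0..1}" for x t
    unfolding step_def step_t_def
    by (intro flow.transport_has_deriv_t[OF flows] inflow_deriv[OF u] coupling_transportable[OF u] that)
  show "step u j x t = 0" if "x \<in> {0..1}" "t \<le> \<tau>" for x t
    unfolding step_def using null_beforeD(4)[OF u] \<rho>_range that
    by (intro flow.transport_zero[OF flows, of \<tau>]) (auto simp: inflow_def coupling_def)
qed

lemma step_diff: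
  assumes u: "null_before \<tau> u ut" and w: "null_before \<tau> w wt" and "x \<in> {0..1}"
  shows "step (\<lambda>j x t. u j x t - w j x t) j x t = step u j x t - step w j x t"
proof -
  have 1: "inflow (\<lambda>j x t. u j x t - w j x t) j = (\<lambda>s. inflow u j s - inflow w j s)"
    by (simp add: inflow_def fun_eq_iff right_diff_distrib sum_subtractf)
  have 2: "coupling (\<lambda>j x t. u j x t - w j x t) j = (\<lambda>x t. coupling u j x t - coupling w j x t)"
    by (simp add: coupling_def fun_eq_iff right_diff_distrib sum_subtractf)
  show ?thesis
    unfolding step_def 1 2
    by (rule flow.transport_diff[OF flows coupling_cont(1)[OF u] coupling_cont(1)[OF w] assms(3)])
qed

definition weight_bound :: "real \<Rightarrow> real \<Rightarrow> real \<Rightarrow> real \<Rightarrow> ('n \<Rightarrow> real \<Rightarrow> real \<Rightarrow> real) \<Rightarrow> bool"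
  where "weight_bound \<tau> \<kappa> \<nu> C u \<longleftrightarrow>
    (\<forall>j. \<forall>x\<in>{0..1}. \<forall>t. \<bar>u j x t\<bar> \<le> C * exp (- (\<kappa> * x)) * exp (\<nu> * (t - \<tau>)))"

text \<open>The inflow reads the old iterate at x = 1, where the spatial weight is
  \<open>exp (- \<kappa>)\<close>; this beats \<open>P\<close>. The coupling reads it at an
  arbitrary reflected point, where that weight is merely at most 1; here the gain is
  \<open>1 / (\<nu> * c0)\<close>, which has to make up for \<open>exp \<kappa>\<close> too. Each
  contribution is at most a quarter. The condition \<open>\<kappa> \<le> \<nu> * c0\<close> lets the
  arrival delay reproduce the spatial weight, and the 2 in front of the number of components counts
  the two products in \<open>coupling_t\<close>.\<close>

lemma step_bound:
  assumes u: "null_before \<tau> u ut" and C: "0 \<le> C"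
    and P: "\<And>j. (\<Sum>k\<in>UNIV. \<bar>p j k\<bar>) \<le> P" and \<kappa>: "0 \<le> \<kappa>" and \<nu>: "0 < \<nu>" "\<kappa> \<le> \<nu> * c0"
    and small: "exp (2 * L) * (P * exp (- \<kappa>)) \<le> 1 / 4"
      "exp (2 * L) * (2 * real CARD('n) * B / (\<nu> * c0)) \<le> exp (- \<kappa>) / 4"
    and b: "weight_bound \<tau> \<kappa> \<nu> C u" "weight_bound \<tau> \<kappa> \<nu> C ut"
  shows "weight_bound \<tau> \<kappa> \<nu> (C / 2) (step u)" "weight_bound \<tau> \<kappa> \<nu> (C / 2) (step_t u ut)"
proof -
  let ?E = "\<lambda>t. exp (\<nu> * (t - \<tau>))"
  define A where "A = P * (C * exp (- \<kappa>))"
  define D where "D = 2 * real CARD('n) * B * C"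
  have P0: "0 \<le> P" using P[of undefined] by (meson abs_ge_zero order_trans sum_nonneg)
  have A0: "0 \<le> A" using P0 C by (simp add: A_def)
  have D0: "0 \<le> D" using B_nonneg C by (simp add: D_def)
  have "\<bar>inflow w j s\<bar> \<le> A * ?E s" if "weight_bound \<tau> \<kappa> \<nu> C w" for w j s
  proof -
    have "\<bar>inflow w j s\<bar> \<le> (\<Sum>k\<in>UNIV. \<bar>p j k\<bar> * (C * exp (- \<kappa>) * ?E s))"
      unfolding inflow_def
    proof (rule order_trans[OF sum_abs sum_mono])
      fix k
      have "\<bar>w k 1 s\<bar> \<le> C * exp (- \<kappa>) * ?E s"
        using that[unfolded weight_bound_def, rule_format, of 1 k s] by simp
      then show "\<bar>p j k * w k 1 s\<bar> \<le> \<bar>p j k\<bar> * (C * exp (- \<kappa>) * ?E s)"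
        unfolding abs_mult by (intro mult_left_mono) auto
    qed
    also have "\<dots> \<le> P * (C * exp (- \<kappa>) * ?E s)"
      unfolding sum_distrib_right[symmetric] using C by (intro mult_right_mono P) auto
    finally show ?thesis by (simp add: A_def mult.assoc)
  qed
  note G = this[OF b(1)] this[OF b(2)]
  have w_le: "\<bar>w k (\<rho> j k x) t\<bar> \<le> C * ?E t" if "weight_bound \<tau> \<kappa> \<nu> C w" "x \<in> {0..1}" for w j k x t
  proof -
    have "\<bar>w k (\<rho> j k x) t\<bar> \<le> C * exp (- (\<kappa> * \<rho> j k x)) * ?E t"
      using that(1) \<rho>_range[OF that(2)] by (simp add: weight_bound_def)
    also have "\<dots> \<le> C * 1 * ?E t"
      using C \<kappa> \<rho>_range[OF that(2), of j k] by (intro mult_right_mono mult_left_mono) auto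
    finally show ?thesis by simp
  qed
  have F1: "\<bar>coupling u j x t\<bar> \<le> D * ?E t" if x: "x \<in> {0..1}" for j x t
  proof -
    have "\<bar>coupling u j x t\<bar> \<le> (\<Sum>k\<in>(UNIV :: 'n set). B * (C * ?E t))"
      unfolding coupling_def abs_minus_cancel
    proof (rule order_trans[OF sum_abs sum_mono])
      fix k
      show "\<bar>g j k x t * u k (\<rho> j k x) t\<bar> \<le> B * (C * ?E t)"
        unfolding abs_mult using B_nonneg by (intro mult_mono g_le x w_le[OF b(1)]) auto
    qed
    also have "\<dots> \<le> D * ?E t"
      using B_nonneg C by (simp add: D_def mult_ac)
    finally show ?thesis .
  qed
  have F2: "\<bar>coupling_t u ut j x t\<bar> \<le> D * ?E t" if x: "x \<in> {0..1}" for j x t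
  proof -
    have "\<bar>coupling_t u ut j x t\<bar> \<le> (\<Sum>k\<in>(UNIV :: 'n set). 2 * (B * (C * ?E t)))"
      unfolding coupling_t_def abs_minus_cancel
    proof (rule order_trans[OF sum_abs sum_mono])
      fix k
      have "\<bar>gt j k x t * u k (\<rho> j k x) t\<bar> \<le> B * (C * ?E t)"
        unfolding abs_mult using B_nonneg by (intro mult_mono gt_le x w_le[OF b(1)]) auto
      moreover have "\<bar>g j k x t * ut k (\<rho> j k x) t\<bar> \<le> B * (C * ?E t)"
        unfolding abs_mult using B_nonneg by (intro mult_mono g_le x w_le[OF b(2)]) auto
      ultimately show "\<bar>gt j k x t * u k (\<rho> j k x) t + g j k x t * ut k (\<rho> j k x) t\<bar> \<le> 2 * (B * (C * ?E t))"
        by linarith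
    qed
    also have "\<dots> = D * ?E t" by (simp add: D_def mult_ac)
    finally show ?thesis .
  qed
  have total: "exp (2 * L) * (A * exp (- (\<nu> * c0 * x)) + D / (\<nu> * c0)) * ?E t
      \<le> C / 2 * exp (- (\<kappa> * x)) * ?E t" if x: "x \<in> {0..1}" for x t
  proof (intro mult_right_mono)
    have "\<kappa> * x \<le> \<nu> * c0 * x" using x \<nu> by (intro mult_right_mono) auto
    then have "exp (2 * L) * (A * exp (- (\<nu> * c0 * x))) \<le> exp (2 * L) * (A * exp (- (\<kappa> * x)))"
      using A0 by (intro mult_left_mono) auto
    also have "\<dots> = exp (2 * L) * (P * exp (- \<kappa>)) * (C * exp (- (\<kappa> * x)))"
      by (simp add: A_def mult_ac)
    also have "\<dots> \<le> 1 / 4 * (C * exp (- (\<kappa> * x)))"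
      using C by (intro mult_right_mono small) auto
    finally have 1: "exp (2 * L) * (A * exp (- (\<nu> * c0 * x))) \<le> 1 / 4 * (C * exp (- (\<kappa> * x)))" .
    have "exp (2 * L) * (D / (\<nu> * c0)) = exp (2 * L) * (2 * real CARD('n) * B / (\<nu> * c0)) * C"
      by (simp add: D_def)
    also have "\<dots> \<le> exp (- \<kappa>) / 4 * C" using C by (intro mult_right_mono small) auto
    also have "\<dots> \<le> exp (- (\<kappa> * x)) / 4 * C"
      using C \<kappa> x by (intro mult_right_mono divide_right_mono) (auto simp: mult_left_le)
    also have "\<dots> = 1 / 4 * (C * exp (- (\<kappa> * x)))" by simp
    finally have 2: "exp (2 * L) * (D / (\<nu> * c0)) \<le> 1 / 4 * (C * exp (- (\<kappa> * x)))" .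
    have "C / 2 * exp (- (\<kappa> * x)) = 1 / 2 * (C * exp (- (\<kappa> * x)))" by simp
    then show "exp (2 * L) * (A * exp (- (\<nu> * c0 * x)) + D / (\<nu> * c0)) \<le> C / 2 * exp (- (\<kappa> * x))"
      unfolding distrib_left using 1 2 by linarith
  qed simp
  have "\<bar>step u j x t\<bar> \<le> C / 2 * exp (- (\<kappa> * x)) * ?E t" if x: "x \<in> {0..1}" for j x t
    unfolding step_def
    by (rule order_trans[OF flow.transport_bound(1)[OF flows \<nu>(1) A0 D0 G(1)[of j] G(2)[of j]
          F1 F2 coupling_transportable[OF u]] total]) (assumption | rule x)+
  moreover have "\<bar>step_t u ut j x t\<bar> \<le> C / 2 * exp (- (\<kappa> * x)) * ?E t" if x: "x \<in> {0..1}" for j x t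
    unfolding step_t_def
    by (rule order_trans[OF flow.transport_bound(2)[OF flows \<nu>(1) A0 D0 G(1)[of j] G(2)[of j]
          F1 F2 coupling_transportable[OF u]] total]) (assumption | rule x)+
  ultimately show "weight_bound \<tau> \<kappa> \<nu> (C / 2) (step u)" "weight_bound \<tau> \<kappa> \<nu> (C / 2) (step_t u ut)"
    unfolding weight_bound_def by blast+
qed

text \<open>Geometric bounds for terms and derivatives give locally uniform convergence of both
  series, hence termwise differentiation. The tail bounds, with 2 as the sum of the geometric
  series, have the form that \<open>step_bound\<close> accepts, so that \<open>step\<close> can be
  applied to the remainder.\<close>

lemma null_before_series:
  assumes d: "\<And>n. null_before \<tau> (d n) (dt n)"
    and b: "\<And>n. weight_bound \<tau> \<kappa> \<nu> (C * (1/2) ^ n) (d n)" "\<And>n. weight_bound \<tau> \<kappa> \<nu> (C * (1/2) ^ n) (dt n)"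
    and pos: "0 \<le> \<kappa>" "0 < \<nu>" "0 \<le> C"
  defines "v \<equiv> \<lambda>j x t. \<Sum>n. d n j x t" and "vt \<equiv> \<lambda>j x t. \<Sum>n. dt n j x t"
  shows "null_before \<tau> v vt"
    "\<And>N. weight_bound \<tau> \<kappa> \<nu> (2 * C * (1/2) ^ N) (\<lambda>j x t. v j x t - (\<Sum>n<N. d n j x t))"
    "\<And>N. weight_bound \<tau> \<kappa> \<nu> (2 * C * (1/2) ^ N) (\<lambda>j x t. vt j x t - (\<Sum>n<N. dt n j x t))"
    "\<And>j x t. x \<in> {0..1} \<Longrightarrow> (\<lambda>N. \<Sum>n<N. d n j x t) \<longlonglongrightarrow> v j x t"
proof -
  define M where "M T n = C * exp (\<nu> * (T - \<tau>)) * (1/2) ^ n" for T and n :: nat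
  have M: "summable (M T)" for T
    unfolding M_def by (intro summable_mult summable_geometric) simp
  have le: "norm (w n j x t) \<le> M T n"
    if w: "\<And>n. weight_bound \<tau> \<kappa> \<nu> (C * (1/2) ^ n) (w n)" and x: "x \<in> {0..1}" and t: "t \<le> T" for w n j x t T
  proof -
    have "\<bar>w n j x t\<bar> \<le> C * (1/2) ^ n * exp (- (\<kappa> * x)) * exp (\<nu> * (t - \<tau>))"
      using w[unfolded weight_bound_def] x by blast
    also have "\<dots> \<le> C * (1/2) ^ n * 1 * exp (\<nu> * (T - \<tau>))"
      using pos x t by (intro mult_mono) auto
    finally show ?thesis by (simp add: M_def mult_ac)
  qed
  have cont: "continuous_on ({0..1} \<times> UNIV) (\<lambda>(x, t). \<Sum>n. w n j x t)"
    if w: "\<And>n. weight_bound \<tau> \<kappa> \<nu> (C * (1/2) ^ n) (w n)"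
      and c: "\<And>n. continuous_on ({0..1} \<times> UNIV) (\<lambda>(x, t). w n j x t)" for w j
  proof (rule continuous_on_strip_from_below)
    fix T
    have "uniform_limit ({0..1} \<times> {..<T}) (\<lambda>N z. \<Sum>n<N. w n j (fst z) (snd z))
        (\<lambda>z. \<Sum>n. w n j (fst z) (snd z)) sequentially"
      by (rule Weierstrass_m_test[OF _ M[of T]]) (use le[OF w] in auto)
    moreover have "continuous_on ({0..1} \<times> {..<T}) (\<lambda>z. \<Sum>n<N. w n j (fst z) (snd z))" for N
      using c by (intro continuous_on_sum continuous_on_subset[OF c[unfolded case_prod_beta]]) auto
    ultimately have "continuous_on ({0..1} \<times> {..<T}) (\<lambda>z. \<Sum>n. w n j (fst z) (snd z))"
      by (intro uniform_limit_theorem) auto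
    then show "continuous_on ({0..1} \<times> {..<T}) (\<lambda>(x, t). \<Sum>n. w n j x t)"
      by (simp add: case_prod_beta)
  qed
  have summ: "summable (\<lambda>n. w n j x t)"
    if w: "\<And>n. weight_bound \<tau> \<kappa> \<nu> (C * (1/2) ^ n) (w n)" and x: "x \<in> {0..1}" for w j x t
    by (rule summable_comparison_test'[OF M[of t], of 0]) (use le[OF w x] in auto)
  have tail: "weight_bound \<tau> \<kappa> \<nu> (2 * C * (1/2) ^ N) (\<lambda>j x t. (\<Sum>n. w n j x t) - (\<Sum>n<N. w n j x t))"
    if w: "\<And>n. weight_bound \<tau> \<kappa> \<nu> (C * (1/2) ^ n) (w n)" for w N
    unfolding weight_bound_def
  proof (intro allI ballI)
    fix j and x t :: real assume x: "x \<in> {0..1}"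
    define K where "K = C * (1/2) ^ N * exp (- (\<kappa> * x)) * exp (\<nu> * (t - \<tau>))"
    have wk: "norm (w (n + N) j x t) \<le> K * (1/2) ^ n" for n
    proof -
      have "\<bar>w (n + N) j x t\<bar> \<le> C * (1/2) ^ (n + N) * exp (- (\<kappa> * x)) * exp (\<nu> * (t - \<tau>))"
        using w[unfolded weight_bound_def] x by blast
      then show ?thesis by (simp add: K_def power_add mult_ac)
    qed
    have geo: "(\<lambda>n. K * (1/2) ^ n) sums (K * 2)"
      using sums_mult[OF geometric_sums[of "1/2 :: real"], of K] by simp
    have s1: "summable (\<lambda>n. norm (w (n + N) j x t))"
      by (rule summable_comparison_test'[OF sums_summable[OF geo], of 0]) (use wk in auto)
    have "(\<Sum>n. w n j x t) - (\<Sum>n<N. w n j x t) = (\<Sum>n. w (n + N) j x t)"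
      using suminf_split_initial_segment[OF summ[OF w x], of j t N] by simp
    also have "norm \<dots> \<le> (\<Sum>n. norm (w (n + N) j x t))" by (rule summable_norm[OF s1])
    also have "\<dots> \<le> (\<Sum>n. K * (1/2) ^ n)"
      by (rule suminf_le[OF wk s1 sums_summable[OF geo]])
    also have "\<dots> = K * 2" using geo by (rule sums_unique[symmetric])
    finally show "\<bar>(\<Sum>n. w n j x t) - (\<Sum>n<N. w n j x t)\<bar>
        \<le> 2 * C * (1/2) ^ N * exp (- (\<kappa> * x)) * exp (\<nu> * (t - \<tau>))"
      by (simp add: K_def mult_ac)
  qed
  show "null_before \<tau> v vt"
    unfolding null_before_def
  proof (intro allI conjI ballI impI)
    fix j
    show "continuous_on ({0..1} \<times> UNIV) (\<lambda>(x, t). v j x t)"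
      unfolding v_def by (rule cont[OF b(1) null_beforeD(1)[OF d]])
    show "continuous_on ({0..1} \<times> UNIV) (\<lambda>(x, t). vt j x t)"
      unfolding vt_def by (rule cont[OF b(2) null_beforeD(2)[OF d]])
    show "v j x t = 0" if "x \<in> {0..1}" "t \<le> \<tau>" for x t
      unfolding v_def using null_beforeD(4)[OF d that] by simp
    fix x t :: real assume x: "x \<in> {0..1}"
    show "(v j x has_real_derivative vt j x t) (at t)"
      unfolding v_def vt_def
    \<comment> \<open>The half-line below t + 1 contains t in its interior, and on it the derivative
      series has a summable majorant.\<close>
    proof (rule has_field_derivative_series'(2)[of "{..<t + 1}" "\<lambda>n. d n j x" "\<lambda>n. dt n j x" t t])
      show "(d n j x has_real_derivative dt n j x s) (at s within {..<t + 1})" for n s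
        by (rule has_field_derivative_at_within[OF null_beforeD(3)[OF d x]])
      show "uniformly_convergent_on {..<t + 1} (\<lambda>n s. \<Sum>i<n. dt i j x s)"
        by (rule Weierstrass_m_test'[OF _ M[of "t + 1"]]) (use le[OF b(2) x] in auto)
      show "summable (\<lambda>n. d n j x t)" by (rule summ[OF b(1) x])
      show "t \<in> interior {..<t + 1}" by (simp add: interior_open)
    qed auto
  qed
  show "weight_bound \<tau> \<kappa> \<nu> (2 * C * (1/2) ^ N) (\<lambda>j x t. v j x t - (\<Sum>n<N. d n j x t))"
    "weight_bound \<tau> \<kappa> \<nu> (2 * C * (1/2) ^ N) (\<lambda>j x t. vt j x t - (\<Sum>n<N. dt n j x t))" for N
    unfolding v_def vt_def by (rule tail[OF b(1)], rule tail[OF b(2)])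
  show "(\<lambda>N. \<Sum>n<N. d n j x t) \<longlonglongrightarrow> v j x t" if "x \<in> {0..1}" for j x t
    unfolding v_def using summ[OF b(1) that] by (rule summable_LIMSEQ)
qed

lemma weights_exist:
  obtains P \<kappa> \<nu> where "\<And>j. (\<Sum>k\<in>UNIV. \<bar>p j k\<bar>) \<le> P" "0 \<le> \<kappa>" "0 < \<nu>" "\<kappa> \<le> \<nu> * c0"
    "exp (2 * L) * (P * exp (- \<kappa>)) \<le> 1 / 4"
    "exp (2 * L) * (2 * real CARD('n) * B / (\<nu> * c0)) \<le> exp (- \<kappa>) / 4"
proof -
  define P where "P = (\<Sum>j\<in>UNIV. \<Sum>k\<in>UNIV. \<bar>p j k\<bar>)"
  have P: "(\<Sum>k\<in>UNIV. \<bar>p j k\<bar>) \<le> P" for j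
    unfolding P_def by (rule member_le_sum) (auto intro: sum_nonneg)
  have P0: "0 \<le> P" unfolding P_def by (intro sum_nonneg) auto
  have L: "0 \<le> L" using flow.L_nonneg[OF flows] .
  \<comment> \<open>\<open>q\<close> is going to be \<open>exp \<kappa>\<close>. It exceeds four
    times the amplified boundary norm, and adding 1 to \<open>P\<close> keeps it at least 1, so that
    \<kappa> is nonnegative.\<close>
  define q where "q = 4 * exp (2 * L) * (P + 1)"
  have q: "1 \<le> q"
  proof -
    have "1 * 1 \<le> exp (2 * L) * (P + 1)" using L P0 by (intro mult_mono) auto
    then show ?thesis by (simp add: q_def)
  qed
  define \<kappa> where "\<kappa> = ln q"
  have \<kappa>: "0 \<le> \<kappa>" "exp (- \<kappa>) = 1 / q"
    using q by (auto simp: \<kappa>_def exp_minus divide_inverse)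
  \<comment> \<open>Chosen after \<kappa>: \<open>\<nu> * c0\<close> has to dominate \<kappa> and
    also 4 times 2 times the coupling constant times \<open>exp \<kappa>\<close>. The final 1 keeps
    \<nu> positive when the other terms vanish.\<close>
  define \<nu> where "\<nu> = (\<kappa> + 8 * exp (2 * L) * real CARD('n) * B * q + 1) / c0"
  have X: "0 \<le> 8 * exp (2 * L) * real CARD('n) * B * q" using B_nonneg q by simp
  have nc: "\<nu> * c0 = \<kappa> + 8 * exp (2 * L) * real CARD('n) * B * q + 1" "0 < \<nu>"
  proof -
    have "0 < \<kappa> + 8 * exp (2 * L) * real CARD('n) * B * q + 1" using \<kappa>(1) X by linarith
    then show "0 < \<nu>" unfolding \<nu>_def using c0_pos by (rule divide_pos_pos)
    show "\<nu> * c0 = \<kappa> + 8 * exp (2 * L) * real CARD('n) * B * q + 1"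
      using c0_pos by (simp add: \<nu>_def)
  qed
  have pos: "0 < \<nu> * c0" using nc(2) c0_pos by simp
  show ?thesis
  proof (rule that[OF P \<kappa>(1) nc(2)])
    show "\<kappa> \<le> \<nu> * c0" using nc(1) X by linarith
    show "exp (2 * L) * (P * exp (- \<kappa>)) \<le> 1 / 4"
    proof -
      have "4 * (exp (2 * L) * P) \<le> q" by (simp add: q_def distrib_left)
      then show ?thesis unfolding \<kappa>(2) using q by (simp add: field_simps)
    qed
    have "8 * exp (2 * L) * real CARD('n) * B * q \<le> \<nu> * c0" using nc(1) \<kappa>(1) by linarith
    then show "exp (2 * L) * (2 * real CARD('n) * B / (\<nu> * c0)) \<le> exp (- \<kappa>) / 4"
      unfolding \<kappa>(2) using pos q by (simp add: field_simps)
  qed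
qed

text \<open>The first term \<open>v1\<close> transports the source with zero inflow, and the later
  ones are its images under powers of \<open>step\<close>. The sum satisfies v = v1 + step v; at x =
  0 this is the boundary condition, and the x-derivative of a transported function turns it into the
  differential equation.\<close>

theorem forced_solution_exists:
  assumes K: "\<And>j. flow.transportable (f j) (ft j) (K j) (Kt j)"
    and K_le: "\<And>j x t. x \<in> {0..1} \<Longrightarrow> \<bar>K j x t\<bar> \<le> D" "\<And>j x t. x \<in> {0..1} \<Longrightarrow> \<bar>Kt j x t\<bar> \<le> D"
    and K_zero: "\<And>j x t. x \<in> {0..1} \<Longrightarrow> t \<le> \<tau> \<Longrightarrow> K j x t = 0"
      "\<And>j x t. x \<in> {0..1} \<Longrightarrow> t \<le> \<tau> \<Longrightarrow> Kt j x t = 0"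
  shows "\<exists>v vt. null_before \<tau> v vt \<and> (\<forall>j t. v j 0 t = inflow v j t) \<and>
    (\<forall>j. \<forall>x\<in>{0..1}. \<forall>t. ((\<lambda>y. v j y t) has_real_derivative
      K j x t + coupling v j x t - f j x t * vt j x t) (at x within {0..1}))"
proof -
  obtain P \<kappa> \<nu> where w: "\<And>j. (\<Sum>k\<in>UNIV. \<bar>p j k\<bar>) \<le> P" "0 \<le> \<kappa>" "0 < \<nu>" "\<kappa> \<le> \<nu> * c0"
    "exp (2 * L) * (P * exp (- \<kappa>)) \<le> 1 / 4"
    "exp (2 * L) * (2 * real CARD('n) * B / (\<nu> * c0)) \<le> exp (- \<kappa>) / 4"
    using weights_exist by metis
  define v1 where "v1 j = flow.transport (f j) (\<lambda>s. 0) (K j)" for j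
  define v1t where "v1t j = flow.transport_deriv (f j) (ft j) (\<lambda>s. 0) (Kt j)" for j
  have K_cont: "continuous_on ({0..1} \<times> UNIV) (\<lambda>(x, t). K j x t)" for j
    using K[of j] by (simp add: flow.transportable_def[OF flows])
  have D0: "0 \<le> D" using K_le(1)[of 0 undefined 0] by simp
  have nb1: "null_before \<tau> v1 v1t"
    unfolding null_before_def
  proof (intro allI conjI ballI impI)
    fix j
    show "continuous_on ({0..1} \<times> UNIV) (\<lambda>(x, t). v1 j x t)"
      unfolding v1_def by (intro flow.transport_cont[OF flows] K_cont continuous_on_const)
    show "continuous_on ({0..1} \<times> UNIV) (\<lambda>(x, t). v1t j x t)"
      unfolding v1t_def by (rule flow.transport_deriv_cont[OF flows continuous_on_const K])
    show "(v1 j x has_real_derivative v1t j x t) (at t)" if "x \<in> {0..1}" for x t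
      unfolding v1_def v1t_def by (intro flow.transport_has_deriv_t[OF flows] K that DERIV_const)
    show "v1 j x t = 0" if "x \<in> {0..1}" "t \<le> \<tau>" for x t
      unfolding v1_def using K_zero(1) that by (intro flow.transport_zero[OF flows, of \<tau>]) auto
  qed
  \<comment> \<open>The source vanishes up to \<tau>, and after \<tau> the weight is at least 1, so
    a constant bound is also an exponential one.\<close>
  have K_exp: "\<bar>K j x t\<bar> \<le> D * exp (\<nu> * (t - \<tau>))" "\<bar>Kt j x t\<bar> \<le> D * exp (\<nu> * (t - \<tau>))"
    if x: "x \<in> {0..1}" for j x t
  proof -
    have "D \<le> D * exp (\<nu> * (t - \<tau>))" if "t > \<tau>" using that D0 w(3) mult_left_mono[of 1 "exp (\<nu> * (t - \<tau>))" D] by simp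
    then show "\<bar>K j x t\<bar> \<le> D * exp (\<nu> * (t - \<tau>))" "\<bar>Kt j x t\<bar> \<le> D * exp (\<nu> * (t - \<tau>))"
      using K_le(1)[OF x, of j t] K_le(2)[OF x, of j t] K_zero(1)[OF x, of t j] K_zero(2)[OF x, of t j] D0
      by (cases "t > \<tau>"; simp)+
  qed
  \<comment> \<open>\<open>transport_bound\<close> with zero inflow carries no decay in x; the
    factor \<open>exp \<kappa>\<close> pays for inserting the spatial weight, which is at least
    \<open>exp (- \<kappa>)\<close>.\<close>
  define C where "C = exp (2 * L) * (D / (\<nu> * c0)) * exp \<kappa>"
  have C: "0 \<le> C" using D0 w(3) c0_pos by (simp add: C_def)
  have base_le: "exp (2 * L) * (0 * exp (- (\<nu> * c0 * x)) + D / (\<nu> * c0)) * exp (\<nu> * (t - \<tau>))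
      \<le> C * exp (- (\<kappa> * x)) * exp (\<nu> * (t - \<tau>))" if "x \<in> {0..1}" for x t
  proof (rule mult_right_mono)
    have "1 \<le> exp \<kappa> * exp (- (\<kappa> * x))"
      using that w(2) by (simp flip: exp_add) (simp add: mult_left_le)
    then have "exp (2 * L) * (D / (\<nu> * c0)) * 1 \<le> exp (2 * L) * (D / (\<nu> * c0)) * (exp \<kappa> * exp (- (\<kappa> * x)))"
      using D0 w(3) c0_pos by (intro mult_left_mono) auto
    then show "exp (2 * L) * (0 * exp (- (\<nu> * c0 * x)) + D / (\<nu> * c0)) \<le> C * exp (- (\<kappa> * x))"
      by (simp add: C_def mult_ac)
  qed simp
  have zb: "\<bar>0\<bar> \<le> 0 * exp (\<nu> * (s - \<tau>))" for s by simp
  have "\<bar>v1 j x t\<bar> \<le> C * exp (- (\<kappa> * x)) * exp (\<nu> * (t - \<tau>))" if x: "x \<in> {0..1}" for j x t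
    unfolding v1_def
    by (rule order_trans[OF flow.transport_bound(1)[OF flows w(3) order_refl D0 zb zb
          K_exp(1) K_exp(2) K] base_le]) (assumption | rule x)+
  moreover have "\<bar>v1t j x t\<bar> \<le> C * exp (- (\<kappa> * x)) * exp (\<nu> * (t - \<tau>))" if x: "x \<in> {0..1}" for j x t
    unfolding v1t_def
    by (rule order_trans[OF flow.transport_bound(2)[OF flows w(3) order_refl D0 zb zb
          K_exp(1) K_exp(2) K] base_le]) (assumption | rule x)+
  ultimately have b1: "weight_bound \<tau> \<kappa> \<nu> C v1" "weight_bound \<tau> \<kappa> \<nu> C v1t"
    unfolding weight_bound_def by blast+
  \<comment> \<open>From here on \<open>D\<close> is the sequence of pairs of iterate and
    t-derivative. They are built together, since \<open>step_t\<close> uses both.\<close>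
  define D where "D = rec_nat (v1, v1t) (\<lambda>n (u, ut). (step u, step_t u ut))"
  define d where "d n = fst (D n)" for n
  define dt where "dt n = snd (D n)" for n
  have d_0: "d 0 = v1" "dt 0 = v1t" by (simp_all add: d_def dt_def D_def)
  have d_Suc: "d (Suc n) = step (d n)" "dt (Suc n) = step_t (d n) (dt n)" for n
    by (simp_all add: d_def dt_def D_def case_prod_beta)
  have nb: "null_before \<tau> (d n) (dt n)" for n
    by (induction n) (simp_all add: d_0 d_Suc nb1 null_before_step)
  have b: "weight_bound \<tau> \<kappa> \<nu> (C * (1/2) ^ n) (d n) \<and> weight_bound \<tau> \<kappa> \<nu> (C * (1/2) ^ n) (dt n)" for n
  proof (induction n)
    case 0
    then show ?case using b1 by (simp add: d_0)
  next
    case (Suc n)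
    have "0 \<le> C * (1/2) ^ n" using C by simp
    from step_bound[OF nb this w(1-6) conjunct1[OF Suc] conjunct2[OF Suc]]
    show ?case by (simp add: d_Suc)
  qed
  define v where "v = (\<lambda>j x t. \<Sum>n. d n j x t)"
  define vt where "vt = (\<lambda>j x t. \<Sum>n. dt n j x t)"
  note ser = null_before_series[OF nb conjunct1[OF b] conjunct2[OF b] w(2,3) C, folded v_def vt_def]
  define V where "V N = (\<lambda>j x t. \<Sum>n<N. d n j x t)" for N
  define Vt where "Vt N = (\<lambda>j x t. \<Sum>n<N. dt n j x t)" for N
  have nbV: "null_before \<tau> (V N) (Vt N)" for N
    by (induction N) (simp_all add: V_def Vt_def null_before_zero null_before_add[OF _ nb])
  \<comment> \<open>The partial sums obey the affine recursion whose limit is the fixed-point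
    equation.\<close>
  have V_step: "V (Suc N) j x t = v1 j x t + step (V N) j x t" if x: "x \<in> {0..1}" for N j x t
  proof (induction N)
    case 0
    have "step (\<lambda>j x t. 0 - 0) j x t = 0"
      using step_diff[OF null_before_zero null_before_zero x] by simp
    then show ?case by (simp add: V_def d_0)
  next
    case (Suc N)
    have "d N = (\<lambda>j x t. V (Suc N) j x t - V N j x t)" by (simp add: V_def)
    then have "d (Suc N) j x t = step (V (Suc N)) j x t - step (V N) j x t"
      using step_diff[OF nbV nbV x] by (simp add: d_Suc)
    moreover have "V (Suc (Suc N)) j x t = V (Suc N) j x t + d (Suc N) j x t"
      by (simp add: V_def)
    ultimately show ?case using Suc by simp
  qed
  have fixpoint: "v j x t = v1 j x t + step v j x t" if x: "x \<in> {0..1}" for j x t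
  proof -
    let ?e = "exp (- (\<kappa> * x)) * exp (\<nu> * (t - \<tau>))"
    have "norm (step (V N) j x t - step v j x t) \<le> C * (1/2) ^ N * ?e" for N
    proof -
      have "weight_bound \<tau> \<kappa> \<nu> (2 * C * (1/2) ^ N / 2) (step (\<lambda>j x t. v j x t - V N j x t))"
        using ser(2)[of N] ser(3)[of N] C unfolding V_def[symmetric]
        by (intro step_bound(1)[OF null_before_diff[OF ser(1) nbV] _ w(1-6)])
          (auto simp: V_def Vt_def v_def vt_def)
      then have "\<bar>step (\<lambda>j x t. v j x t - V N j x t) j x t\<bar> \<le> C * (1/2) ^ N * ?e"
        using x by (simp add: weight_bound_def mult.assoc)
      then show ?thesis
        unfolding step_diff[OF ser(1) nbV x] by (simp add: abs_minus_commute)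
    qed
    then have ev: "\<forall>\<^sub>F N in sequentially. norm (step (V N) j x t - step v j x t) \<le> C * (1/2) ^ N * ?e"
      by (rule always_eventually[OF allI])
    have lim: "(\<lambda>N. C * (1/2) ^ N * ?e) \<longlonglongrightarrow> 0"
      by (intro tendsto_mult_left_zero tendsto_mult_right_zero LIMSEQ_power_zero) simp
    have "(\<lambda>N. step (V N) j x t - step v j x t) \<longlonglongrightarrow> 0"
      by (rule Lim_null_comparison[OF ev lim])
    then have "(\<lambda>N. step (V N) j x t) \<longlonglongrightarrow> step v j x t" by (rule LIM_zero_cancel)
    then have "(\<lambda>N. V (Suc N) j x t) \<longlonglongrightarrow> v1 j x t + step v j x t"
      unfolding V_step[OF x] by (intro tendsto_intros)
    moreover have "(\<lambda>N. V (Suc N) j x t) \<longlonglongrightarrow> v j x t"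
      using ser(4)[OF x, of j t] unfolding V_def v_def by (rule LIMSEQ_Suc)
    ultimately show ?thesis by (rule LIMSEQ_unique[symmetric])
  qed
  have "v j 0 t = inflow v j t" for j t
    using fixpoint[of 0 j t] by (simp add: v1_def step_def flow.transport_0[OF flows])
  moreover have "((\<lambda>y. v j y t) has_real_derivative
      K j x t + coupling v j x t - f j x t * vt j x t) (at x within {0..1})"
    if x: "x \<in> {0..1}" for j x t
  proof -
    \<comment> \<open>Both sides are t-derivatives of the two sides of the fixed-point equation.
      This rewriting lets the x-derivatives of \<open>v1\<close> and \<open>step v\<close> combine
      into one equation for \<open>v\<close>.\<close>
    have t_deriv: "vt j x t = v1t j x t + step_t v vt j x t"
    proof (rule DERIV_unique)
      show "(v j x has_real_derivative vt j x t) (at t)" by (rule null_beforeD(3)[OF ser(1) x])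
      have "v j x = (\<lambda>t. v1 j x t + step v j x t)" using fixpoint[OF x] by auto
      then show "(v j x has_real_derivative v1t j x t + step_t v vt j x t) (at t)"
        using null_beforeD(3)[OF nb1 x] null_beforeD(3)[OF null_before_step[OF ser(1)] x]
        by (auto intro: DERIV_add)
    qed
    have "((\<lambda>y. v1 j y t) has_real_derivative K j x t - f j x t * v1t j x t) (at x within {0..1})"
      unfolding v1_def v1t_def
      by (rule flow.transport_has_deriv_x[OF flows DERIV_const continuous_on_const K x])
    moreover have "((\<lambda>y. step v j y t) has_real_derivative
        coupling v j x t - f j x t * step_t v vt j x t) (at x within {0..1})"
      unfolding step_def step_t_def
      by (rule flow.transport_has_deriv_x[OF flows inflow_deriv[OF ser(1)] inflow_cont(2)[OF ser(1)]
            coupling_transportable[OF ser(1)] x])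
    ultimately have "((\<lambda>y. v1 j y t + step v j y t) has_real_derivative
        (K j x t - f j x t * v1t j x t) + (coupling v j x t - f j x t * step_t v vt j x t)) (at x within {0..1})"
      by (rule DERIV_add)
    then have "((\<lambda>y. v1 j y t + step v j y t) has_real_derivative
        K j x t + coupling v j x t - f j x t * vt j x t) (at x within {0..1})"
      by (simp add: t_deriv algebra_simps)
    then show ?thesis
      unfolding has_field_derivative_def
      by (rule has_derivative_transform[OF x, rotated]) (rule fixpoint)
  qed
  ultimately show ?thesis using ser(1) by blast
qed

end

section \<open>The energy estimate\<close>

definition flip :: "nat \<Rightarrow> 'n::{finite, linorder} \<Rightarrow> real \<Rightarrow> real"
  where "flip m j x = (if pos j \<le> m then x else 1 - x)"

lemma flip_range: "x \<in> {0..1} \<Longrightarrow> flip m j x \<in> {0..1}"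
  by (auto simp: flip_def)

lemma flip_flip [simp]: "flip m j (flip m j x) = x"
  by (simp add: flip_def)

lemma flip_cont: "continuous_on A (flip m j)"
  by (cases "pos j \<le> m") (auto simp: flip_def[abs_def] intro!: continuous_intros)

lemma has_partials_on_Times:
  assumes "has_partials_on u ux ut (X \<times> T)" "x \<in> X" "t \<in> T"
  shows "((\<lambda>y. u (y, t)) has_real_derivative ux (x, t)) (at x within X)"
    "((\<lambda>s. u (x, s)) has_real_derivative ut (x, t)) (at t within T)"
proof -
  have X: "{y. (y, t) \<in> X \<times> T} = X" and T: "{s. (x, s) \<in> X \<times> T} = T"
    using assms by auto
  have "(x, t) \<in> X \<times> T" using assms by simp
  from bspec[OF assms(1)[unfolded has_partials_on_def] this]
  show "((\<lambda>y. u (y, t)) has_real_derivative ux (x, t)) (at x within X)"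
    "((\<lambda>s. u (x, s)) has_real_derivative ut (x, t)) (at t within T)"
    unfolding prod.case X T by blast+
qed

lemma has_partials_on_TimesI:
  assumes "\<And>x t. x \<in> X \<Longrightarrow> t \<in> T \<Longrightarrow> ((\<lambda>y. u (y, t)) has_real_derivative ux (x, t)) (at x within X)"
    and "\<And>x t. x \<in> X \<Longrightarrow> t \<in> T \<Longrightarrow> ((\<lambda>s. u (x, s)) has_real_derivative ut (x, t)) (at t within T)"
  shows "has_partials_on u ux ut (X \<times> T)"
  unfolding has_partials_on_def
proof
  fix z assume "z \<in> X \<times> T"
  then obtain x t where z: "z = (x, t)" "x \<in> X" "t \<in> T" by auto
  have X: "{y. (y, t) \<in> X \<times> T} = X" and T: "{s. (x, s) \<in> X \<times> T} = T" using z by auto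
  show "case z of (x, t) \<Rightarrow>
      ((\<lambda>y. u (y, t)) has_real_derivative ux (x, t)) (at x within {y. (y, t) \<in> X \<times> T}) \<and>
      ((\<lambda>s. u (x, s)) has_real_derivative ut (x, t)) (at t within {s. (x, s) \<in> X \<times> T})"
    unfolding z(1) prod.case X T using assms z by blast
qed

lemma norm_L2_class_continuous:
  assumes "continuous_on {0..1} f"
  shows "(norm (L2_class f))\<^sup>2 = integral {0..1} (\<lambda>x. (f x)\<^sup>2)"
proof -
  have sq: "square_integrable f" by (rule square_integrable_continuous[OF assms])
  have "(norm (L2_class f))\<^sup>2 = (\<integral>x. (f x)\<^sup>2 \<partial>U01)"
    by (simp add: norm_L2_class[OF sq])
  also have "\<dots> = integral {0<..<1} (\<lambda>x. (f x)\<^sup>2)"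
    by (rule lebesgue_integral_eq_integral[OF square_integrableD(2)[OF sq]]) simp
  also have "\<dots> = integral {0..1} (\<lambda>x. (f x)\<^sup>2)" by (rule integral_open_interval_real[symmetric])
  finally show ?thesis .
qed

lemma component_Max_Pow [simp]: "component (Max_Pow f) = f"
  by (rule Max_Pow_inverse) simp

text \<open>The partial derivatives of the coefficients are fixed as functions, and one constant
  \<open>B\<close> bounds everything, so the existential content of the spaces has to be unpacked
  only once.\<close>

locale ibvp =
  fixes m :: nat and p :: "'n::{finite, linorder} \<Rightarrow> 'n \<Rightarrow> real"
    and a aX aT :: "'n \<Rightarrow> real \<times> real \<Rightarrow> real"
    and b bX bT :: "'n \<Rightarrow> 'n \<Rightarrow> real \<times> real \<Rightarrow> real"
    and \<Lambda> B :: real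
  assumes a_partials: "\<And>j. has_partials_on (a j) (aX j) (aT j) ({0..1} \<times> UNIV)"
    and b_partials: "\<And>j k. has_partials_on (b j k) (bX j k) (bT j k) ({0..1} \<times> UNIV)"
    and a_cont: "\<And>j. continuous_on ({0..1} \<times> UNIV) (a j)" "\<And>j. continuous_on ({0..1} \<times> UNIV) (aX j)"
      "\<And>j. continuous_on ({0..1} \<times> UNIV) (aT j)"
    and b_cont: "\<And>j k. continuous_on ({0..1} \<times> UNIV) (b j k)" "\<And>j k. continuous_on ({0..1} \<times> UNIV) (bX j k)"
      "\<And>j k. continuous_on ({0..1} \<times> UNIV) (bT j k)"
    and a_bound: "\<And>j x t. x \<in> {0..1} \<Longrightarrow> \<bar>a j (x, t)\<bar> \<le> B" "\<And>j x t. x \<in> {0..1} \<Longrightarrow> \<bar>aX j (x, t)\<bar> \<le> B"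
      "\<And>j x t. x \<in> {0..1} \<Longrightarrow> \<bar>aT j (x, t)\<bar> \<le> B"
    and b_bound: "\<And>j k x t. x \<in> {0..1} \<Longrightarrow> \<bar>b j k (x, t)\<bar> \<le> B" "\<And>j k x t. x \<in> {0..1} \<Longrightarrow> \<bar>bX j k (x, t)\<bar> \<le> B"
      "\<And>j k x t. x \<in> {0..1} \<Longrightarrow> \<bar>bT j k (x, t)\<bar> \<le> B"
    and \<Lambda>_pos: "0 < \<Lambda>"
    and a_pos: "\<And>j x t. pos j \<le> m \<Longrightarrow> x \<in> {0..1} \<Longrightarrow> \<Lambda> \<le> a j (x, t)"
    and a_neg: "\<And>j x t. \<not> pos j \<le> m \<Longrightarrow> x \<in> {0..1} \<Longrightarrow> a j (x, t) \<le> - \<Lambda>"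
begin

lemma B_pos: "0 < B"
  using a_bound(1)[of 0 undefined 0] a_pos[of undefined 0 0] a_neg[of undefined 0 0] \<Lambda>_pos
  by (cases "pos (undefined :: 'n) \<le> m") auto

text \<open>A source is allowed so that the deviation of a solution from frozen data can be
  estimated as well. The initial condition is left out: estimates refer to the state at \<tau>
  whatever it is, and a solution may be restarted at a later time with a state that is no longer a
  test function.\<close>

definition solution :: "real \<Rightarrow> ('n \<Rightarrow> real \<times> real \<Rightarrow> real) \<Rightarrow> ('n \<Rightarrow> real \<times> real \<Rightarrow> real) \<Rightarrow> bool"
  where "solution \<tau> r u \<longleftrightarrow>
    (\<forall>j. u j \<in> C1_on (closure (half_strip \<tau>))) \<and>
    (\<forall>j. \<forall>(x, t)\<in>half_strip \<tau>.
      deriv (\<lambda>s. u j (x, s)) t + a j (x, t) * deriv (\<lambda>y. u j (y, t)) x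
        + (\<Sum>k\<in>UNIV. b j k (x, t) * u k (x, t)) = r j (x, t)) \<and>
    (\<forall>j. \<forall>t\<ge>\<tau>. pos j \<le> m \<longrightarrow> u j (0, t) = boundary_rhs m p u j t) \<and>
    (\<forall>j. \<forall>t\<ge>\<tau>. pos j > m \<longrightarrow> u j (1, t) = boundary_rhs m p u j t)"

lemma classical_solution_iff:
  "classical_solution m p a b \<tau> \<phi> u \<longleftrightarrow>
    solution \<tau> (\<lambda>_ _. 0) u \<and> (\<forall>j. \<forall>x\<in>{0..1}. u j (x, \<tau>) = \<phi> j x)"
  by (simp add: classical_solution_def solution_def conj_assoc)

lemma solution_partials:
  assumes "solution \<tau> r u"
  obtains ux ut where "\<And>j. has_partials_on (u j) (ux j) (ut j) ({0..1} \<times> {\<tau>..})"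
    "\<And>j. continuous_on ({0..1} \<times> {\<tau>..}) (u j)"
    "\<And>j. continuous_on ({0..1} \<times> {\<tau>..}) (ux j)" "\<And>j. continuous_on ({0..1} \<times> {\<tau>..}) (ut j)"
proof -
  have "\<forall>j. \<exists>ux ut. continuous_on ({0..1} \<times> {\<tau>..}) (u j) \<and> has_partials_on (u j) ux ut ({0..1} \<times> {\<tau>..}) \<and>
      continuous_on ({0..1} \<times> {\<tau>..}) ux \<and> continuous_on ({0..1} \<times> {\<tau>..}) ut"
    using assms by (simp add: solution_def C1_on_def closure_half_strip)
  then show ?thesis using that by metis
qed

lemma has_partials_on_half_strip:
  assumes "has_partials_on u ux ut ({0..1} \<times> {\<tau>..})" "x \<in> {0..1}" "\<tau> \<le> t"
  shows "((\<lambda>y. u (y, t)) has_real_derivative ux (x, t)) (at x within {0..1})"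
    "((\<lambda>s. u (x, s)) has_real_derivative ut (x, t)) (at t within {\<tau>..})"
  using has_partials_on_Times[OF assms(1,2), of t] assms(3) by auto

lemma interior_derivs:
  assumes "has_partials_on u ux ut ({0..1} \<times> {\<tau>..})" "0 < x" "x < 1" "\<tau> < t"
  shows "((\<lambda>y. u (y, t)) has_real_derivative ux (x, t)) (at x)"
    "((\<lambda>s. u (x, s)) has_real_derivative ut (x, t)) (at t)"
    "deriv (\<lambda>y. u (y, t)) x = ux (x, t)" "deriv (\<lambda>s. u (x, s)) t = ut (x, t)"
proof -
  have x: "at x within {0..1} = at x" and t: "at t within {\<tau>..} = at t"
    using assms by (auto intro!: at_within_interior simp: interior_real_atLeast)
  show 1: "((\<lambda>y. u (y, t)) has_real_derivative ux (x, t)) (at x)"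
    and 2: "((\<lambda>s. u (x, s)) has_real_derivative ut (x, t)) (at t)"
    using has_partials_on_half_strip[OF assms(1), of x t] assms unfolding x t by auto
  show "deriv (\<lambda>y. u (y, t)) x = ux (x, t)" "deriv (\<lambda>s. u (x, s)) t = ut (x, t)"
    using DERIV_imp_deriv[OF 1] DERIV_imp_deriv[OF 2] .
qed

text \<open>The weight grows along the direction of propagation, so that the dissipation at the outflow
  ends dominates what the boundary conditions feed back at the inflow ends.\<close>

definition "R = B * (\<Sum>j\<in>UNIV. \<Sum>k\<in>UNIV. (p j k)\<^sup>2) / \<Lambda>"

definition weight :: "'n \<Rightarrow> real \<Rightarrow> real"
  where "weight j x = 1 + R * flip m j x"

definition weight_slope :: "'n \<Rightarrow> real"
  where "weight_slope j = (if pos j \<le> m then R else - R)"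

text \<open>With H = (1 + R) B and n components, the slope of the weight and the x-derivative of the
  speed contribute H each, the coupling contributes 2 n H; together this is at most 4 n H. The 1
  comes from Young's inequality for the source.\<close>

definition "growth = 4 * real CARD('n) * (1 + R) * B + 1"

lemma R_nonneg: "0 \<le> R"
  using B_pos \<Lambda>_pos by (simp add: R_def sum_nonneg)

lemma weight_bounds: "x \<in> {0..1} \<Longrightarrow> 1 \<le> weight j x" "x \<in> {0..1} \<Longrightarrow> weight j x \<le> 1 + R"
  using R_nonneg by (auto simp: weight_def flip_def mult_left_le)

lemma weight_deriv: "(weight j has_real_derivative weight_slope j) (at x within A)"
  unfolding weight_def[abs_def] flip_def weight_slope_def
  by (auto intro!: derivative_eq_intros)

lemma weight_cont: "continuous_on A (weight j)"
  by (cases "pos j \<le> m") (auto simp: weight_def[abs_def] flip_def intro!: continuous_intros)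

text \<open>Every component has weight 1 at its inflow end and 1 + R at its outflow end. By the
  Cauchy-Schwarz inequality the inflow energy is at most the sum of the squares of \<open>p\<close>
  times the outflow energy, and \<open>R\<close> is calibrated so that \<open>R * \<Lambda>\<close>
  equals \<open>B\<close> times that sum.\<close>

lemma boundary_dissipation:
  fixes U :: "'n \<Rightarrow> real \<Rightarrow> real"
  assumes "\<And>j. pos j \<le> m \<Longrightarrow> U j 0 = (\<Sum>k | pos k \<le> m. p j k * U k 1) + (\<Sum>k | pos k > m. p j k * U k 0)"
    and "\<And>j. \<not> pos j \<le> m \<Longrightarrow> U j 1 = (\<Sum>k | pos k \<le> m. p j k * U k 1) + (\<Sum>k | pos k > m. p j k * U k 0)"
  shows "0 \<le> (\<Sum>j\<in>UNIV. weight j 1 * a j (1, t) * (U j 1)\<^sup>2 - weight j 0 * a j (0, t) * (U j 0)\<^sup>2)"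
proof -
  define out where "out j = (if pos j \<le> m then U j 1 else U j 0)" for j
  define inn where "inn j = (if pos j \<le> m then U j 0 else U j 1)" for j
  define Q where "Q = (\<Sum>k\<in>UNIV. (out k)\<^sup>2)"
  have Q: "0 \<le> Q" unfolding Q_def by (intro sum_nonneg) auto
  have rhs: "(\<Sum>k | pos k \<le> m. p j k * U k 1) + (\<Sum>k | pos k > m. p j k * U k 0)
      = (\<Sum>k\<in>UNIV. p j k * out k)" for j
  proof -
    have "(\<Sum>k\<in>UNIV. p j k * out k) = (\<Sum>k\<in>{k. pos k \<le> m} \<union> {k. pos k > m}. p j k * out k)"
      by (rule sum.cong) auto
    also have "\<dots> = (\<Sum>k | pos k \<le> m. p j k * out k) + (\<Sum>k | pos k > m. p j k * out k)"
      by (rule sum.union_disjoint) auto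
    finally show ?thesis by (simp add: out_def)
  qed
  have inn: "inn j = (\<Sum>k\<in>UNIV. p j k * out k)" for j
    using assms[of j] by (auto simp: inn_def rhs)
  have inn_sq: "(inn j)\<^sup>2 \<le> (\<Sum>k\<in>UNIV. (p j k)\<^sup>2) * Q" for j
    unfolding inn Q_def by (rule Cauchy_Schwarz_ineq_sum)
  have each: "(1 + R) * \<Lambda> * (out j)\<^sup>2 - B * (inn j)\<^sup>2
      \<le> weight j 1 * a j (1, t) * (U j 1)\<^sup>2 - weight j 0 * a j (0, t) * (U j 0)\<^sup>2" for j
  proof (cases "pos j \<le> m")
    case True
    have "(1 + R) * \<Lambda> * (U j 1)\<^sup>2 \<le> (1 + R) * a j (1, t) * (U j 1)\<^sup>2"
      using a_pos[OF True, of 1 t] R_nonneg by (intro mult_right_mono mult_left_mono) auto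
    moreover have "a j (0, t) * (U j 0)\<^sup>2 \<le> B * (U j 0)\<^sup>2"
      using a_bound(1)[of 0 j t] by (intro mult_right_mono) auto
    ultimately show ?thesis using True by (simp add: out_def inn_def weight_def flip_def)
  next
    case False
    have "(1 + R) * \<Lambda> * (U j 0)\<^sup>2 \<le> (1 + R) * (- a j (0, t)) * (U j 0)\<^sup>2"
      using a_neg[OF False, of 0 t] R_nonneg by (intro mult_right_mono mult_left_mono) auto
    moreover have "- a j (1, t) * (U j 1)\<^sup>2 \<le> B * (U j 1)\<^sup>2"
      using a_bound(1)[of 1 j t] by (intro mult_right_mono) auto
    ultimately show ?thesis using False by (simp add: out_def inn_def weight_def flip_def)
  qed
  have "B * (\<Sum>j\<in>UNIV. (inn j)\<^sup>2) \<le> B * (\<Sum>j\<in>UNIV. (\<Sum>k\<in>UNIV. (p j k)\<^sup>2) * Q)"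
    using B_pos by (intro mult_left_mono sum_mono inn_sq) auto
  also have "\<dots> = R * \<Lambda> * Q"
    using \<Lambda>_pos by (simp add: R_def sum_distrib_right)
  also have "\<dots> \<le> (1 + R) * \<Lambda> * Q" using \<Lambda>_pos Q by (simp add: distrib_right)
  finally have "0 \<le> (\<Sum>j\<in>UNIV. (1 + R) * \<Lambda> * (out j)\<^sup>2 - B * (inn j)\<^sup>2)"
    by (simp add: sum_subtractf sum_distrib_left Q_def)
  also have "\<dots> \<le> (\<Sum>j\<in>UNIV. weight j 1 * a j (1, t) * (U j 1)\<^sup>2 - weight j 0 * a j (0, t) * (U j 0)\<^sup>2)"
    by (intro sum_mono each)
  finally show ?thesis .
qed

text \<open>The subtracted sum is the exact x-derivative of the energy flux, weight times speed
  times \<open>(U j)\<^sup>2\<close>. Once the equation has replaced the time derivative, no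
  derivative of the unknown remains outside this flux, and the other terms are quadratic in
  \<open>U\<close> up to the source.\<close>

lemma pointwise_energy:
  fixes U Ux Ut r :: "'n \<Rightarrow> real"
  assumes x: "x \<in> {0..1}" and r: "\<And>j. \<bar>r j\<bar> \<le> F"
    and pde: "\<And>j. Ut j + a j (x, t) * Ux j + (\<Sum>k\<in>UNIV. b j k (x, t) * U k) = r j"
  shows "(\<Sum>j\<in>UNIV. weight j x * (2 * U j * Ut j)) \<le>
    growth * (\<Sum>j\<in>UNIV. weight j x * (U j)\<^sup>2) + real CARD('n) * (1 + R) * F\<^sup>2
    - (\<Sum>j\<in>UNIV. weight_slope j * a j (x, t) * (U j)\<^sup>2 + weight j x * aX j (x, t) * (U j)\<^sup>2
        + weight j x * a j (x, t) * (2 * U j * Ux j))"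
proof -
  define W where "W j = weight j x * (U j)\<^sup>2" for j
  define N where "N = real CARD('n)"
  define H where "H = (1 + R) * B"
  have H: "0 \<le> H" using R_nonneg B_pos by (simp add: H_def)
  have U_W: "(U j)\<^sup>2 \<le> W j" for j
    using weight_bounds(1)[OF x, of j] mult_right_mono[of 1 "weight j x" "(U j)\<^sup>2"] by (simp add: W_def)
  have W0: "0 \<le> W j" for j using U_W[of j] by (meson order_trans zero_le_power2)
  have each: "weight j x * (2 * U j * Ut j) + (weight_slope j * a j (x, t) * (U j)\<^sup>2 + weight j x * aX j (x, t) * (U j)\<^sup>2
        + weight j x * a j (x, t) * (2 * U j * Ux j))
      \<le> (1 + R) * F\<^sup>2 + W j + 2 * H * W j + (N * (H * W j) + (\<Sum>k\<in>UNIV. H * W k))" for j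
  proof -
    \<comment> \<open>The equation removes both derivatives of the unknown at once: the transport
      term added on the left cancels the one inside \<open>Ut j\<close>.\<close>
    have e1: "weight j x * (2 * U j * Ut j) + weight j x * a j (x, t) * (2 * U j * Ux j)
        = weight j x * (2 * U j * r j) + (\<Sum>k\<in>UNIV. weight j x * b j k (x, t) * (- 2 * U j * U k))"
    proof -
      define S where "S = (\<Sum>k\<in>UNIV. b j k (x, t) * U k)"
      have Ut: "Ut j = r j - a j (x, t) * Ux j - S"
        using pde[of j] by (simp add: S_def)
      have "(\<Sum>k\<in>UNIV. weight j x * b j k (x, t) * (- 2 * U j * U k)) = (- 2 * weight j x * U j) * S"
        unfolding sum_distrib_left S_def by (rule sum.cong) simp_all
      then show ?thesis unfolding Ut by (simp add: algebra_simps)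
    qed
    have e2: "weight j x * (2 * U j * r j) \<le> (1 + R) * F\<^sup>2 + W j"
    proof -
      have "2 * U j * r j \<le> (r j)\<^sup>2 + (U j)\<^sup>2"
        using sum_squares_bound[of "U j" "r j"] by simp
      moreover have "(r j)\<^sup>2 \<le> F\<^sup>2"
        using r[of j] abs_ge_zero[of "r j"] by (intro abs_le_square_iff[THEN iffD1]) linarith
      ultimately have "2 * U j * r j \<le> F\<^sup>2 + (U j)\<^sup>2" by linarith
      then have "weight j x * (2 * U j * r j) \<le> weight j x * (F\<^sup>2 + (U j)\<^sup>2)"
        using weight_bounds(1)[OF x, of j] by (intro mult_left_mono) auto
      also have "\<dots> \<le> (1 + R) * F\<^sup>2 + W j"
        using weight_bounds(2)[OF x, of j] by (simp add: W_def distrib_left mult_right_mono)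
      finally show ?thesis .
    qed
    have e3: "weight j x * b j k (x, t) * (- 2 * U j * U k) \<le> H * W j + H * W k" for k
    proof -
      have "\<bar>weight j x * b j k (x, t)\<bar> \<le> H"
        unfolding H_def abs_mult using weight_bounds[OF x, of j] b_bound(1)[OF x] R_nonneg
        by (intro mult_mono) auto
      moreover have "\<bar>- 2 * U j * U k\<bar> \<le> (U j)\<^sup>2 + (U k)\<^sup>2"
        using sum_squares_bound[of "U j" "U k"] sum_squares_bound[of "- U j" "U k"] by (simp add: abs_le_iff)
      ultimately have "\<bar>weight j x * b j k (x, t) * (- 2 * U j * U k)\<bar> \<le> H * ((U j)\<^sup>2 + (U k)\<^sup>2)"
        unfolding abs_mult[of "weight j x * b j k (x, t)"] using H by (intro mult_mono) auto
      also have "\<dots> \<le> H * (W j + W k)"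
        using U_W[of j] U_W[of k] H by (intro mult_left_mono add_mono) auto
      finally show ?thesis by (simp add: distrib_left)
    qed
    have e4: "weight_slope j * a j (x, t) * (U j)\<^sup>2 \<le> H * W j"
    proof -
      have "\<bar>weight_slope j * a j (x, t)\<bar> \<le> H"
        unfolding H_def abs_mult using a_bound(1)[OF x] R_nonneg
        by (intro mult_mono) (auto simp: weight_slope_def)
      then have "weight_slope j * a j (x, t) * (U j)\<^sup>2 \<le> H * (U j)\<^sup>2" by (intro mult_right_mono) auto
      also have "\<dots> \<le> H * W j" using U_W H by (intro mult_left_mono)
      finally show ?thesis .
    qed
    have e5: "weight j x * aX j (x, t) * (U j)\<^sup>2 \<le> H * W j"
    proof -
      have "\<bar>weight j x * aX j (x, t)\<bar> \<le> H"
        unfolding H_def abs_mult using weight_bounds[OF x, of j] a_bound(2)[OF x] R_nonneg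
        by (intro mult_mono) auto
      then have "weight j x * aX j (x, t) * (U j)\<^sup>2 \<le> H * (U j)\<^sup>2" by (intro mult_right_mono) auto
      also have "\<dots> \<le> H * W j" using U_W H by (intro mult_left_mono)
      finally show ?thesis .
    qed
    have "(\<Sum>k\<in>UNIV. weight j x * b j k (x, t) * (- 2 * U j * U k)) \<le> (\<Sum>k\<in>UNIV. H * W j + H * W k)"
      by (intro sum_mono e3)
    also have "\<dots> = N * (H * W j) + (\<Sum>k\<in>UNIV. H * W k)" by (simp add: sum.distrib N_def)
    finally show ?thesis using e1 e2 e4 e5 by linarith
  qed
  define SW where "SW = (\<Sum>j\<in>UNIV. W j)"
  have SW: "0 \<le> SW" unfolding SW_def by (intro sum_nonneg W0)
  have "(\<Sum>j\<in>UNIV. weight j x * (2 * U j * Ut j)) + (\<Sum>j\<in>UNIV. weight_slope j * a j (x, t) * (U j)\<^sup>2 + weight j x * aX j (x, t) * (U j)\<^sup>2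
        + weight j x * a j (x, t) * (2 * U j * Ux j))
      \<le> (\<Sum>j\<in>UNIV. (1 + R) * F\<^sup>2 + W j + 2 * H * W j + (N * (H * W j) + (\<Sum>k\<in>UNIV. H * W k)))"
    unfolding sum.distrib[symmetric] by (intro sum_mono) (use each in \<open>simp add: sum.distrib algebra_simps\<close>)
  also have "\<dots> = N * ((1 + R) * F\<^sup>2) + SW + 2 * H * SW + (N * (H * SW) + N * (H * SW))"
    by (simp add: sum.distrib SW_def N_def sum_distrib_left)
  also have "\<dots> \<le> N * ((1 + R) * F\<^sup>2) + growth * SW"
  proof -
    have "1 \<le> N" by (simp add: N_def Suc_le_eq)
    then have "1 * (H * SW) \<le> N * (H * SW)" using H SW by (intro mult_right_mono) auto
    moreover have "growth * SW = 4 * (N * (H * SW)) + SW"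
      by (simp add: growth_def N_def H_def algebra_simps)
    ultimately show ?thesis by linarith
  qed
  finally show ?thesis by (simp add: SW_def W_def N_def)
qed

section \<open>Energy balance and Gronwall's inequality\<close>

definition energy :: "('n \<Rightarrow> real \<times> real \<Rightarrow> real) \<Rightarrow> real \<Rightarrow> real"
  where "energy u t = (\<Sum>j\<in>UNIV. integral {0..1} (\<lambda>x. weight j x * (u j (x, t))\<^sup>2))"

lemma cont_slice:
  fixes v :: "real \<times> real \<Rightarrow> real"
  assumes "continuous_on ({0..1} \<times> T) v" "t \<in> T"
  shows "continuous_on {0..1} (\<lambda>x. v (x, t))"
  by (rule continuous_on_compose2[OF assms(1)]) (use assms(2) in \<open>auto intro!: continuous_intros\<close>)

lemma energy_deriv:
  assumes "solution \<tau> r u" and F: "\<And>j x t. 0 < x \<Longrightarrow> x < 1 \<Longrightarrow> \<tau> < t \<Longrightarrow> \<bar>r j (x, t)\<bar> \<le> F"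
  shows "continuous_on {\<tau>..} (energy u)"
    "\<And>t. \<tau> < t \<Longrightarrow> \<exists>E'. (energy u has_real_derivative E') (at t) \<and>
      E' \<le> growth * energy u t + real CARD('n) * (1 + R) * F\<^sup>2"
proof -
  obtain ux ut where P: "\<And>j. has_partials_on (u j) (ux j) (ut j) ({0..1} \<times> {\<tau>..})"
    and c: "\<And>j. continuous_on ({0..1} \<times> {\<tau>..}) (u j)"
      "\<And>j. continuous_on ({0..1} \<times> {\<tau>..}) (ux j)" "\<And>j. continuous_on ({0..1} \<times> {\<tau>..}) (ut j)"
    using solution_partials[OF assms(1)] by metis
  note cu = cont_slice[OF c(1)] and cux = cont_slice[OF c(2)] and cut = cont_slice[OF c(3)]
  have D: "(energy u has_real_derivative
      (\<Sum>j\<in>UNIV. integral {0..1} (\<lambda>x. weight j x * (2 * u j (x, t) * ut j (x, t))))) (at t within {\<tau>..})"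
    if t: "\<tau> \<le> t" for t
    unfolding energy_def[abs_def] cbox_interval[symmetric]
  proof (rule DERIV_sum)
    fix j
    show "((\<lambda>t. integral (cbox 0 1) (\<lambda>x. weight j x * (u j (x, t))\<^sup>2)) has_real_derivative
        integral (cbox 0 1) (\<lambda>x. weight j x * (2 * u j (x, t) * ut j (x, t)))) (at t within {\<tau>..})"
    proof (rule leibniz_rule_field_derivative)
      fix s x :: real assume s: "s \<in> {\<tau>..}" "x \<in> cbox 0 1"
      have "((\<lambda>s. u j (x, s)) has_real_derivative ut j (x, s)) (at s within {\<tau>..})"
        using has_partials_on_half_strip(2)[OF P] s by auto
      then show "((\<lambda>s. weight j x * (u j (x, s))\<^sup>2) has_real_derivative
          weight j x * (2 * u j (x, s) * ut j (x, s))) (at s within {\<tau>..})"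
        by (auto intro!: derivative_eq_intros)
    next
      show "(\<lambda>x. weight j x * (u j (x, s))\<^sup>2) integrable_on cbox 0 1" if "s \<in> {\<tau>..}" for s
        using cu[OF that] by (auto intro!: integrable_continuous_real continuous_intros weight_cont)
      have sw: "continuous_on ({\<tau>..} \<times> cbox 0 1) (\<lambda>z. v (snd z, fst z))"
        if "continuous_on ({0..1} \<times> {\<tau>..}) v" for v :: "real \<times> real \<Rightarrow> real"
        by (rule continuous_on_compose2[OF that]) (auto intro!: continuous_intros)
      show "continuous_on ({\<tau>..} \<times> cbox 0 1) (\<lambda>(s, x). weight j x * (2 * u j (x, s) * ut j (x, s)))"
        unfolding case_prod_beta
        by (intro continuous_intros sw c continuous_on_compose2[OF weight_cont[of UNIV]]) auto
    qed (use t in auto)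
  qed
  show "continuous_on {\<tau>..} (energy u)"
    using D by (auto intro!: DERIV_continuous_on)
  fix t assume t: "\<tau> < t"
  then have tt: "t \<in> {\<tau>..}" by simp
  let ?E' = "\<Sum>j\<in>UNIV. integral {0..1} (\<lambda>x. weight j x * (2 * u j (x, t) * ut j (x, t)))"
  have E': "(energy u has_real_derivative ?E') (at t)"
    using D[of t] t at_within_interior[of t "{\<tau>..}"] by (simp add: interior_real_atLeast)
  define flux where "flux j x = weight j x * a j (x, t) * (u j (x, t))\<^sup>2" for j x
  define flux' where "flux' j x = weight_slope j * a j (x, t) * (u j (x, t))\<^sup>2 + weight j x * aX j (x, t) * (u j (x, t))\<^sup>2
        + weight j x * a j (x, t) * (2 * u j (x, t) * ux j (x, t))" for j x
  have "(flux' j has_integral flux j 1 - flux j 0) {0..1}" for j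
  proof (rule fundamental_theorem_of_calculus)
    fix x :: real assume x: "x \<in> {0..1}"
    have "((\<lambda>y. a j (y, t)) has_real_derivative aX j (x, t)) (at x within {0..1})"
      by (rule has_partials_on_Times(1)[OF a_partials x]) simp
    moreover have "((\<lambda>y. u j (y, t)) has_real_derivative ux j (x, t)) (at x within {0..1})"
      using has_partials_on_half_strip(1)[OF P x] t by simp
    ultimately have "(flux j has_real_derivative flux' j x) (at x within {0..1})"
      unfolding flux_def[abs_def] flux'_def
      by (auto intro!: derivative_eq_intros weight_deriv simp: power2_eq_square algebra_simps)
    then show "(flux j has_vector_derivative flux' j x) (at x within {0..1})"
      by (simp add: has_real_derivative_iff_has_vector_derivative)
  qed simp
  then have flux_int: "((\<lambda>x. \<Sum>j\<in>UNIV. flux' j x) has_integral (\<Sum>j\<in>UNIV. flux j 1 - flux j 0)) {0..1}"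
    by (intro has_integral_sum) auto
  have bd: "0 \<le> (\<Sum>j\<in>UNIV. flux j 1 - flux j 0)"
    unfolding flux_def
  proof (rule boundary_dissipation)
    show "u j (0, t) = (\<Sum>k | pos k \<le> m. p j k * u k (1, t)) + (\<Sum>k | pos k > m. p j k * u k (0, t))"
      if "pos j \<le> m" for j
      using assms(1) t that by (simp add: solution_def boundary_rhs_def)
    show "u j (1, t) = (\<Sum>k | pos k \<le> m. p j k * u k (1, t)) + (\<Sum>k | pos k > m. p j k * u k (0, t))"
      if "\<not> pos j \<le> m" for j
      using assms(1) t that by (simp add: solution_def boundary_rhs_def)
  qed
  let ?L = "\<lambda>x. \<Sum>j\<in>UNIV. weight j x * (2 * u j (x, t) * ut j (x, t))"
  let ?W = "\<lambda>x. \<Sum>j\<in>UNIV. weight j x * (u j (x, t))\<^sup>2"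
  let ?C = "real CARD('n) * (1 + R) * F\<^sup>2"
  have iL: "(?L has_integral ?E') {0..1}"
    by (intro has_integral_sum integrable_integral integrable_continuous_real continuous_intros
        weight_cont cu[OF tt] cut[OF tt]) auto
  have iW: "(?W has_integral energy u t) {0..1}"
    unfolding energy_def
    by (intro has_integral_sum integrable_integral integrable_continuous_real continuous_intros
        weight_cont cu[OF tt]) auto
  have iC: "((\<lambda>x::real. ?C) has_integral ?C) {0..1}"
    using has_integral_const_real[of ?C 0 1] by simp
  have iR: "((\<lambda>x. growth * ?W x + ?C - (\<Sum>j\<in>UNIV. flux' j x)) has_integral
      growth * energy u t + ?C - (\<Sum>j\<in>UNIV. flux j 1 - flux j 0)) {0..1}"
    by (intro has_integral_diff has_integral_add has_integral_mult_right iW iC flux_int)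
  \<comment> \<open>The equation is assumed in the open half-strip only, so the pointwise comparison
    of the integrands has to avoid x = 0 and x = 1.\<close>
  have on_open: "(h has_integral y) {0<..<1}" if "(h has_integral y) {0..1}" for h :: "real \<Rightarrow> real" and y
    using that has_integral_open_interval[of h y 0 1] by simp
  have "?E' \<le> growth * energy u t + ?C - (\<Sum>j\<in>UNIV. flux j 1 - flux j 0)"
  proof (rule has_integral_le)
    show "(?L has_integral ?E') {0<..<1}"
      by (rule on_open[OF iL])
    show "((\<lambda>x. growth * ?W x + ?C - (\<Sum>j\<in>UNIV. flux' j x)) has_integral
      growth * energy u t + ?C - (\<Sum>j\<in>UNIV. flux j 1 - flux j 0)) {0<..<1}"
      by (rule on_open[OF iR])
    fix x :: real assume x: "x \<in> {0<..<1}"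
    have pde: "ut j (x, t) + a j (x, t) * ux j (x, t) + (\<Sum>k\<in>UNIV. b j k (x, t) * u k (x, t)) = r j (x, t)" for j
    proof -
      have "(x, t) \<in> half_strip \<tau>" using x t by (simp add: half_strip_def)
      then have "deriv (\<lambda>s. u j (x, s)) t + a j (x, t) * deriv (\<lambda>y. u j (y, t)) x
        + (\<Sum>k\<in>UNIV. b j k (x, t) * u k (x, t)) = r j (x, t)"
        using assms(1) unfolding solution_def by blast
      then show ?thesis using interior_derivs(3,4)[OF P, of x t j] x t by simp
    qed
    show "?L x \<le> growth * ?W x + ?C - (\<Sum>j\<in>UNIV. flux' j x)"
      unfolding flux'_def
      by (rule pointwise_energy[where r = "\<lambda>j. r j (x, t)"]) (use x t F pde in auto)
  qed
  then have "?E' \<le> growth * energy u t + ?C" using bd by linarith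
  then show "\<exists>E'. (energy u has_real_derivative E') (at t) \<and> E' \<le> growth * energy u t + ?C"
    using E' by blast
qed

lemma growth_pos: "1 \<le> growth"
  using R_nonneg B_pos by (simp add: growth_def)

lemma energy_growth:
  assumes "solution \<tau> r u" "\<And>j x t. 0 < x \<Longrightarrow> x < 1 \<Longrightarrow> \<tau> < t \<Longrightarrow> \<bar>r j (x, t)\<bar> \<le> F" "\<tau> \<le> t"
  shows "energy u t \<le> exp (growth * (t - \<tau>)) * (energy u \<tau> + real CARD('n) * (1 + R) * F\<^sup>2 * (t - \<tau>))"
proof -
  let ?C = "real CARD('n) * (1 + R) * F\<^sup>2"
  \<comment> \<open>Gronwall by monotonicity: the exponential factor cancels the growth term, and
    the linear term absorbs the source because that factor is at most 1.\<close>
  let ?G = "\<lambda>s. exp (- (growth * (s - \<tau>))) * energy u s - ?C * (s - \<tau>)"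
  have C: "0 \<le> ?C" using R_nonneg by simp
  note ED = energy_deriv[OF assms(1,2)]
  have "?G t \<le> ?G \<tau>"
  proof (rule DERIV_nonpos_imp_decreasing_open[OF assms(3)])
    fix s assume s: "\<tau> < s" "s < t"
    obtain E' where E': "(energy u has_real_derivative E') (at s)" "E' \<le> growth * energy u s + ?C"
      using ED(2)[OF _ _ _ s(1)] by blast
    let ?e = "exp (- (growth * (s - \<tau>)))"
    have "(?G has_real_derivative ?e * E' - growth * ?e * energy u s - ?C) (at s)"
      by (rule derivative_eq_intros E'(1) refl | simp)+
    moreover have "?e * E' \<le> ?e * (growth * energy u s + ?C)"
      using E'(2) by (intro mult_left_mono) auto
    moreover have "?e * ?C \<le> 1 * ?C"
      using growth_pos s C by (intro mult_right_mono) auto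
    ultimately show "\<exists>y. (?G has_real_derivative y) (at s) \<and> y \<le> 0"
      by (intro exI[of _ "?e * E' - growth * ?e * energy u s - ?C"] conjI) (assumption, simp add: algebra_simps)
  next
    show "continuous_on {\<tau>..t} ?G"
      using continuous_on_subset[OF ED(1)] by (intro continuous_intros) auto
  qed
  then have "exp (- (growth * (t - \<tau>))) * energy u t \<le> energy u \<tau> + ?C * (t - \<tau>)" by simp
  then have "exp (growth * (t - \<tau>)) * (exp (- (growth * (t - \<tau>))) * energy u t)
      \<le> exp (growth * (t - \<tau>)) * (energy u \<tau> + ?C * (t - \<tau>))"
    by (intro mult_left_mono) auto
  then show ?thesis by (simp flip: mult.assoc exp_add)
qed

abbreviation "state u t \<equiv> L2_vec (\<lambda>j x. u j (x, t))"

lemma energy_bounds: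
  assumes "\<And>j. continuous_on {0..1} (\<lambda>x. u j (x, t))"
  shows "(norm (state u t))\<^sup>2 \<le> energy u t"
    "energy u t \<le> real CARD('n) * (1 + R) * (norm (state u t))\<^sup>2"
proof -
  let ?I = "\<lambda>j. integral {0..1} (\<lambda>x. (u j (x, t))\<^sup>2)"
  let ?W = "\<lambda>j. integral {0..1} (\<lambda>x. weight j x * (u j (x, t))\<^sup>2)"
  have i: "(\<lambda>x. (u j (x, t))\<^sup>2) integrable_on {0..1}"
    "(\<lambda>x. weight j x * (u j (x, t))\<^sup>2) integrable_on {0..1}"
    "(\<lambda>x. (1 + R) * (u j (x, t))\<^sup>2) integrable_on {0..1}" for j
    by (intro integrable_continuous_real continuous_intros weight_cont assms)+
  have I_W: "?I j \<le> ?W j" for j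
  proof (rule integral_le[OF i(1,2)])
    fix x :: real assume "x \<in> {0..1}"
    then show "(u j (x, t))\<^sup>2 \<le> weight j x * (u j (x, t))\<^sup>2"
      using weight_bounds(1)[of x j] mult_right_mono[of 1 "weight j x" "(u j (x, t))\<^sup>2"] by simp
  qed
  have W_I: "?W j \<le> (1 + R) * ?I j" for j
    unfolding integral_mult_right[symmetric]
    by (rule integral_le[OF i(2,3)]) (intro mult_right_mono weight_bounds; simp)
  have I0: "0 \<le> ?I j" for j by (rule integral_nonneg[OF i(1)]) simp
  have nI: "(norm (L2_class (\<lambda>x. u j (x, t))))\<^sup>2 = ?I j" for j
    by (rule norm_L2_class_continuous[OF assms])
  have "?W j \<le> energy u t" for j
    unfolding energy_def using I0 I_W by (intro member_le_sum) (auto intro: order_trans)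
  then have "(norm (L2_class (\<lambda>x. u j (x, t))))\<^sup>2 \<le> energy u t" for j
    unfolding nI by (rule order_trans[OF I_W])
  then have "norm (state u t) \<le> sqrt (energy u t)"
    by (simp add: norm_max_pow_le_iff real_le_rsqrt)
  moreover have E0: "0 \<le> energy u t"
    unfolding energy_def by (intro sum_nonneg order_trans[OF I0 I_W])
  ultimately have "(norm (state u t))\<^sup>2 \<le> (sqrt (energy u t))\<^sup>2"
    by (intro power_mono) auto
  then show "(norm (state u t))\<^sup>2 \<le> energy u t" using E0 by simp
  have W_R: "?W j \<le> (1 + R) * (norm (state u t))\<^sup>2" for j
  proof -
    have "?I j \<le> (norm (state u t))\<^sup>2"
      unfolding nI[symmetric] using norm_component_le[of "state u t" j] by (intro power_mono) auto
    then have "(1 + R) * ?I j \<le> (1 + R) * (norm (state u t))\<^sup>2"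
      using R_nonneg by (intro mult_left_mono) auto
    then show ?thesis using W_I[of j] by linarith
  qed
  have "energy u t \<le> of_nat (card (UNIV :: 'n set)) * ((1 + R) * (norm (state u t))\<^sup>2)"
    unfolding energy_def by (rule sum_bounded_above) (rule W_R)
  then show "energy u t \<le> real CARD('n) * (1 + R) * (norm (state u t))\<^sup>2" by (simp add: mult.assoc)
qed

text \<open>The price for passing from the weighted energy back to the maximum norm: the square root
  of the ratio of the two constants in \<open>energy_bounds\<close>.\<close>

definition "amplif = sqrt (real CARD('n) * (1 + R))"

lemma amplif_ge: "1 \<le> amplif"
proof -
  have "1 * 1 \<le> real CARD('n) * (1 + R)" using R_nonneg by (intro mult_mono) (auto simp: Suc_le_eq)
  then show ?thesis by (simp add: amplif_def)
qed

lemma solution_slice_cont: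
  assumes "solution \<tau> r u" "\<tau> \<le> t"
  shows "continuous_on {0..1} (\<lambda>x. u j (x, t))"
  using assms cont_slice[of "{\<tau>..}" "u j" t] by (simp add: solution_def C1_on_def closure_half_strip)

theorem energy_estimate:
  assumes "solution \<tau> r u" "\<And>j x t. 0 < x \<Longrightarrow> x < 1 \<Longrightarrow> \<tau> < t \<Longrightarrow> \<bar>r j (x, t)\<bar> \<le> F"
    and "0 \<le> F" "\<tau> \<le> t"
  shows "norm (state u t) \<le> amplif * exp (growth * (t - \<tau>)) * (norm (state u \<tau>) + F * sqrt (t - \<tau>))"
proof (rule power2_le_imp_le)
  let ?A = "real CARD('n) * (1 + R)" and ?h = "t - \<tau>" and ?y = "norm (state u \<tau>)"
  have A: "0 \<le> 1 + R" "0 \<le> ?A" "amplif\<^sup>2 = ?A" using R_nonneg by (auto simp: amplif_def)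
  have e: "1 \<le> exp (growth * ?h)" using growth_pos assms(4) by simp
  have "(norm (state u t))\<^sup>2 \<le> energy u t"
    by (rule energy_bounds(1)[OF solution_slice_cont[OF assms(1,4)]])
  also have "\<dots> \<le> exp (growth * ?h) * (energy u \<tau> + ?A * F\<^sup>2 * ?h)"
    by (rule energy_growth[OF assms(1,2,4)])
  also have "\<dots> \<le> exp (growth * ?h) * (?A * ?y\<^sup>2 + ?A * F\<^sup>2 * ?h)"
    using energy_bounds(2)[OF solution_slice_cont[OF assms(1) order_refl]]
    by (intro mult_left_mono add_right_mono) auto
  also have "\<dots> = exp (growth * ?h) * (?A * (?y\<^sup>2 + (F * sqrt ?h)\<^sup>2))"
    using assms(4) by (simp add: distrib_left power_mult_distrib)
  \<comment> \<open>The bound is enlarged to a perfect square so that the root can be taken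
    cleanly.\<close>
  also have "\<dots> \<le> (exp (growth * ?h))\<^sup>2 * (?A * (?y + F * sqrt ?h)\<^sup>2)"
  proof (intro mult_mono mult_left_mono)
    show "exp (growth * ?h) \<le> (exp (growth * ?h))\<^sup>2" using e by (simp add: power2_eq_square)
    show "?y\<^sup>2 + (F * sqrt ?h)\<^sup>2 \<le> (?y + F * sqrt ?h)\<^sup>2"
      using assms(3,4) by (simp add: power2_sum)
  qed (use A in auto)
  also have "\<dots> = (amplif * exp (growth * ?h) * (?y + F * sqrt ?h))\<^sup>2"
    by (simp add: A(3)[symmetric] power_mult_distrib)
  finally show "(norm (state u t))\<^sup>2 \<le> (amplif * exp (growth * ?h) * (?y + F * sqrt ?h))\<^sup>2" .
  show "0 \<le> amplif * exp (growth * ?h) * (?y + F * sqrt ?h)"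
    using amplif_ge assms(3,4) by auto
qed

end

section \<open>Classical solutions\<close>

lemma bounded_family:
  fixes H :: "(real \<Rightarrow> real) set"
  assumes "finite H" "\<And>h. h \<in> H \<Longrightarrow> continuous_on {0..1} h"
  shows "\<exists>M\<ge>0. \<forall>h\<in>H. \<forall>x\<in>{0..1}. \<bar>h x\<bar> \<le> M"
proof -
  have "compact (\<Union>h\<in>H. h ` {0..1})"
    using assms by (intro compact_UN compact_continuous_image) auto
  then have "bounded (\<Union>h\<in>H. h ` {0..1})" by (rule compact_imp_bounded)
  then obtain M where M: "\<And>y. y \<in> (\<Union>h\<in>H. h ` {0..1}) \<Longrightarrow> norm y \<le> M"
    unfolding bounded_iff by blast
  have "\<bar>h x\<bar> \<le> max M 0" if "h \<in> H" "x \<in> {0..1}" for h and x :: real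
  proof -
    have "norm (h x) \<le> M" using that by (intro M) blast
    then show ?thesis by simp
  qed
  then show ?thesis by (intro exI[of _ "max M 0"]) auto
qed

context ibvp
begin

definition orient :: "'n \<Rightarrow> real" where "orient j = (if pos j \<le> m then 1 else - 1)"

text \<open>The quantity dt/dx in the reflected coordinate. \<open>orient j\<close> makes it
  positive for either direction of travel, as \<open>flow\<close> demands.\<close>

definition slowness :: "'n \<Rightarrow> real \<Rightarrow> real \<Rightarrow> real"
  where "slowness j x t = orient j / a j (flip m j x, t)"

definition slowness_t :: "'n \<Rightarrow> real \<Rightarrow> real \<Rightarrow> real"
  where "slowness_t j x t = - orient j * aT j (flip m j x, t) / (a j (flip m j x, t))\<^sup>2"

text \<open>The coupling coefficient after division by the oriented speed, read in the reflected
  coordinate of component j.\<close>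

definition exchange :: "'n \<Rightarrow> 'n \<Rightarrow> real \<Rightarrow> real \<Rightarrow> real"
  where "exchange j k x t = slowness j x t * b j k (flip m j x, t)"

definition exchange_t :: "'n \<Rightarrow> 'n \<Rightarrow> real \<Rightarrow> real \<Rightarrow> real"
  where "exchange_t j k x t = slowness_t j x t * b j k (flip m j x, t) + slowness j x t * bT j k (flip m j x, t)"

lemma orient_a: "x \<in> {0..1} \<Longrightarrow> \<Lambda> \<le> orient j * a j (x, t)"
  using a_pos[of j x t] a_neg[of j x t] by (auto simp: orient_def)

lemma a_nonzero: "x \<in> {0..1} \<Longrightarrow> a j (x, t) \<noteq> 0"
  using orient_a[of x j t] \<Lambda>_pos by auto

lemma slowness_eq: "slowness j x t = 1 / (orient j * a j (flip m j x, t))"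
  by (simp add: slowness_def orient_def)

lemma flip_strip_cont:
  assumes "continuous_on ({0..1} \<times> UNIV) v"
  shows "continuous_on ({0..1} \<times> T) (\<lambda>(x, t). v (flip m j x, t))"
  unfolding case_prod_beta
  by (rule continuous_on_compose2[OF assms])
    (auto intro!: continuous_intros continuous_on_compose2[OF flip_cont[of UNIV]] dest: flip_range[of _ m j])

lemma t_partial:
  assumes "has_partials_on v vx vt ({0..1} \<times> UNIV)" "x \<in> {0..1}"
  shows "((\<lambda>t. v (x, t)) has_real_derivative vt (x, t)) (at t)"
  using has_partials_on_Times(2)[OF assms, of t] by simp

lemma slowness_bounds:
  assumes x: "x \<in> {0..1}"
  shows "1 / B \<le> slowness j x t" "slowness j x t \<le> 1 / \<Lambda>" "\<bar>slowness j x t\<bar> \<le> 1 / \<Lambda>"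
    "\<bar>slowness_t j x t\<bar> \<le> B / \<Lambda>\<^sup>2"
proof -
  let ?y = "orient j * a j (flip m j x, t)"
  have y: "\<Lambda> \<le> ?y" by (rule orient_a[OF flip_range[OF x]])
  have abs_y: "\<bar>?y\<bar> = \<bar>a j (flip m j x, t)\<bar>" by (simp add: abs_mult orient_def)
  then have yB: "?y \<le> B" using a_bound(1)[OF flip_range[OF x], of j m j t] by simp
  show "1 / B \<le> slowness j x t" "slowness j x t \<le> 1 / \<Lambda>"
    unfolding slowness_eq using y yB \<Lambda>_pos B_pos by (auto intro!: frac_le)
  then show "\<bar>slowness j x t\<bar> \<le> 1 / \<Lambda>"
    using B_pos by (auto simp: abs_le_iff) (smt (verit) divide_pos_pos)
  have "\<Lambda>\<^sup>2 \<le> (a j (flip m j x, t))\<^sup>2"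
    using y abs_y \<Lambda>_pos by (simp add: abs_le_square_iff[symmetric])
  moreover have "\<bar>slowness_t j x t\<bar> = \<bar>aT j (flip m j x, t)\<bar> / (a j (flip m j x, t))\<^sup>2"
    by (simp add: slowness_t_def abs_mult orient_def)
  ultimately show "\<bar>slowness_t j x t\<bar> \<le> B / \<Lambda>\<^sup>2"
    using a_bound(3)[OF flip_range[OF x], of j m j t] \<Lambda>_pos B_pos by (auto intro!: frac_le)
qed

lemma slowness_cont:
  "continuous_on ({0..1} \<times> UNIV) (\<lambda>(x, t). slowness j x t)"
  "continuous_on ({0..1} \<times> UNIV) (\<lambda>(x, t). slowness_t j x t)"
proof -
  note ac = flip_strip_cont[OF a_cont(1), of UNIV j j] flip_strip_cont[OF a_cont(3), of UNIV j j]
  have nz: "\<forall>z\<in>{0..1} \<times> UNIV. a j (flip m j (fst z), snd z) \<noteq> 0"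
    by (intro ballI a_nonzero flip_range) auto
  show "continuous_on ({0..1} \<times> UNIV) (\<lambda>(x, t). slowness j x t)"
    "continuous_on ({0..1} \<times> UNIV) (\<lambda>(x, t). slowness_t j x t)"
    using ac nz unfolding slowness_def slowness_t_def case_prod_beta
    by (auto intro!: continuous_intros)
qed

lemma slowness_deriv:
  assumes x: "x \<in> {0..1}"
  shows "(slowness j x has_real_derivative slowness_t j x t) (at t)"
  unfolding slowness_def[abs_def] slowness_t_def
  using a_nonzero[OF flip_range[OF x]] t_partial[OF a_partials flip_range[OF x]]
  by (auto intro!: derivative_eq_intros simp: power2_eq_square)

lemma exchange_deriv:
  assumes x: "x \<in> {0..1}"
  shows "(exchange j k x has_real_derivative exchange_t j k x t) (at t)"
  unfolding exchange_def[abs_def] exchange_t_def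
  using DERIV_mult[OF slowness_deriv[OF x] t_partial[OF b_partials flip_range[OF x]]]
  by (simp add: mult.commute)

lemma exchange_cont:
  "continuous_on ({0..1} \<times> UNIV) (\<lambda>(x, t). exchange j k x t)"
  "continuous_on ({0..1} \<times> UNIV) (\<lambda>(x, t). exchange_t j k x t)"
  using slowness_cont[of j] flip_strip_cont[OF b_cont(1)[of j k], of UNIV j] flip_strip_cont[OF b_cont(3)[of j k], of UNIV j]
  unfolding exchange_def exchange_t_def case_prod_beta
  by (auto intro!: continuous_intros)

text \<open>The coordinate x of component j denotes the physical point \<open>flip m j x\<close>,
  and component k sees that point at \<open>flip m k (flip m j x)\<close>. The constants follow from
  \<open>\<Lambda> \<le> orient j * a j\<close> and from \<open>B\<close>.\<close>

lemma flipped_system: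
  "hyperbolic slowness slowness_t (1 / B) (1 / \<Lambda>) (B / \<Lambda>\<^sup>2) exchange exchange_t
    (B / \<Lambda>\<^sup>2 * B + 1 / \<Lambda> * B) (\<lambda>j k x. flip m k (flip m j x))"
proof
  fix j k :: 'n and x t :: real
  show "continuous_on ({0..1} \<times> UNIV) (\<lambda>(x, t). slowness j x t)"
    "continuous_on ({0..1} \<times> UNIV) (\<lambda>(x, t). slowness_t j x t)" by (rule slowness_cont)+
  show "continuous_on ({0..1} \<times> UNIV) (\<lambda>(x, t). exchange j k x t)"
    "continuous_on ({0..1} \<times> UNIV) (\<lambda>(x, t). exchange_t j k x t)" by (rule exchange_cont)+
  show "0 < 1 / B" using B_pos by simp
  show "continuous_on {0..1} (\<lambda>x. flip m k (flip m j x))"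
    by (rule continuous_on_compose2[OF flip_cont[of UNIV] flip_cont]) simp
  assume x: "x \<in> {0..1}"
  show "flip m k (flip m j x) \<in> {0..1}" by (intro flip_range x)
  show "(slowness j x has_real_derivative slowness_t j x t) (at t)" by (rule slowness_deriv[OF x])
  show "(exchange j k x has_real_derivative exchange_t j k x t) (at t)" by (rule exchange_deriv[OF x])
  show "1 / B \<le> slowness j x t" "slowness j x t \<le> 1 / \<Lambda>" "\<bar>slowness_t j x t\<bar> \<le> B / \<Lambda>\<^sup>2"
    by (rule slowness_bounds[OF x])+
  have 1: "\<bar>slowness j x t * b j k (flip m j x, t)\<bar> \<le> 1 / \<Lambda> * B"
    unfolding abs_mult using \<Lambda>_pos by (intro mult_mono slowness_bounds b_bound flip_range x) auto
  have 2: "\<bar>slowness j x t * bT j k (flip m j x, t)\<bar> \<le> 1 / \<Lambda> * B"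
    unfolding abs_mult using \<Lambda>_pos by (intro mult_mono slowness_bounds b_bound flip_range x) auto
  have 3: "\<bar>slowness_t j x t * b j k (flip m j x, t)\<bar> \<le> B / \<Lambda>\<^sup>2 * B"
    unfolding abs_mult using \<Lambda>_pos B_pos by (intro mult_mono slowness_bounds b_bound flip_range x) auto
  have 4: "0 \<le> B / \<Lambda>\<^sup>2 * B" using B_pos by simp
  show "\<bar>exchange j k x t\<bar> \<le> B / \<Lambda>\<^sup>2 * B + 1 / \<Lambda> * B"
    unfolding exchange_def using 1 4 by linarith
  show "\<bar>exchange_t j k x t\<bar> \<le> B / \<Lambda>\<^sup>2 * B + 1 / \<Lambda> * B"
    unfolding exchange_t_def using 2 3 by linarith
qed

text \<open>For data \<open>\<phi>\<close> the function \<open>\<phi> + sin (t - \<tau>) \<psi>\<close> matches the solution to first order at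
  \<open>t = \<tau>\<close>, so the remainder has zero data and a source that vanishes at \<open>t = \<tau>\<close> and can be
  switched off for earlier times at the price of a kink. The sine keeps the source bounded.\<close>

theorem classical_solution_exists:
  assumes \<phi>: "\<And>j. \<phi> j \<in> test_functions"
  shows "\<exists>u. classical_solution m p a b \<tau> \<phi> u"
proof -
  interpret H: hyperbolic slowness slowness_t "1 / B" "1 / \<Lambda>" "B / \<Lambda>\<^sup>2" exchange exchange_t
    "B / \<Lambda>\<^sup>2 * B + 1 / \<Lambda> * B" "\<lambda>j k x. flip m k (flip m j x)" p
    by (rule flipped_system)
  define \<phi>1 where "\<phi>1 j = deriv (\<phi> j)" for j
  define \<phi>2 where "\<phi>2 j = deriv (\<phi>1 j)" for j
  have \<phi>1: "\<phi>1 j \<in> test_functions" for j unfolding \<phi>1_def by (intro test_functions_deriv \<phi>)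
  have \<phi>2: "\<phi>2 j \<in> test_functions" for j unfolding \<phi>2_def by (intro test_functions_deriv \<phi>1)
  have d\<phi>: "(\<phi> j has_real_derivative \<phi>1 j x) (at x within A)" for j x A
    unfolding \<phi>1_def by (rule has_field_derivative_at_within[OF test_function_derivative[OF \<phi>]])
  have d\<phi>1: "(\<phi>1 j has_real_derivative \<phi>2 j x) (at x within A)" for j x A
    unfolding \<phi>2_def by (rule has_field_derivative_at_within[OF test_function_derivative[OF \<phi>1]])
  note c\<phi> = test_function_continuous[OF \<phi>] test_function_continuous[OF \<phi>1] test_function_continuous[OF \<phi>2]
  \<comment> \<open>The time derivative at \<tau> that the equation forces upon a solution with
    initial data \<phi>.\<close>
  define \<psi> where "\<psi> j x = - (a j (x, \<tau>) * \<phi>1 j x + (\<Sum>k\<in>UNIV. b j k (x, \<tau>) * \<phi> k x))" for j x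
  define \<psi>1 where "\<psi>1 j x = - (aX j (x, \<tau>) * \<phi>1 j x + a j (x, \<tau>) * \<phi>2 j x
      + (\<Sum>k\<in>UNIV. bX j k (x, \<tau>) * \<phi> k x + b j k (x, \<tau>) * \<phi>1 k x))" for j x
  have d\<psi>: "(\<psi> j has_real_derivative \<psi>1 j x) (at x within {0..1})" if x: "x \<in> {0..1}" for j x
  proof -
    have da: "((\<lambda>x. a j (x, \<tau>)) has_real_derivative aX j (x, \<tau>)) (at x within {0..1})"
      by (rule has_partials_on_Times(1)[OF a_partials x]) simp
    have db: "((\<lambda>x. b j k (x, \<tau>)) has_real_derivative bX j k (x, \<tau>)) (at x within {0..1})" for k
      by (rule has_partials_on_Times(1)[OF b_partials x]) simp
    have "((\<lambda>x. b j k (x, \<tau>) * \<phi> k x) has_real_derivative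
        bX j k (x, \<tau>) * \<phi> k x + b j k (x, \<tau>) * \<phi>1 k x) (at x within {0..1})" for k
      using DERIV_mult[OF db d\<phi>] by (simp add: mult.commute)
    moreover have "((\<lambda>x. a j (x, \<tau>) * \<phi>1 j x) has_real_derivative
        aX j (x, \<tau>) * \<phi>1 j x + a j (x, \<tau>) * \<phi>2 j x) (at x within {0..1})"
      using DERIV_mult[OF da d\<phi>1] by (simp add: mult.commute)
    ultimately show ?thesis
      unfolding \<psi>_def[abs_def] \<psi>1_def by (intro DERIV_minus DERIV_add DERIV_sum)
  qed
  have c\<psi>: "continuous_on {0..1} (\<psi> j)" "continuous_on {0..1} (\<psi>1 j)" for j
    unfolding \<psi>_def[abs_def] \<psi>1_def[abs_def]
    using cont_slice[OF a_cont(1)] cont_slice[OF a_cont(2)] cont_slice[OF b_cont(1)] cont_slice[OF b_cont(2)]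
    by (auto intro!: continuous_intros c\<phi>)
  define H where "H = range \<phi> \<union> range \<phi>1 \<union> range \<psi> \<union> range \<psi>1"
  have "finite H" by (simp add: H_def)
  moreover have "continuous_on {0..1} h" if "h \<in> H" for h
    using that c\<phi> c\<psi> by (auto simp: H_def)
  ultimately have "\<exists>M\<ge>0. \<forall>h\<in>H. \<forall>x\<in>{0..1}. \<bar>h x\<bar> \<le> M" by (rule bounded_family)
  then obtain M where M0: "0 \<le> M" and MH: "\<And>h x. h \<in> H \<Longrightarrow> x \<in> {0..1} \<Longrightarrow> \<bar>h x\<bar> \<le> M"
    by blast
  have M: "0 \<le> M" "\<bar>\<phi> j x\<bar> \<le> M" "\<bar>\<phi>1 j x\<bar> \<le> M" "\<bar>\<psi> j x\<bar> \<le> M" "\<bar>\<psi>1 j x\<bar> \<le> M"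
    if "x \<in> {0..1}" for j x
    using M0 MH[OF _ that, of "\<phi> j"] MH[OF _ that, of "\<phi>1 j"] MH[OF _ that, of "\<psi> j"] MH[OF _ that, of "\<psi>1 j"]
    by (auto simp: H_def)
  define w where "w j x t = \<phi> j x + sin (t - \<tau>) * \<psi> j x" for j x t
  define wx where "wx j x t = \<phi>1 j x + sin (t - \<tau>) * \<psi>1 j x" for j x t
  \<comment> \<open>The residual of \<open>w\<close> in the equation. At t = \<tau> the sine is 0
    and the cosine 1, so the choice of \<psi> makes it vanish there.\<close>
  define r where "r j x t = cos (t - \<tau>) * \<psi> j x + a j (x, t) * wx j x t
      + (\<Sum>k\<in>UNIV. b j k (x, t) * w k x t)" for j x t
  define rt where "rt j x t = - sin (t - \<tau>) * \<psi> j x + (aT j (x, t) * wx j x t + a j (x, t) * (cos (t - \<tau>) * \<psi>1 j x))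
      + (\<Sum>k\<in>UNIV. bT j k (x, t) * w k x t + b j k (x, t) * (cos (t - \<tau>) * \<psi> k x))" for j x t
  have dw: "((\<lambda>t. w j x t) has_real_derivative cos (t - \<tau>) * \<psi> j x) (at t within A)" for j x t A
    unfolding w_def by (auto intro!: derivative_eq_intros)
  have dwx_t: "((\<lambda>t. wx j x t) has_real_derivative cos (t - \<tau>) * \<psi>1 j x) (at t)" for j x t
    unfolding wx_def by (auto intro!: derivative_eq_intros)
  have dw_x: "((\<lambda>x. w j x t) has_real_derivative wx j x t) (at x within {0..1})" if "x \<in> {0..1}" for j x t
    unfolding w_def wx_def using d\<psi>[OF that] by (auto intro!: derivative_eq_intros d\<phi>)
  have dr: "(r j x has_real_derivative rt j x t) (at t)" if x: "x \<in> {0..1}" for j x t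
  proof -
    have 1: "((\<lambda>t. cos (t - \<tau>) * \<psi> j x) has_real_derivative - sin (t - \<tau>) * \<psi> j x) (at t)"
      by (auto intro!: derivative_eq_intros)
    have 2: "((\<lambda>t. a j (x, t) * wx j x t) has_real_derivative
        aT j (x, t) * wx j x t + a j (x, t) * (cos (t - \<tau>) * \<psi>1 j x)) (at t)"
      using DERIV_mult[OF t_partial[OF a_partials x] dwx_t] by (simp add: mult.commute)
    have 3: "((\<lambda>t. b j k (x, t) * w k x t) has_real_derivative
        bT j k (x, t) * w k x t + b j k (x, t) * (cos (t - \<tau>) * \<psi> k x)) (at t)" for k
      using DERIV_mult[OF t_partial[OF b_partials x] dw] by (simp add: mult.commute)
    show ?thesis
      unfolding r_def[abs_def] rt_def by (intro DERIV_add DERIV_sum 1 2 3)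
  qed
  have on_strip: "continuous_on ({0..1} \<times> UNIV) (\<lambda>z. h (fst z))" if "continuous_on {0..1} h" for h :: "real \<Rightarrow> real"
    by (rule continuous_on_compose2[OF that]) (auto intro!: continuous_intros)
  have w_cont: "continuous_on ({0..1} \<times> UNIV) (\<lambda>(x, t). w j x t)"
    "continuous_on ({0..1} \<times> UNIV) (\<lambda>(x, t). wx j x t)" for j
    unfolding w_def wx_def case_prod_beta by (intro continuous_intros on_strip c\<phi> c\<psi>)+
  have r_cont: "continuous_on ({0..1} \<times> UNIV) (\<lambda>z. r j (fst z) (snd z))"
    "continuous_on ({0..1} \<times> UNIV) (\<lambda>z. rt j (fst z) (snd z))" for j
    using w_cont a_cont b_cont unfolding r_def rt_def case_prod_beta
    by (auto intro!: continuous_intros on_strip c\<psi>)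
  define N where "N = real CARD('n)"
  have N: "0 \<le> N" by (simp add: N_def)
  have mult_le: "\<bar>y * z\<bar> \<le> C * D" if "\<bar>y\<bar> \<le> C" "\<bar>z\<bar> \<le> D" for y z C D :: real
    unfolding abs_mult using that by (intro mult_mono) auto
  have w_le: "\<bar>w j x t\<bar> \<le> 2 * M" "\<bar>wx j x t\<bar> \<le> 2 * M" if x: "x \<in> {0..1}" for j x t
    using mult_le[OF abs_sin_le_one M(4)[OF x], of "t - \<tau>" j] mult_le[OF abs_sin_le_one M(5)[OF x], of "t - \<tau>" j]
      M(2)[OF x, of j] M(3)[OF x, of j] unfolding w_def wx_def by linarith+
  have c_le: "\<bar>cos (t - \<tau>) * \<psi> j x\<bar> \<le> 1 * M" "\<bar>cos (t - \<tau>) * \<psi>1 j x\<bar> \<le> 1 * M" "\<bar>- sin (t - \<tau>) * \<psi> j x\<bar> \<le> 1 * M"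
    if x: "x \<in> {0..1}" for j x t
    by (intro mult_le M x; simp)+
  define D where "D = M + 3 * (B * M) + N * (3 * (B * M))"
  have BM: "0 \<le> B * M" using B_pos M0 by simp
  have r_le: "\<bar>r j x t\<bar> \<le> D" if x: "x \<in> {0..1}" for j x t
  proof -
    have "\<bar>\<Sum>k\<in>UNIV. b j k (x, t) * w k x t\<bar> \<le> (\<Sum>k\<in>(UNIV::'n set). B * (2 * M))"
      by (intro order_trans[OF sum_abs] sum_mono mult_le b_bound w_le x)
    also have "\<dots> = N * (2 * (B * M))" by (simp add: N_def)
    also have "\<dots> \<le> N * (3 * (B * M))" using N BM by (intro mult_left_mono) auto
    finally show ?thesis
      using c_le(1)[OF x, of t j] mult_le[OF a_bound(1)[OF x] w_le(2)[OF x], of j t j t] BM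
      unfolding r_def D_def by linarith
  qed
  have rt_le: "\<bar>rt j x t\<bar> \<le> D" if x: "x \<in> {0..1}" for j x t
  proof -
    have "\<bar>bT j k (x, t) * w k x t + b j k (x, t) * (cos (t - \<tau>) * \<psi> k x)\<bar> \<le> 3 * (B * M)" for k
      using mult_le[OF b_bound(3)[OF x] w_le(1)[OF x], of j k t k t] mult_le[OF b_bound(1)[OF x] c_le(1)[OF x], of j k t t k]
      by linarith
    then have "\<bar>\<Sum>k\<in>UNIV. bT j k (x, t) * w k x t + b j k (x, t) * (cos (t - \<tau>) * \<psi> k x)\<bar>
        \<le> (\<Sum>k\<in>(UNIV::'n set). 3 * (B * M))"
      by (intro order_trans[OF sum_abs] sum_mono)
    also have "\<dots> = N * (3 * (B * M))" by (simp add: N_def)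
    finally show ?thesis
      using c_le(3)[OF x, of t j] mult_le[OF a_bound(3)[OF x] w_le(2)[OF x], of j t j t]
        mult_le[OF a_bound(1)[OF x] c_le(2)[OF x], of j t t j]
      unfolding rt_def D_def by linarith
  qed
  \<comment> \<open>The source for the remainder in reflected form: minus the residual, divided by
    the oriented speed.\<close>
  define \<kappa> where "\<kappa> j x t = - (slowness j x t * r j (flip m j x) t)" for j x t
  define \<kappa>t where "\<kappa>t j x t = - (slowness_t j x t * r j (flip m j x) t + slowness j x t * rt j (flip m j x) t)" for j x t
  define E where "E = B / \<Lambda>\<^sup>2 * D + 1 / \<Lambda> * D"
  have "0 \<le> D" unfolding D_def using M0 BM N by simp
  then have BD: "0 \<le> B / \<Lambda>\<^sup>2 * D" using B_pos by simp
  have \<kappa>_le: "\<bar>\<kappa> j x t\<bar> \<le> E" "\<bar>\<kappa>t j x t\<bar> \<le> E" if x: "x \<in> {0..1}" for j x t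
    using mult_le[OF slowness_bounds(3)[OF x] r_le[OF flip_range[OF x]], of j t j m j t]
      mult_le[OF slowness_bounds(4)[OF x] r_le[OF flip_range[OF x]], of j t j m j t]
      mult_le[OF slowness_bounds(3)[OF x] rt_le[OF flip_range[OF x]], of j t j m j t] BD
    unfolding \<kappa>_def \<kappa>t_def E_def by linarith+
  have \<kappa>_cont: "continuous_on ({0..1} \<times> UNIV) (\<lambda>(x, t). \<kappa> j x t)"
    "continuous_on ({0..1} \<times> UNIV) (\<lambda>(x, t). \<kappa>t j x t)" for j
    using slowness_cont[of j] flip_strip_cont[OF r_cont(1), of UNIV j j] flip_strip_cont[OF r_cont(2), of UNIV j j]
    unfolding \<kappa>_def \<kappa>t_def case_prod_beta by (auto intro!: continuous_intros)
  have d\<kappa>: "(\<kappa> j x has_real_derivative \<kappa>t j x t) (at t)" if x: "x \<in> {0..1}" for j x t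
    using DERIV_minus[OF DERIV_mult[OF slowness_deriv[OF x] dr[OF flip_range[OF x]]]]
    unfolding \<kappa>_def[abs_def] \<kappa>t_def by (simp add: mult.commute)
  have r_\<tau>: "r j x \<tau> = 0" for j x
    by (simp add: r_def w_def wx_def \<psi>_def)
  define K where "K j x t = (if t > \<tau> then \<kappa> j x t else 0)" for j x t
  define Kt where "Kt j x t = (if t > \<tau> then \<kappa>t j x t else 0)" for j x t
  have K_tr: "flow.transportable (slowness j) (slowness_t j) (K j) (Kt j)" for j
    unfolding K_def[abs_def] Kt_def[abs_def]
    by (rule flow.transportable_kink[OF H.flows \<kappa>_cont d\<kappa> _ \<kappa>_le(2)]) (auto simp: \<kappa>_def r_\<tau>)
  have K_cont: "continuous_on ({0..1} \<times> UNIV) (\<lambda>(x, t). K j x t)" for j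
    using K_tr[of j] by (simp add: flow.transportable_def[OF H.flows])
  have E0: "0 \<le> E" using \<kappa>_le(1)[of 0 undefined 0] by simp
  have "\<exists>v vt. null_before \<tau> v vt \<and> (\<forall>j t. v j 0 t = H.inflow v j t) \<and>
    (\<forall>j. \<forall>x\<in>{0..1}. \<forall>t. ((\<lambda>y. v j y t) has_real_derivative
      K j x t + H.coupling v j x t - slowness j x t * vt j x t) (at x within {0..1}))"
    by (rule H.forced_solution_exists[OF K_tr, of E]) (use \<kappa>_le E0 in \<open>auto simp: K_def Kt_def\<close>)
  then obtain v vt where nb: "null_before \<tau> v vt" and bc: "\<And>j t. v j 0 t = H.inflow v j t"
    and dv: "\<And>j x t. x \<in> {0..1} \<Longrightarrow> ((\<lambda>y. v j y t) has_real_derivative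
      K j x t + H.coupling v j x t - slowness j x t * vt j x t) (at x within {0..1})"
    by blast
  define V where "V j x t = K j x t + H.coupling v j x t - slowness j x t * vt j x t" for j x t
  have V_cont: "continuous_on ({0..1} \<times> UNIV) (\<lambda>z. V j (fst z) (snd z))" for j
    using K_cont[of j] H.coupling_cont(1)[OF nb, of j] slowness_cont(1)[of j] null_beforeD(2)[OF nb, of j]
    unfolding V_def case_prod_beta by (auto intro!: continuous_intros)
  define u where "u j = (\<lambda>(x, t). w j x t + v j (flip m j x) t)" for j
  define ux where "ux j = (\<lambda>(x, t). wx j x t + V j (flip m j x) t * orient j)" for j
  define ut where "ut j = (\<lambda>(x, t). cos (t - \<tau>) * \<psi> j x + vt j (flip m j x) t)" for j
  have sub: "continuous_on ({0..1} \<times> {\<tau>..}) h" if "continuous_on ({0..1} \<times> UNIV) h" for h :: "real \<times> real \<Rightarrow> real"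
    using that by (rule continuous_on_subset) auto
  have u_cont: "continuous_on ({0..1} \<times> {\<tau>..}) (u j)" "continuous_on ({0..1} \<times> {\<tau>..}) (ux j)"
    "continuous_on ({0..1} \<times> {\<tau>..}) (ut j)" for j
    using w_cont[of j] flip_strip_cont[OF null_beforeD(1)[OF nb, unfolded case_prod_beta], of UNIV j j]
      flip_strip_cont[OF null_beforeD(2)[OF nb, unfolded case_prod_beta], of UNIV j j]
      flip_strip_cont[OF V_cont, of UNIV j j]
    unfolding u_def ux_def ut_def case_prod_beta
    by (auto intro!: sub continuous_intros on_strip c\<psi>)
  have u_part: "has_partials_on (u j) (ux j) (ut j) ({0..1} \<times> {\<tau>..})" for j
  proof (rule has_partials_on_TimesI)
    fix x t :: real assume x: "x \<in> {0..1}" and t: "t \<in> {\<tau>..}"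
    have "((\<lambda>y. v j (flip m j y) t) has_real_derivative V j (flip m j x) t * orient j) (at x within {0..1})"
    proof -
      have "(flip m j has_real_derivative orient j) (at x within {0..1})"
        unfolding flip_def[abs_def] orient_def by (auto intro!: derivative_eq_intros)
      moreover have "flip m j ` {0..1} \<subseteq> {0..1}" by (intro image_subsetI flip_range)
      then have "((\<lambda>y. v j y t) has_real_derivative V j (flip m j x) t) (at (flip m j x) within flip m j ` {0..1})"
        unfolding V_def by (rule DERIV_subset[OF dv[OF flip_range[OF x]]])
      ultimately show ?thesis
        using DERIV_image_chain[of "\<lambda>y. v j y t" _ "flip m j" x "{0..1}"] by (simp add: o_def)
    qed
    then show "((\<lambda>y. u j (y, t)) has_real_derivative ux j (x, t)) (at x within {0..1})"
      unfolding u_def ux_def prod.case by (intro DERIV_add dw_x x)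
    have "(v j (flip m j x) has_real_derivative vt j (flip m j x) t) (at t within {\<tau>..})"
      by (rule has_field_derivative_at_within[OF null_beforeD(3)[OF nb flip_range[OF x]]])
    then show "((\<lambda>s. u j (x, s)) has_real_derivative ut j (x, t)) (at t within {\<tau>..})"
      unfolding u_def ut_def prod.case by (intro DERIV_add dw)
  qed
  \<comment> \<open>The data and their first derivatives vanish at both ends, hence so does \<psi>.
    The approximation \<open>w\<close> contributes nothing to the boundary conditions, which thus
    concern the remainder alone.\<close>
  have ends: "\<phi> j 0 = 0" "\<phi> j 1 = 0" "\<psi> j 0 = 0" "\<psi> j 1 = 0" for j
    using test_function_boundary[OF \<phi>] test_function_boundary[OF \<phi>1] by (simp_all add: \<psi>_def)
  \<comment> \<open>In reflected coordinates every outgoing trace is the value at 1, so the two sums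
    in the boundary condition merge into one.\<close>
  have outflow: "boundary_rhs m p u j t = (\<Sum>k\<in>UNIV. p j k * v k 1 t)" for j t
  proof -
    have "(\<Sum>k\<in>UNIV. p j k * v k 1 t) = (\<Sum>k\<in>{k. pos k \<le> m} \<union> {k. pos k > m}. p j k * v k 1 t)"
      by (rule sum.cong) auto
    also have "\<dots> = (\<Sum>k | pos k \<le> m. p j k * v k 1 t) + (\<Sum>k | pos k > m. p j k * v k 1 t)"
      by (rule sum.union_disjoint) auto
    finally show ?thesis
      by (simp add: boundary_rhs_def u_def w_def ends flip_def)
  qed
  have "solution \<tau> (\<lambda>_ _. 0) u"
    unfolding solution_def
  proof (intro conjI allI impI)
    show "u j \<in> C1_on (closure (half_strip \<tau>))" for j
      unfolding C1_on_def closure_half_strip using u_cont u_part by blast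
    show "u j (0, t) = boundary_rhs m p u j t" if "pos j \<le> m" for j t
      unfolding outflow using that bc by (simp add: u_def w_def ends flip_def H.inflow_def)
    show "u j (1, t) = boundary_rhs m p u j t" if "m < pos j" for j t
      unfolding outflow using that bc by (simp add: u_def w_def ends flip_def H.inflow_def)
    show "\<forall>(x, t)\<in>half_strip \<tau>. deriv (\<lambda>s. u j (x, s)) t + a j (x, t) * deriv (\<lambda>y. u j (y, t)) x +
        (\<Sum>k\<in>UNIV. b j k (x, t) * u k (x, t)) = 0" for j
    proof clarify
      fix x t assume "(x, t) \<in> half_strip \<tau>"
      then have xt: "0 < x" "x < 1" "\<tau> < t" by (auto simp: half_strip_def)
      have x: "x \<in> {0..1}" using xt by simp
      define s where "s = (\<Sum>k\<in>UNIV. b j k (x, t) * v k (flip m k x) t)"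
      have sl: "a j (x, t) * (orient j * slowness j (flip m j x) t) = 1"
        using a_nonzero[OF x] by (simp add: slowness_def orient_def)
      \<comment> \<open>For t > \<tau> the source is switched on, so all terms of the reflected
        x-derivative share the factor \<open>slowness\<close>. Multiplying by the speed cancels it
        and leaves minus the residual of \<open>w\<close>, which balances the residual in the
        equation.\<close>
      have "V j (flip m j x) t = - (slowness j (flip m j x) t * (r j x t + s + vt j (flip m j x) t))"
        using xt by (simp add: V_def K_def \<kappa>_def H.coupling_def exchange_def s_def sum_distrib_left algebra_simps)
      then have "a j (x, t) * (V j (flip m j x) t * orient j)
          = - (a j (x, t) * (orient j * slowness j (flip m j x) t)) * (r j x t + s + vt j (flip m j x) t)"
        by simp
      also have "\<dots> = - (r j x t + s + vt j (flip m j x) t)" unfolding sl by simp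
      finally have aV: "a j (x, t) * (V j (flip m j x) t * orient j) = - (r j x t + s + vt j (flip m j x) t)" .
      have "(\<Sum>k\<in>UNIV. b j k (x, t) * u k (x, t)) = (\<Sum>k\<in>UNIV. b j k (x, t) * w k x t) + s"
        by (simp add: u_def s_def distrib_left sum.distrib)
      moreover have "a j (x, t) * ux j (x, t) = a j (x, t) * wx j x t - (r j x t + s + vt j (flip m j x) t)"
        using aV by (simp add: ux_def distrib_left)
      moreover have "ut j (x, t) = cos (t - \<tau>) * \<psi> j x + vt j (flip m j x) t" by (simp add: ut_def)
      moreover have "r j x t = cos (t - \<tau>) * \<psi> j x + a j (x, t) * wx j x t + (\<Sum>k\<in>UNIV. b j k (x, t) * w k x t)"
        by (rule r_def)
      ultimately show "deriv (\<lambda>s. u j (x, s)) t + a j (x, t) * deriv (\<lambda>y. u j (y, t)) x +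
        (\<Sum>k\<in>UNIV. b j k (x, t) * u k (x, t)) = 0"
        unfolding interior_derivs(3,4)[OF u_part xt] by linarith
    qed
  qed
  moreover have "u j (x, \<tau>) = \<phi> j x" if "x \<in> {0..1}" for j x
    using null_beforeD(4)[OF nb flip_range[OF that] order_refl] by (simp add: u_def w_def)
  ultimately have "classical_solution m p a b \<tau> \<phi> u"
    unfolding classical_solution_iff by blast
  then show ?thesis by blast
qed

section \<open>Superposition and uniqueness\<close>

lemma solution_lincomb:
  assumes "solution \<tau> r u" "solution \<tau> r' v"
  shows "solution \<tau> (\<lambda>j z. r j z + c * r' j z) (\<lambda>j z. u j z + c * v j z)"
proof -
  obtain ux ut where u: "\<And>j. has_partials_on (u j) (ux j) (ut j) ({0..1} \<times> {\<tau>..})"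
    "\<And>j. continuous_on ({0..1} \<times> {\<tau>..}) (u j)"
    "\<And>j. continuous_on ({0..1} \<times> {\<tau>..}) (ux j)" "\<And>j. continuous_on ({0..1} \<times> {\<tau>..}) (ut j)"
    using solution_partials[OF assms(1)] by metis
  obtain vx vt where v: "\<And>j. has_partials_on (v j) (vx j) (vt j) ({0..1} \<times> {\<tau>..})"
    "\<And>j. continuous_on ({0..1} \<times> {\<tau>..}) (v j)"
    "\<And>j. continuous_on ({0..1} \<times> {\<tau>..}) (vx j)" "\<And>j. continuous_on ({0..1} \<times> {\<tau>..}) (vt j)"
    using solution_partials[OF assms(2)] by metis
  have P: "has_partials_on (\<lambda>z. u j z + c * v j z) (\<lambda>z. ux j z + c * vx j z) (\<lambda>z. ut j z + c * vt j z)
      ({0..1} \<times> {\<tau>..})" for j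
    by (intro has_partials_on_TimesI DERIV_add DERIV_cmult has_partials_on_Times[OF u(1)]
        has_partials_on_Times[OF v(1)])
  show ?thesis
    unfolding solution_def
  proof (intro conjI allI impI)
    show "(\<lambda>z. u j z + c * v j z) \<in> C1_on (closure (half_strip \<tau>))" for j
      unfolding C1_on_def closure_half_strip mem_Collect_eq
      by (intro conjI exI[of _ "\<lambda>z. ux j z + c * vx j z"] exI[of _ "\<lambda>z. ut j z + c * vt j z"] P
          continuous_intros u v)
    have rhs: "boundary_rhs m p (\<lambda>j z. u j z + c * v j z) j t = boundary_rhs m p u j t + c * boundary_rhs m p v j t" for j t
      by (simp add: boundary_rhs_def algebra_simps sum.distrib sum_distrib_left)
    show "u j (0, t) + c * v j (0, t) = boundary_rhs m p (\<lambda>j z. u j z + c * v j z) j t" if "\<tau> \<le> t" "pos j \<le> m" for j t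
      using assms that by (simp add: rhs solution_def)
    show "u j (1, t) + c * v j (1, t) = boundary_rhs m p (\<lambda>j z. u j z + c * v j z) j t" if "\<tau> \<le> t" "m < pos j" for j t
      using assms that by (simp add: rhs solution_def)
    show "\<forall>(x, t)\<in>half_strip \<tau>. deriv (\<lambda>s. u j (x, s) + c * v j (x, s)) t
        + a j (x, t) * deriv (\<lambda>y. u j (y, t) + c * v j (y, t)) x
        + (\<Sum>k\<in>UNIV. b j k (x, t) * (u k (x, t) + c * v k (x, t))) = r j (x, t) + c * r' j (x, t)" for j
    proof clarify
      fix x t assume xt': "(x, t) \<in> half_strip \<tau>"
      then have xt: "0 < x" "x < 1" "\<tau> < t" by (auto simp: half_strip_def)
      have 1: "deriv (\<lambda>s. u j (x, s)) t + a j (x, t) * deriv (\<lambda>y. u j (y, t)) x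
          + (\<Sum>k\<in>UNIV. b j k (x, t) * u k (x, t)) = r j (x, t)"
        "deriv (\<lambda>s. v j (x, s)) t + a j (x, t) * deriv (\<lambda>y. v j (y, t)) x
          + (\<Sum>k\<in>UNIV. b j k (x, t) * v k (x, t)) = r' j (x, t)"
        using assms xt' unfolding solution_def by blast+
      have 2: "(\<Sum>k\<in>UNIV. b j k (x, t) * (u k (x, t) + c * v k (x, t)))
          = (\<Sum>k\<in>UNIV. b j k (x, t) * u k (x, t)) + c * (\<Sum>k\<in>UNIV. b j k (x, t) * v k (x, t))"
        by (simp add: algebra_simps sum.distrib sum_distrib_left)
      show "deriv (\<lambda>s. u j (x, s) + c * v j (x, s)) t
        + a j (x, t) * deriv (\<lambda>y. u j (y, t) + c * v j (y, t)) x
        + (\<Sum>k\<in>UNIV. b j k (x, t) * (u k (x, t) + c * v k (x, t))) = r j (x, t) + c * r' j (x, t)"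
        unfolding 2 1[symmetric] interior_derivs(3,4)[OF P xt] interior_derivs(3,4)[OF u(1) xt] interior_derivs(3,4)[OF v(1) xt]
        by (simp add: algebra_simps)
    qed
  qed
qed

lemma solution_diff:
  assumes "solution \<tau> r u" "solution \<tau> r' v"
  shows "solution \<tau> (\<lambda>j z. r j z - r' j z) (\<lambda>j z. u j z - v j z)"
  using solution_lincomb[OF assms, of "- 1"] by simp

lemma state_lincomb:
  assumes "\<And>j. continuous_on {0..1} (\<lambda>x. u j (x, t))" "\<And>j. continuous_on {0..1} (\<lambda>x. v j (x, t))"
  shows "state (\<lambda>j z. u j z + c * v j z) t = state u t + c *\<^sub>R state v t"
proof -
  have "L2_class (\<lambda>x. u j (x, t) + c * v j (x, t))
      = L2_class (\<lambda>x. u j (x, t)) + c *\<^sub>R L2_class (\<lambda>x. v j (x, t))" for j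
    using square_integrable_continuous[OF assms(1)] square_integrable_continuous[OF assms(2)]
    by (simp add: L2_class_add L2_class_scale square_integrable_scale)
  then show ?thesis
    by (simp add: component_inject[symmetric] plus_max_pow.rep_eq scaleR_max_pow.rep_eq)
qed

lemma state_diff:
  assumes "\<And>j. continuous_on {0..1} (\<lambda>x. u j (x, t))" "\<And>j. continuous_on {0..1} (\<lambda>x. v j (x, t))"
  shows "state (\<lambda>j z. u j z - v j z) t = state u t - state v t"
  using state_lincomb[OF assms, where c = "- 1"] by simp

lemma solutions_diff_estimate:
  assumes "solution \<tau> (\<lambda>_ _. 0) u" "solution \<tau> (\<lambda>_ _. 0) v" "\<tau> \<le> t"
  shows "norm (state u t - state v t) \<le> amplif * exp (growth * (t - \<tau>)) * norm (state u \<tau> - state v \<tau>)"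
proof -
  have "solution \<tau> (\<lambda>_ _. 0) (\<lambda>j z. u j z - v j z)" using solution_diff[OF assms(1,2)] by simp
  from energy_estimate[OF this, of 0 t] assms(3)
  have "norm (state (\<lambda>j z. u j z - v j z) t)
      \<le> amplif * exp (growth * (t - \<tau>)) * norm (state (\<lambda>j z. u j z - v j z) \<tau>)" by simp
  moreover have "state (\<lambda>j z. u j z - v j z) s = state u s - state v s" if "\<tau> \<le> s" for s
    by (intro state_diff solution_slice_cont[OF assms(1) that] solution_slice_cont[OF assms(2) that])
  ultimately show ?thesis using assms(3) by simp
qed

text \<open>The energy of the difference stays zero. Since its integrand is continuous and
  nonnegative and the weight is at least 1, this L2 statement becomes a pointwise one that includes
  the boundary.\<close>

lemma classical_solution_unique:
  assumes u: "classical_solution m p a b \<tau> \<phi> u" and v: "classical_solution m p a b \<tau> \<phi> v"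
    and "z \<in> closure (half_strip \<tau>)"
  shows "v j z = u j z"
proof -
  obtain x t where z: "z = (x, t)" "x \<in> {0..1}" "\<tau> \<le> t"
    using assms(3) by (auto simp: closure_half_strip)
  have us: "solution \<tau> (\<lambda>_ _. 0) u" and vs: "solution \<tau> (\<lambda>_ _. 0) v"
    using u v by (simp_all add: classical_solution_iff)
  let ?d = "\<lambda>j z. u j z - v j z"
  have ds: "solution \<tau> (\<lambda>_ _. 0) ?d" using solution_diff[OF us vs] by simp
  have "energy ?d t \<le> exp (growth * (t - \<tau>)) * energy ?d \<tau>"
    using energy_growth[OF ds, of 0 t] z by simp
  also have "energy ?d \<tau> = (\<Sum>j\<in>(UNIV :: 'n set). integral {0..1::real} (\<lambda>x. 0))"
    unfolding energy_def
  proof (intro sum.cong refl Henstock_Kurzweil_Integration.integral_cong)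
    fix j :: 'n and x :: real assume "x \<in> {0..1}"
    then show "weight j x * (u j (x, \<tau>) - v j (x, \<tau>))\<^sup>2 = 0"
      using u v by (simp add: classical_solution_iff)
  qed
  finally have le0: "energy ?d t \<le> 0" by simp
  have c: "continuous_on {0..1} (\<lambda>x. weight j x * (?d j (x, t))\<^sup>2)" for j
    by (intro continuous_intros weight_cont solution_slice_cont[OF us] solution_slice_cont[OF vs] z)
  have nn: "0 \<le> weight j x * (?d j (x, t))\<^sup>2" if "x \<in> {0..1}" for j x
    using weight_bounds(1)[OF that, of j] by simp
  have i0: "0 \<le> integral {0..1} (\<lambda>x. weight j x * (?d j (x, t))\<^sup>2)" for j
    using nn by (intro integral_nonneg integrable_continuous_real c)
  have "integral {0..1} (\<lambda>x. weight j x * (?d j (x, t))\<^sup>2) \<le> energy ?d t"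
    unfolding energy_def by (rule member_le_sum) (use i0 in auto)
  then have "integral {0..1} (\<lambda>x. weight j x * (?d j (x, t))\<^sup>2) = 0" using le0 i0[of j] by simp
  then have "\<forall>x\<in>{0..1}. weight j x * (?d j (x, t))\<^sup>2 = 0"
    by (subst (asm) integral_eq_0_iff) (use c nn in auto)
  then have "weight j x * (?d j (x, t))\<^sup>2 = 0" using z by blast
  then show ?thesis using weight_bounds(1)[OF z(2), of j] z by simp
qed

end

section \<open>The evolution family\<close>

lemma norm_max_pow_le_sum: "norm u \<le> (\<Sum>j\<in>UNIV. norm (component u j))"
  unfolding norm_max_pow_le_iff by (intro allI member_le_sum) auto

lemma tendsto_max_pow:
  fixes X :: "'s \<Rightarrow> ('x::real_normed_vector, 'n::finite) max_pow"
  assumes "\<And>j. ((\<lambda>s. component (X s) j) \<longlongrightarrow> component \<phi> j) F"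
  shows "(X \<longlongrightarrow> \<phi>) F"
proof (rule LIM_zero_cancel, rule Lim_null_comparison)
  show "\<forall>\<^sub>F s in F. norm (X s - \<phi>) \<le> (\<Sum>j\<in>UNIV. norm (component (X s) j - component \<phi> j))"
    using norm_max_pow_le_sum[of "X _ - \<phi>"] by (simp add: minus_max_pow.rep_eq)
  have lim: "((\<lambda>s. norm (component (X s) j - component \<phi> j)) \<longlongrightarrow> 0) F" for j
    using assms[of j] by (simp add: tendsto_norm_zero LIM_zero)
  have "((\<lambda>s. \<Sum>j\<in>UNIV. norm (component (X s) j - component \<phi> j)) \<longlongrightarrow> (\<Sum>j\<in>(UNIV :: 'n set). 0)) F"
    by (intro tendsto_sum lim)
  then show "((\<lambda>s. \<Sum>j\<in>UNIV. norm (component (X s) j - component \<phi> j)) \<longlongrightarrow> 0) F" by simp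
qed

lemma approximating_data_exists: "\<exists>\<psi>. approximating_data \<phi> \<psi>"
proof -
  have "\<forall>j. \<exists>f. (\<forall>l::nat. f l \<in> test_functions) \<and> (\<lambda>l. L2_class (f l)) \<longlonglongrightarrow> component \<phi> j"
    using test_closure_iff test_closure_UNIV by blast
  then obtain f where f: "\<And>j l. f j l \<in> test_functions" "\<And>j. (\<lambda>l. L2_class (f j l)) \<longlonglongrightarrow> component \<phi> j"
    by metis
  have "(\<lambda>l. L2_vec (\<lambda>j. f j l)) \<longlonglongrightarrow> \<phi>"
    by (rule tendsto_max_pow) (simp add: Max_Pow_inverse f)
  then show ?thesis
    using f(1) unfolding approximating_data_def by (intro exI[of _ "\<lambda>l j. f j l"]) auto
qed

context ibvp
begin

lemma state_initial:
  assumes "classical_solution m p a b \<tau> \<phi> w" "\<And>j. \<phi> j \<in> test_functions"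
  shows "state w \<tau> = L2_vec \<phi>"
proof -
  have w: "solution \<tau> (\<lambda>_ _. 0) w" and eq: "\<And>j x. x \<in> {0..1} \<Longrightarrow> w j (x, \<tau>) = \<phi> j x"
    using assms(1) by (simp_all add: classical_solution_iff)
  have "L2_class (\<lambda>x. w j (x, \<tau>)) = L2_class (\<phi> j)" for j
    using eq square_integrable_continuous[OF solution_slice_cont[OF w order_refl]]
      test_function_square_integrable[OF assms(2)]
    by (subst L2_class_eq_iff) (auto intro!: AE_I2)
  then show ?thesis by simp
qed

lemma approximating_solutions:
  obtains \<psi> v where "approximating_data \<phi> \<psi>" "\<And>l. classical_solution m p a b \<tau> (\<psi> l) (v l)"
    "\<And>l. solution \<tau> (\<lambda>_ _. 0) (v l)" "(\<lambda>l. state (v l) \<tau>) \<longlonglongrightarrow> \<phi>"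
proof -
  obtain \<psi> where \<psi>: "approximating_data \<phi> \<psi>" using approximating_data_exists by blast
  then have "\<forall>l. \<exists>u. classical_solution m p a b \<tau> (\<psi> l) u"
    by (simp add: approximating_data_def classical_solution_exists)
  then obtain v where v: "\<And>l. classical_solution m p a b \<tau> (\<psi> l) (v l)" by metis
  show ?thesis
  proof (rule that[OF \<psi> v])
    show "solution \<tau> (\<lambda>_ _. 0) (v l)" for l using v[of l] by (simp add: classical_solution_iff)
    have "state (v l) \<tau> = L2_vec (\<psi> l)" for l
      using state_initial[OF v] \<psi> by (simp add: approximating_data_def)
    then show "(\<lambda>l. state (v l) \<tau>) \<longlonglongrightarrow> \<phi>" using \<psi> by (simp add: approximating_data_def)
  qed
qed

section \<open>Extension of the solution operators to L2\<close>

definition "gain h = amplif * exp (growth * h)"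

lemma gain_pos: "0 < gain h"
  using amplif_ge by (simp add: gain_def)

lemma gain_mono: "h \<le> h' \<Longrightarrow> gain h \<le> gain h'"
  using amplif_ge growth_pos by (simp add: gain_def)

text \<open>The energy estimate is stable under \<open>L\<^sup>2\<close>-limits and hence determines the value of the
  evolution at every \<open>\<phi>\<close>.\<close>

definition evolved :: "real \<Rightarrow> real \<Rightarrow> (L2, 'n) max_pow \<Rightarrow> (L2, 'n) max_pow"
  where "evolved t \<tau> \<phi> = (SOME \<Phi>. \<forall>w. solution \<tau> (\<lambda>_ _. 0) w \<longrightarrow>
    norm (state w t - \<Phi>) \<le> gain (t - \<tau>) * norm (state w \<tau> - \<phi>))"

text \<open>What has to be shown is that an admissible \<Phi> exists. States at time t of
  approximating solutions form a Cauchy sequence by the energy estimate for differences, and its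
  limit inherits the estimate against every solution \<open>w\<close>.\<close>

lemma evolved_estimate:
  assumes "solution \<tau> (\<lambda>_ _. 0) w" and t: "\<tau> \<le> t"
  shows "norm (state w t - evolved t \<tau> \<phi>) \<le> gain (t - \<tau>) * norm (state w \<tau> - \<phi>)"
proof -
  obtain v where v: "\<And>l. solution \<tau> (\<lambda>_ _. 0) (v l)" "(\<lambda>l::nat. state (v l) \<tau>) \<longlonglongrightarrow> \<phi>"
    using approximating_solutions[of \<phi> \<tau>] by metis
  have est: "norm (state w t - state (v l) t) \<le> gain (t - \<tau>) * norm (state w \<tau> - state (v l) \<tau>)"
    if "solution \<tau> (\<lambda>_ _. 0) w" for w l
    unfolding gain_def by (rule solutions_diff_estimate[OF that v(1) t])
  have "Cauchy (\<lambda>l. state (v l) t)"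
  proof (rule CauchyI)
    fix e :: real assume "0 < e"
    then have "0 < e / gain (t - \<tau>)" using gain_pos by simp
    moreover have "Cauchy (\<lambda>l. state (v l) \<tau>)" using v(2) by (rule LIMSEQ_imp_Cauchy)
    ultimately obtain N where N: "\<And>k l. N \<le> k \<Longrightarrow> N \<le> l \<Longrightarrow>
        norm (state (v k) \<tau> - state (v l) \<tau>) < e / gain (t - \<tau>)"
      by (meson CauchyD)
    have "norm (state (v k) t - state (v l) t) < e" if "N \<le> k" "N \<le> l" for k l
      using est[OF v(1), of k l] N[OF that] gain_pos[of "t - \<tau>"]
      by (simp add: pos_less_divide_eq mult.commute)
    then show "\<exists>N. \<forall>k\<ge>N. \<forall>l\<ge>N. norm (state (v k) t - state (v l) t) < e" by blast
  qed
  then obtain \<Phi> where \<Phi>: "(\<lambda>l. state (v l) t) \<longlonglongrightarrow> \<Phi>"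
    using Cauchy_convergent convergent_def by blast
  have "norm (state w t - \<Phi>) \<le> gain (t - \<tau>) * norm (state w \<tau> - \<phi>)"
    if w: "solution \<tau> (\<lambda>_ _. 0) w" for w
  proof (rule LIMSEQ_le)
    show "(\<lambda>l. norm (state w t - state (v l) t)) \<longlonglongrightarrow> norm (state w t - \<Phi>)"
      by (intro tendsto_intros \<Phi>)
    show "(\<lambda>l. gain (t - \<tau>) * norm (state w \<tau> - state (v l) \<tau>)) \<longlonglongrightarrow> gain (t - \<tau>) * norm (state w \<tau> - \<phi>)"
      by (intro tendsto_intros v(2))
  qed (use est[OF w] in blast)
  then have "\<forall>w. solution \<tau> (\<lambda>_ _. 0) w \<longrightarrow>
      norm (state w t - evolved t \<tau> \<phi>) \<le> gain (t - \<tau>) * norm (state w \<tau> - \<phi>)"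
    unfolding evolved_def by (intro someI[of "\<lambda>\<Phi>. \<forall>w. solution \<tau> (\<lambda>_ _. 0) w \<longrightarrow>
      norm (state w t - \<Phi>) \<le> gain (t - \<tau>) * norm (state w \<tau> - \<phi>)"]) blast
  then show ?thesis using assms(1) by blast
qed

lemma evolved_solution:
  assumes "solution \<tau> (\<lambda>_ _. 0) w" "\<tau> \<le> t"
  shows "evolved t \<tau> (state w \<tau>) = state w t"
  using evolved_estimate[OF assms, of "state w \<tau>"] by simp

lemma evolved_tendsto:
  assumes "\<And>l. solution \<tau> (\<lambda>_ _. 0) (v l)" "(\<lambda>l::nat. state (v l) \<tau>) \<longlonglongrightarrow> \<phi>" "\<tau> \<le> t"
  shows "(\<lambda>l. state (v l) t) \<longlonglongrightarrow> evolved t \<tau> \<phi>"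
proof (rule LIM_zero_cancel, rule Lim_null_comparison)
  show "\<forall>\<^sub>F l in sequentially. norm (state (v l) t - evolved t \<tau> \<phi>) \<le> gain (t - \<tau>) * norm (state (v l) \<tau> - \<phi>)"
    by (intro always_eventually allI evolved_estimate assms)
  have "(\<lambda>l. gain (t - \<tau>) * norm (state (v l) \<tau> - \<phi>)) \<longlonglongrightarrow> gain (t - \<tau>) * norm (\<phi> - \<phi>)"
    by (intro tendsto_intros assms)
  then show "(\<lambda>l. gain (t - \<tau>) * norm (state (v l) \<tau> - \<phi>)) \<longlonglongrightarrow> 0" by simp
qed

lemma evolved_lincomb:
  assumes t: "\<tau> \<le> t"
  shows "evolved t \<tau> (\<phi> + c *\<^sub>R \<zeta>) = evolved t \<tau> \<phi> + c *\<^sub>R evolved t \<tau> \<zeta>"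
proof -
  obtain v where v: "\<And>l. solution \<tau> (\<lambda>_ _. 0) (v l)" "(\<lambda>l::nat. state (v l) \<tau>) \<longlonglongrightarrow> \<phi>"
    using approximating_solutions[of \<phi> \<tau>] by metis
  obtain w where w: "\<And>l. solution \<tau> (\<lambda>_ _. 0) (w l)" "(\<lambda>l::nat. state (w l) \<tau>) \<longlonglongrightarrow> \<zeta>"
    using approximating_solutions[of \<zeta> \<tau>] by metis
  define z where "z l = (\<lambda>j y. v l j y + c * w l j y)" for l
  have z: "solution \<tau> (\<lambda>_ _. 0) (z l)" for l
    using solution_lincomb[OF v(1)[of l] w(1)[of l], of c] by (simp add: z_def)
  have st: "state (z l) s = state (v l) s + c *\<^sub>R state (w l) s" if "\<tau> \<le> s" for l s
    unfolding z_def
    by (intro state_lincomb solution_slice_cont[OF v(1) that] solution_slice_cont[OF w(1) that])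
  have "(\<lambda>l. state (z l) \<tau>) \<longlonglongrightarrow> \<phi> + c *\<^sub>R \<zeta>"
    unfolding st[OF order_refl] by (intro tendsto_intros v w)
  then have "(\<lambda>l. state (z l) t) \<longlonglongrightarrow> evolved t \<tau> (\<phi> + c *\<^sub>R \<zeta>)"
    by (rule evolved_tendsto[OF z _ t])
  moreover have "(\<lambda>l. state (z l) t) \<longlonglongrightarrow> evolved t \<tau> \<phi> + c *\<^sub>R evolved t \<tau> \<zeta>"
    unfolding st[OF t] by (intro tendsto_intros evolved_tendsto[OF v t] evolved_tendsto[OF w t])
  ultimately show ?thesis by (rule LIMSEQ_unique)
qed

lemma evolved_norm:
  assumes t: "\<tau> \<le> t"
  shows "norm (evolved t \<tau> \<phi>) \<le> gain (t - \<tau>) * norm \<phi>"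
proof -
  obtain v where v: "\<And>l. solution \<tau> (\<lambda>_ _. 0) (v l)" "(\<lambda>l::nat. state (v l) \<tau>) \<longlonglongrightarrow> \<phi>"
    using approximating_solutions[of \<phi> \<tau>] by metis
  show ?thesis
  proof (rule LIMSEQ_le)
    show "(\<lambda>l. norm (state (v l) t)) \<longlonglongrightarrow> norm (evolved t \<tau> \<phi>)"
      by (intro tendsto_intros evolved_tendsto[OF v t])
    show "(\<lambda>l. gain (t - \<tau>) * norm (state (v l) \<tau>)) \<longlonglongrightarrow> gain (t - \<tau>) * norm \<phi>"
      by (intro tendsto_intros v)
    have "norm (state (v l) t) \<le> gain (t - \<tau>) * norm (state (v l) \<tau>)" for l
      using energy_estimate[OF v(1), of 0 t l] t by (simp add: gain_def)
    then show "\<exists>N. \<forall>l\<ge>N. norm (state (v l) t) \<le> gain (t - \<tau>) * norm (state (v l) \<tau>)" by blast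
  qed
qed

lemma bounded_linear_evolved:
  assumes t: "\<tau> \<le> t"
  shows "bounded_linear (evolved t \<tau>)"
proof (rule bounded_linear_intro)
  have zero: "evolved t \<tau> 0 = 0"
    using evolved_norm[OF t, of 0] by simp
  show "evolved t \<tau> (\<phi> + \<zeta>) = evolved t \<tau> \<phi> + evolved t \<tau> \<zeta>" for \<phi> \<zeta>
    using evolved_lincomb[OF t, of \<phi> 1 \<zeta>] by simp
  show "evolved t \<tau> (c *\<^sub>R \<phi>) = c *\<^sub>R evolved t \<tau> \<phi>" for c \<phi>
    using evolved_lincomb[OF t, of 0 c \<phi>] by (simp add: zero)
  show "norm (evolved t \<tau> \<phi>) \<le> norm \<phi> * gain (t - \<tau>)" for \<phi>
    using evolved_norm[OF t] by (simp add: mult.commute)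
qed

text \<open>For t < \<tau> the value is a placeholder; \<open>Blinfun\<close> is applied only where
  \<open>evolved\<close> is known to be bounded and linear.\<close>

definition evolution :: "real \<Rightarrow> real \<Rightarrow> ((L2, 'n) max_pow \<Rightarrow>\<^sub>L (L2, 'n) max_pow)"
  where "evolution t \<tau> = (if \<tau> \<le> t then Blinfun (evolved t \<tau>) else 0)"

lemma evolution_apply: "\<tau> \<le> t \<Longrightarrow> blinfun_apply (evolution t \<tau>) \<phi> = evolved t \<tau> \<phi>"
  by (simp add: evolution_def bounded_linear_Blinfun_apply bounded_linear_evolved)

lemma evolution_norm:
  assumes "\<tau> \<le> t"
  shows "norm (evolution t \<tau>) \<le> gain (t - \<tau>)"
  using evolved_norm[OF assms] gain_pos[of "t - \<tau>"]
  by (intro norm_blinfun_bound) (auto simp: evolution_apply[OF assms])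

lemma evolution_refl: "evolution \<tau> \<tau> = id_blinfun"
proof (rule blinfun_eqI)
  fix \<phi>
  obtain v where v: "\<And>l. solution \<tau> (\<lambda>_ _. 0) (v l)" "(\<lambda>l::nat. state (v l) \<tau>) \<longlonglongrightarrow> \<phi>"
    using approximating_solutions[of \<phi> \<tau>] by metis
  have "evolved \<tau> \<tau> \<phi> = \<phi>"
    using evolved_tendsto[OF v order_refl] v(2) by (rule LIMSEQ_unique)
  then show "blinfun_apply (evolution \<tau> \<tau>) \<phi> = blinfun_apply id_blinfun \<phi>"
    by (simp add: evolution_apply)
qed

lemma solution_restrict:
  assumes "solution \<tau> r w" "\<tau> \<le> s"
  shows "solution s r w"
proof -
  obtain ux ut where u: "\<And>j. has_partials_on (w j) (ux j) (ut j) ({0..1} \<times> {\<tau>..})"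
    "\<And>j. continuous_on ({0..1} \<times> {\<tau>..}) (w j)"
    "\<And>j. continuous_on ({0..1} \<times> {\<tau>..}) (ux j)" "\<And>j. continuous_on ({0..1} \<times> {\<tau>..}) (ut j)"
    using solution_partials[OF assms(1)] by metis
  have sub: "{0..1} \<times> {s..} \<subseteq> {0..1::real} \<times> {\<tau>..}" "{s..} \<subseteq> {\<tau>..}" using assms(2) by auto
  have P: "has_partials_on (w j) (ux j) (ut j) ({0..1} \<times> {s..})" for j
  proof (rule has_partials_on_TimesI)
    fix x t :: real assume x: "x \<in> {0..1}" "t \<in> {s..}"
    then have t: "t \<in> {\<tau>..}" using assms(2) by auto
    show "((\<lambda>y. w j (y, t)) has_real_derivative ux j (x, t)) (at x within {0..1})"
      by (rule has_partials_on_Times(1)[OF u(1) x(1) t])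
    show "((\<lambda>s. w j (x, s)) has_real_derivative ut j (x, t)) (at t within {s..})"
      by (rule DERIV_subset[OF has_partials_on_Times(2)[OF u(1) x(1) t] sub(2)])
  qed
  show ?thesis
    unfolding solution_def
  proof (intro conjI allI impI)
    show "w j \<in> C1_on (closure (half_strip s))" for j
      unfolding C1_on_def closure_half_strip mem_Collect_eq
      by (intro conjI exI[of _ "ux j"] exI[of _ "ut j"] P continuous_on_subset[OF u(2) sub(1)]
          continuous_on_subset[OF u(3) sub(1)] continuous_on_subset[OF u(4) sub(1)])
    have "half_strip s \<subseteq> half_strip \<tau>" using assms(2) by (auto simp: half_strip_def)
    then show "\<forall>(x, t)\<in>half_strip s. deriv (\<lambda>s. w j (x, s)) t + a j (x, t) * deriv (\<lambda>y. w j (y, t)) x +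
       (\<Sum>k\<in>UNIV. b j k (x, t) * w k (x, t)) = r j (x, t)" for j
      using assms(1) unfolding solution_def by blast
    show "w j (0, t) = boundary_rhs m p w j t" if "s \<le> t" "pos j \<le> m" for j t
      using assms that unfolding solution_def by simp
    show "w j (1, t) = boundary_rhs m p w j t" if "s \<le> t" "m < pos j" for j t
      using assms that unfolding solution_def by simp
  qed
qed

text \<open>The approximating solutions are restarted at \<open>s\<close>. Their states there are in
  general not test data, which is why \<open>evolved_tendsto\<close> accepts arbitrary solutions
  with converging initial states.\<close>

lemma evolution_compose:
  assumes "\<tau> \<le> s" "s \<le> t"
  shows "evolution t s o\<^sub>L evolution s \<tau> = evolution t \<tau>"
proof (rule blinfun_eqI)
  fix \<phi>
  obtain v where v: "\<And>l. solution \<tau> (\<lambda>_ _. 0) (v l)" "(\<lambda>l::nat. state (v l) \<tau>) \<longlonglongrightarrow> \<phi>"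
    using approximating_solutions[of \<phi> \<tau>] by metis
  have "evolved t s (evolved s \<tau> \<phi>) = evolved t \<tau> \<phi>"
    using evolved_tendsto[OF solution_restrict[OF v(1) assms(1)] evolved_tendsto[OF v assms(1)] assms(2)]
      evolved_tendsto[OF v order_trans[OF assms]] by (rule LIMSEQ_unique)
  then show "blinfun_apply (evolution t s o\<^sub>L evolution s \<tau>) \<phi> = blinfun_apply (evolution t \<tau>) \<phi>"
    using assms by (simp add: evolution_apply)
qed

text \<open>A test function held constant in time satisfies the boundary conditions, because it
  vanishes at both ends, and the equation up to a bounded source. It is the comparison function for
  short times.\<close>

lemma static_solution:
  assumes \<zeta>: "\<And>j. \<zeta> j \<in> test_functions"
  shows "solution \<tau> (\<lambda>j (x, t). a j (x, t) * deriv (\<zeta> j) x + (\<Sum>k\<in>UNIV. b j k (x, t) * \<zeta> k x))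
    (\<lambda>j z. \<zeta> j (fst z))"
  unfolding solution_def
proof (intro conjI allI impI)
  have P: "has_partials_on (\<lambda>z. \<zeta> j (fst z)) (\<lambda>z. deriv (\<zeta> j) (fst z)) (\<lambda>z. 0) ({0..1} \<times> {\<tau>..})" for j
    by (rule has_partials_on_TimesI)
      (auto intro: has_field_derivative_at_within[OF test_function_derivative[OF \<zeta>]])
  have c: "continuous_on ({0..1} \<times> {\<tau>..}) (\<lambda>z. h (fst z))" if "h \<in> test_functions" for h
    by (rule continuous_on_compose2[OF test_function_continuous[OF that, of UNIV]])
      (auto intro!: continuous_intros)
  show "(\<lambda>z. \<zeta> j (fst z)) \<in> C1_on (closure (half_strip \<tau>))" for j
    unfolding C1_on_def closure_half_strip mem_Collect_eq
    by (intro conjI exI[of _ "\<lambda>z. deriv (\<zeta> j) (fst z)"] exI[of _ "\<lambda>z. 0"] P c \<zeta> test_functions_deriv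
        continuous_on_const)
  show "\<forall>(x, t)\<in>half_strip \<tau>. deriv (\<lambda>s. \<zeta> j (fst (x, s))) t + a j (x, t) * deriv (\<lambda>y. \<zeta> j (fst (y, t))) x
      + (\<Sum>k\<in>UNIV. b j k (x, t) * \<zeta> k (fst (x, t)))
      = (case (x, t) of (x, t) \<Rightarrow> a j (x, t) * deriv (\<zeta> j) x + (\<Sum>k\<in>UNIV. b j k (x, t) * \<zeta> k x))" for j
    by simp
  have ends: "\<zeta> j 0 = 0" "\<zeta> j 1 = 0" for j using test_function_boundary[OF \<zeta>] by auto
  show "\<zeta> j (fst (0, t)) = boundary_rhs m p (\<lambda>j z. \<zeta> j (fst z)) j t"
    "\<zeta> j (fst (1, t)) = boundary_rhs m p (\<lambda>j z. \<zeta> j (fst z)) j t" for j t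
    by (simp_all add: boundary_rhs_def ends)
qed

lemma test_data_small_time:
  assumes \<zeta>: "\<And>j. \<zeta> j \<in> test_functions"
  obtains F where "0 \<le> F"
    "\<And>\<tau> t. \<tau> \<le> t \<Longrightarrow> norm (evolved t \<tau> (L2_vec \<zeta>) - L2_vec \<zeta>) \<le> gain (t - \<tau>) * (F * sqrt (t - \<tau>))"
proof -
  define H where "H = range \<zeta> \<union> range (\<lambda>j. deriv (\<zeta> j))"
  have "finite H" by (simp add: H_def)
  moreover have "continuous_on {0..1} h" if "h \<in> H" for h
    using that by (auto simp: H_def intro!: test_function_continuous test_functions_deriv \<zeta>)
  ultimately have "\<exists>M\<ge>0. \<forall>h\<in>H. \<forall>x\<in>{0..1}. \<bar>h x\<bar> \<le> M" by (rule bounded_family)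
  then obtain M where M0: "0 \<le> M" and MH: "\<And>h x. h \<in> H \<Longrightarrow> x \<in> {0..1} \<Longrightarrow> \<bar>h x\<bar> \<le> M"
    by blast
  define F where "F = B * M + real CARD('n) * (B * M)"
  have F0: "0 \<le> F" using B_pos M0 by (simp add: F_def)
  show ?thesis
  proof (rule that[OF F0])
    fix \<tau> t :: real assume t: "\<tau> \<le> t"
    obtain v where v: "classical_solution m p a b \<tau> \<zeta> v" using classical_solution_exists[of \<zeta> \<tau>] \<zeta> by blast
    then have vs: "solution \<tau> (\<lambda>_ _. 0) v" by (simp add: classical_solution_iff)
    let ?r = "\<lambda>j (x, t). a j (x, t) * deriv (\<zeta> j) x + (\<Sum>k\<in>UNIV. b j k (x, t) * \<zeta> k x)"
    let ?d = "\<lambda>j z. v j z - \<zeta> j (fst z)"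
    note d = solution_diff[OF vs static_solution[OF \<zeta>]]
    have st: "state ?d s = state v s - L2_vec \<zeta>" if "\<tau> \<le> s" for s
      using state_diff[of v s "\<lambda>j z. \<zeta> j (fst z)"] solution_slice_cont[OF vs that]
        test_function_continuous[OF \<zeta>] by simp
    have "norm (state ?d t) \<le> amplif * exp (growth * (t - \<tau>)) * (norm (state ?d \<tau>) + F * sqrt (t - \<tau>))"
    proof (rule energy_estimate[OF d _ F0 t])
      fix j and x s :: real assume "0 < x" "x < 1"
      then have x: "x \<in> {0..1}" by simp
      have "\<bar>\<Sum>k\<in>UNIV. b j k (x, s) * \<zeta> k x\<bar> \<le> (\<Sum>k\<in>(UNIV :: 'n set). B * M)"
      proof (rule order_trans[OF sum_abs sum_mono])
        fix k
        show "\<bar>b j k (x, s) * \<zeta> k x\<bar> \<le> B * M"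
          unfolding abs_mult using B_pos
          by (intro mult_mono b_bound x MH[of "\<zeta> k"]) (auto simp: H_def)
      qed
      moreover have "\<bar>a j (x, s) * deriv (\<zeta> j) x\<bar> \<le> B * M"
        unfolding abs_mult using B_pos
        by (intro mult_mono a_bound x MH[of "deriv (\<zeta> j)"]) (auto simp: H_def)
      ultimately show "\<bar>0 - ?r j (x, s)\<bar> \<le> F" by (simp add: F_def)
    qed
    then show "norm (evolved t \<tau> (L2_vec \<zeta>) - L2_vec \<zeta>) \<le> gain (t - \<tau>) * (F * sqrt (t - \<tau>))"
      unfolding st[OF t] st[OF order_refl] using evolved_solution[OF vs t] state_initial[OF v \<zeta>]
      by (simp add: gain_def)
  qed
qed

text \<open>The uniformity in \<tau> passes from test data to all states by approximation, since the
  operators are bounded by \<open>gain 1\<close> for elapsed times up to 1, whatever the initial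
  time.\<close>

lemma small_time:
  assumes "0 < e"
  obtains \<delta> where "0 < \<delta>" "\<And>\<tau> t. \<tau> \<le> t \<Longrightarrow> t < \<tau> + \<delta> \<Longrightarrow> norm (evolved t \<tau> \<phi> - \<phi>) < e"
proof -
  define C where "C = gain 1"
  have C: "0 < C" by (simp add: C_def gain_pos)
  obtain \<psi> where \<psi>: "approximating_data \<phi> \<psi>" using approximating_data_exists by blast
  \<comment> \<open>Replacing the state by test data costs \<eta> initially and at most C \<eta>
    after evolution; both together are to be e/2.\<close>
  define \<eta> where "\<eta> = e / (2 * (C + 1))"
  have \<eta>: "0 < \<eta>" using assms C by (simp add: \<eta>_def)
  have "\<forall>\<^sub>F l in sequentially. dist (L2_vec (\<psi> l)) \<phi> < \<eta>"
    using \<psi> \<eta> by (simp add: approximating_data_def tendstoD)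
  then obtain l where l: "dist (L2_vec (\<psi> l)) \<phi> < \<eta>"
    using eventually_happens by fastforce
  define \<zeta> where "\<zeta> = L2_vec (\<psi> l)"
  have \<zeta>: "norm (\<zeta> - \<phi>) < \<eta>" using l by (simp add: \<zeta>_def dist_norm)
  obtain F where F: "0 \<le> F"
    "\<And>\<tau> t. \<tau> \<le> t \<Longrightarrow> norm (evolved t \<tau> \<zeta> - \<zeta>) \<le> gain (t - \<tau>) * (F * sqrt (t - \<tau>))"
    using test_data_small_time[of "\<psi> l"] \<psi> unfolding \<zeta>_def approximating_data_def by metis
  \<comment> \<open>Bounds the square root of the elapsed time, so that C F q stays below e/2; hence
    the square of \<open>q\<close> in the choice of \<delta>.\<close>
  define q where "q = e / (2 * (C * F + 1))"
  have half: "D * (e / (2 * D)) = e / 2" if "0 < D" for D :: real using that by simp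
  have CF: "0 < C * F + 1" using C F(1) by (simp add: add_nonneg_pos)
  have q: "0 < q" using assms CF by (simp add: q_def)
  show ?thesis
  proof (rule that[of "min 1 (q\<^sup>2)"])
    show "0 < min 1 (q\<^sup>2)" using q by simp
    fix \<tau> t :: real assume t: "\<tau> \<le> t" "t < \<tau> + min 1 (q\<^sup>2)"
    then have h: "t - \<tau> \<le> 1" "t - \<tau> < q\<^sup>2" by auto
    have g: "gain (t - \<tau>) \<le> C" unfolding C_def by (rule gain_mono[OF h(1)])
    have "sqrt (t - \<tau>) \<le> q" using h(2) q by (intro real_le_lsqrt) auto
    then have "gain (t - \<tau>) * (F * sqrt (t - \<tau>)) \<le> C * (F * q)"
      using g F(1) C t by (intro mult_mono) auto
    also have "\<dots> < (C * F + 1) * q" using q by (simp add: algebra_simps)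
    also have "\<dots> = e / 2" unfolding q_def by (rule half[OF CF])
    finally have 1: "norm (evolved t \<tau> \<zeta> - \<zeta>) < e / 2" using F(2)[OF t(1)] by linarith
    interpret E: bounded_linear "evolved t \<tau>" by (rule bounded_linear_evolved[OF t(1)])
    have "norm (evolved t \<tau> \<phi> - evolved t \<tau> \<zeta>) \<le> C * \<eta>"
    proof -
      have "norm (evolved t \<tau> (\<phi> - \<zeta>)) \<le> gain (t - \<tau>) * norm (\<phi> - \<zeta>)" by (rule evolved_norm[OF t(1)])
      also have "\<dots> \<le> C * \<eta>" using g C \<zeta> by (intro mult_mono) (auto simp: norm_minus_commute)
      finally show ?thesis by (simp add: E.diff)
    qed
    moreover have "C * \<eta> + \<eta> = e / 2"
    proof -
      have "C * \<eta> + \<eta> = (C + 1) * \<eta>" by (simp add: distrib_right)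
      also have "\<dots> = e / 2" unfolding \<eta>_def using C by (intro half) simp
      finally show ?thesis .
    qed
    moreover have "norm (evolved t \<tau> \<phi> - \<phi>) \<le> norm (evolved t \<tau> \<phi> - evolved t \<tau> \<zeta>)
        + norm (evolved t \<tau> \<zeta> - \<zeta>) + norm (\<zeta> - \<phi>)"
      using norm_triangle_ineq[of "evolved t \<tau> \<phi> - evolved t \<tau> \<zeta>" "evolved t \<tau> \<zeta> - \<phi>"]
        norm_triangle_ineq[of "evolved t \<tau> \<zeta> - \<zeta>" "\<zeta> - \<phi>"] by simp
    ultimately show "norm (evolved t \<tau> \<phi> - \<phi>) < e" using 1 \<zeta> by linarith
  qed
qed

section \<open>Continuity in time and strong continuity\<close>

lemma state_continuous:
  assumes w: "solution \<tau> r w"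
  shows "continuous_on {\<tau>..} (state w)"
  unfolding continuous_on_def
proof
  fix t0 assume t0: "t0 \<in> {\<tau>..}"
  show "(state w \<longlongrightarrow> state w t0) (at t0 within {\<tau>..})"
  proof (rule tendsto_max_pow)
    fix j
    let ?g = "\<lambda>t. integral (cbox 0 1) (\<lambda>x. (w j (x, t) - w j (x, t0))\<^sup>2)"
    have c: "continuous_on ({0..1} \<times> {\<tau>..}) (w j)"
      using w by (simp add: solution_def C1_on_def closure_half_strip)
    have "continuous_on ({\<tau>..} \<times> cbox 0 1) (\<lambda>(t, x). (w j (x, t) - w j (x, t0))\<^sup>2)"
      unfolding case_prod_beta using t0
      by (intro continuous_intros continuous_on_compose2[OF c]) auto
    then have "continuous_on {\<tau>..} ?g" by (rule integral_continuous_on_param)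
    then have "(?g \<longlongrightarrow> ?g t0) (at t0 within {\<tau>..})"
      using t0 unfolding continuous_on_def by blast
    then have lim: "((\<lambda>t. sqrt (?g t)) \<longlongrightarrow> sqrt 0) (at t0 within {\<tau>..})"
      by (intro tendsto_real_sqrt) simp
    have slice: "continuous_on {0..1} (\<lambda>x. w j (x, t))" if "t \<in> {\<tau>..}" for t
      using solution_slice_cont[OF w] that by simp
    have "norm (L2_class (\<lambda>x. w j (x, t)) - L2_class (\<lambda>x. w j (x, t0))) = sqrt (?g t)"
      if t: "t \<in> {\<tau>..}" for t
    proof -
      have "(norm (L2_class (\<lambda>x. w j (x, t) - w j (x, t0))))\<^sup>2 = ?g t"
        using norm_L2_class_continuous[OF continuous_on_diff[OF slice[OF t] slice[OF t0]]] by simp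
      then have "norm (L2_class (\<lambda>x. w j (x, t) - w j (x, t0))) = sqrt (?g t)"
        by (rule real_sqrt_unique[OF _ norm_ge_zero, symmetric])
      then show ?thesis
        unfolding L2_class_diff[OF square_integrable_continuous[OF slice[OF t]]
            square_integrable_continuous[OF slice[OF t0]]] .
    qed
    then have "\<forall>\<^sub>F t in at t0 within {\<tau>..}.
        norm (L2_class (\<lambda>x. w j (x, t)) - L2_class (\<lambda>x. w j (x, t0))) \<le> sqrt (?g t)"
      by (simp add: eventually_at_filter)
    from Lim_null_comparison[OF this] lim
    show "((\<lambda>t. component (state w t) j) \<longlongrightarrow> component (state w t0) j) (at t0 within {\<tau>..})"
      by (simp add: LIM_zero_cancel)
  qed
qed

lemma approximations_uniform:
  assumes "\<And>l. solution \<tau> (\<lambda>_ _. 0) (v l)" "(\<lambda>l::nat. state (v l) \<tau>) \<longlonglongrightarrow> \<phi>"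
  shows "uniform_limit {\<tau>..T} (\<lambda>l t. state (v l) t) (\<lambda>t. evolved t \<tau> \<phi>) sequentially"
proof (rule uniform_limitI)
  fix e :: real assume e: "0 < e"
  then have "\<forall>\<^sub>F l in sequentially. dist (state (v l) \<tau>) \<phi> < e / gain (T - \<tau>)"
    using assms(2) gain_pos by (intro tendstoD) auto
  then show "\<forall>\<^sub>F l in sequentially. \<forall>t\<in>{\<tau>..T}. dist (state (v l) t) (evolved t \<tau> \<phi>) < e"
  proof eventually_elim
    case (elim l)
    show ?case
    proof
      fix t assume t: "t \<in> {\<tau>..T}"
      have "dist (state (v l) t) (evolved t \<tau> \<phi>) \<le> gain (t - \<tau>) * norm (state (v l) \<tau> - \<phi>)"
        unfolding dist_norm using t by (intro evolved_estimate assms) auto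
      also have "\<dots> \<le> gain (T - \<tau>) * norm (state (v l) \<tau> - \<phi>)"
        using t by (intro mult_right_mono gain_mono) auto
      also have "\<dots> < e"
        using elim gain_pos[of "T - \<tau>"] by (simp add: dist_norm pos_less_divide_eq mult.commute)
      finally show "dist (state (v l) t) (evolved t \<tau> \<phi>) < e" .
    qed
  qed
qed

lemma evolved_continuous: "continuous_on {\<tau>..} (\<lambda>t. evolved t \<tau> \<phi>)"
proof -
  obtain v where v: "\<And>l. solution \<tau> (\<lambda>_ _. 0) (v l)" "(\<lambda>l::nat. state (v l) \<tau>) \<longlonglongrightarrow> \<phi>"
    using approximating_solutions[of \<phi> \<tau>] by metis
  have T: "continuous_on {\<tau>..T} (\<lambda>t. evolved t \<tau> \<phi>)" for T
  proof (rule uniform_limit_theorem[OF _ approximations_uniform[OF v]])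
    show "\<forall>\<^sub>F l in sequentially. continuous_on {\<tau>..T} (state (v l))"
      by (intro always_eventually allI continuous_on_subset[OF state_continuous[OF v(1)]]) auto
  qed simp
  show ?thesis
    unfolding continuous_on_eq_continuous_within
  proof
    fix t0 assume t0: "t0 \<in> {\<tau>..}"
    have "continuous (at t0 within {\<tau>..t0 + 1}) (\<lambda>t. evolved t \<tau> \<phi>)"
      using T[of "t0 + 1"] t0 by (simp add: continuous_on_eq_continuous_within)
    moreover have "at t0 within {\<tau>..t0 + 1} = at t0 within {\<tau>..}"
      by (rule at_within_nhd[of _ "{..<t0 + 1}"]) auto
    ultimately show "continuous (at t0 within {\<tau>..}) (\<lambda>t. evolved t \<tau> \<phi>)" by simp
  qed
qed

lemma evolved_compose:
  assumes "\<tau> \<le> s" "s \<le> t"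
  shows "evolved t s (evolved s \<tau> \<phi>) = evolved t \<tau> \<phi>"
  using arg_cong[OF evolution_compose[OF assms], of "\<lambda>A. blinfun_apply A \<phi>"] assms
  by (simp add: evolution_apply)

text \<open>By the cocycle identity, delaying the start amounts to evolving the displacement that
  the state undergoes in the short time between the two starts. \<open>small_time\<close> controls
  that displacement uniformly.\<close>

lemma evolved_change_start:
  assumes "\<tau> \<le> \<tau>'" "\<tau>' \<le> t"
  shows "norm (evolved t \<tau> \<phi> - evolved t \<tau>' \<phi>) \<le> gain (t - \<tau>') * norm (evolved \<tau>' \<tau> \<phi> - \<phi>)"
proof -
  interpret E: bounded_linear "evolved t \<tau>'" by (rule bounded_linear_evolved[OF assms(2)])
  have "evolved t \<tau> \<phi> - evolved t \<tau>' \<phi> = evolved t \<tau>' (evolved \<tau>' \<tau> \<phi> - \<phi>)"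
    by (simp add: E.diff evolved_compose[OF assms])
  then show ?thesis using evolved_norm[OF assms(2)] by simp
qed

text \<open>On the diagonal this is \<open>small_time\<close>. Off the diagonal the start is first
  moved to \<tau>0 at the same final time t, and then t is moved along the trajectory from \<tau>0,
  which is continuous.\<close>

lemma evolution_strongly_continuous:
  "continuous_on {(t, \<tau>). \<tau> \<le> t} (\<lambda>(t, \<tau>). blinfun_apply (evolution t \<tau>) \<phi>)"
proof -
  have "continuous_on {(t, \<tau>). \<tau> \<le> t} (\<lambda>(t, \<tau>). evolved t \<tau> \<phi>)"
    unfolding continuous_on_iff
  proof (clarify)
    fix t0 \<tau>0 e :: real assume le0: "\<tau>0 \<le> t0" and e: "0 < e"
    show "\<exists>d>0. \<forall>z\<in>{(t, \<tau>). \<tau> \<le> t}. dist z (t0, \<tau>0) < d \<longrightarrow>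
        dist (case z of (t, \<tau>) \<Rightarrow> evolved t \<tau> \<phi>) (evolved t0 \<tau>0 \<phi>) < e"
    proof (cases "t0 = \<tau>0")
      case True
      obtain \<delta> where \<delta>: "0 < \<delta>" "\<And>\<tau> t. \<tau> \<le> t \<Longrightarrow> t < \<tau> + \<delta> \<Longrightarrow> norm (evolved t \<tau> \<phi> - \<phi>) < e"
        using small_time[OF e] by metis
      have "evolved t0 \<tau>0 \<phi> = \<phi>"
        using evolution_apply[of t0 t0 \<phi>] True by (simp add: evolution_refl)
      moreover have "norm (evolved t \<tau> \<phi> - \<phi>) < e" if "\<tau> \<le> t" "dist (t, \<tau>) (t0, \<tau>0) < \<delta> / 2" for t \<tau>
      proof (rule \<delta>(2)[OF that(1)])
        have "\<bar>t - t0\<bar> < \<delta> / 2" "\<bar>\<tau> - \<tau>0\<bar> < \<delta> / 2"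
          using that(2) dist_fst_le[of "(t, \<tau>)" "(t0, \<tau>0)"] dist_snd_le[of "(t, \<tau>)" "(t0, \<tau>0)"]
          by (simp_all add: dist_real_def)
        then show "t < \<tau> + \<delta>" using True by linarith
      qed
      ultimately show ?thesis
        using \<delta>(1) by (intro exI[of _ "\<delta> / 2"]) (auto simp: dist_norm[of "evolved _ _ _"])
    next
      case False
      then have lt: "\<tau>0 < t0" using le0 by simp
      define G where "G = gain (t0 - \<tau>0 + 2)"
      have G: "0 < G" by (simp add: G_def gain_pos)
      have e2: "0 < e / (2 * G)" using e G by simp
      obtain \<delta> where \<delta>: "0 < \<delta>" "\<And>\<tau> t. \<tau> \<le> t \<Longrightarrow> t < \<tau> + \<delta> \<Longrightarrow> norm (evolved t \<tau> \<phi> - \<phi>) < e / (2 * G)"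
        using small_time[OF e2] by metis
      obtain \<epsilon> where \<epsilon>: "0 < \<epsilon>" "\<And>t. \<tau>0 \<le> t \<Longrightarrow> \<bar>t - t0\<bar> < \<epsilon> \<Longrightarrow> dist (evolved t \<tau>0 \<phi>) (evolved t0 \<tau>0 \<phi>) < e / 2"
        using evolved_continuous[of \<tau>0 \<phi>] lt e unfolding continuous_on_iff dist_real_def
        by (metis atLeast_iff half_gt_zero le0)
      define h where "h = (t0 - \<tau>0) / 2"
      \<comment> \<open>Half the gap keeps t at or after \<tau>0, so the evolution from \<tau>0 is
        available at t. The bound 1 keeps all elapsed times below the one used in
        \<open>G\<close>.\<close>
      define d where "d = Min {\<delta>, \<epsilon>, 1, h}"
      have d: "0 < d" "d \<le> \<delta>" "d \<le> \<epsilon>" "d \<le> 1" "d \<le> h"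
        using \<delta>(1) \<epsilon>(1) lt by (auto simp: d_def h_def[symmetric]) (simp add: h_def)
      have "dist (evolved t \<tau> \<phi>) (evolved t0 \<tau>0 \<phi>) < e" if "\<tau> \<le> t" "dist (t, \<tau>) (t0, \<tau>0) < d" for t \<tau> :: real
      proof -
        have td: "\<bar>t - t0\<bar> < d" "\<bar>\<tau> - \<tau>0\<bar> < d"
          using that(2) dist_fst_le[of "(t, \<tau>)" "(t0, \<tau>0)"] dist_snd_le[of "(t, \<tau>)" "(t0, \<tau>0)"]
          by (simp_all add: dist_real_def)
        then have t: "\<tau> \<le> t" "\<tau>0 \<le> t"
        proof -
          show "\<tau> \<le> t" by (rule that(1))
          have "t0 - t < d" using td(1) by (simp add: abs_less_iff)
          also have "d \<le> (t0 - \<tau>0) / 2" using d(5) by (simp add: h_def)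
          finally show "\<tau>0 \<le> t" using lt by (simp add: field_simps)
        qed
        have "norm (evolved t \<tau> \<phi> - evolved t \<tau>0 \<phi>) \<le> e / 2"
        proof (cases "\<tau> \<le> \<tau>0")
          case True
          have "norm (evolved t \<tau> \<phi> - evolved t \<tau>0 \<phi>) \<le> gain (t - \<tau>0) * norm (evolved \<tau>0 \<tau> \<phi> - \<phi>)"
            by (rule evolved_change_start[OF True t(2)])
          also have "\<dots> \<le> G * (e / (2 * G))"
            unfolding G_def[symmetric]
            using True td d G \<delta>(2)[of \<tau> \<tau>0] gain_mono[of "t - \<tau>0" "t0 - \<tau>0 + 2"]
            by (intro mult_mono) (auto simp: G_def[symmetric])
          also have "\<dots> = e / 2" using G by simp
          finally show ?thesis .
        next
          case False
          then have "norm (evolved t \<tau>0 \<phi> - evolved t \<tau> \<phi>) \<le> gain (t - \<tau>) * norm (evolved \<tau> \<tau>0 \<phi> - \<phi>)"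
            using t by (intro evolved_change_start) auto
          also have "\<dots> \<le> G * (e / (2 * G))"
            using False td d G \<delta>(2)[of \<tau>0 \<tau>] gain_mono[of "t - \<tau>" "t0 - \<tau>0 + 2"]
            by (intro mult_mono) (auto simp: G_def[symmetric])
          also have "\<dots> = e / 2" using G by simp
          finally show ?thesis by (simp add: norm_minus_commute)
        qed
        moreover have "dist (evolved t \<tau>0 \<phi>) (evolved t0 \<tau>0 \<phi>) < e / 2"
          using \<epsilon>(2)[OF t(2)] td d by linarith
        ultimately show ?thesis
          using dist_triangle[of "evolved t \<tau> \<phi>" "evolved t0 \<tau>0 \<phi>" "evolved t \<tau>0 \<phi>"]
          by (simp add: dist_norm)
      qed
      then show ?thesis using d(1) by (intro exI[of _ d]) auto
    qed
  qed
  then show ?thesis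
    by (rule continuous_on_cong[THEN iffD1, rotated -1]) (auto simp: evolution_apply)
qed

lemma evolution_family_evolution: "evolution_family evolution"
  unfolding evolution_family_def
  using evolution_refl evolution_compose evolution_strongly_continuous by blast

lemma evolution_approximated:
  assumes "approximating_data \<phi> \<psi>" "\<And>l. classical_solution m p a b \<tau> (\<psi> l) (v l)"
  shows "locally_uniform_L2_limit \<tau> v (\<lambda>t. blinfun_apply (evolution t \<tau>) \<phi>)"
  unfolding locally_uniform_L2_limit_def
proof (intro allI impI)
  fix T
  have v: "solution \<tau> (\<lambda>_ _. 0) (v l)" for l
    using assms(2)[of l] by (simp add: classical_solution_iff)
  have "state (v l) \<tau> = L2_vec (\<psi> l)" for l
    using state_initial[OF assms(2)] assms(1) by (simp add: approximating_data_def)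
  then have "(\<lambda>l. state (v l) \<tau>) \<longlonglongrightarrow> \<phi>" using assms(1) by (simp add: approximating_data_def)
  from approximations_uniform[OF v this, of T]
  show "uniform_limit {\<tau>..T} (\<lambda>l \<theta>. state (v l) \<theta>) (\<lambda>t. blinfun_apply (evolution t \<tau>) \<phi>) sequentially"
    by (rule uniform_limit_cong'[THEN iffD1, rotated -1]) (auto simp: evolution_apply)
qed

lemma generates_evolution: "generates m p a b evolution"
  unfolding generates_def
proof (intro conjI allI impI)
  show "evolution_family evolution" by (rule evolution_family_evolution)
  show "\<exists>u. classical_solution m p a b \<tau> \<phi> u \<and>
      (\<forall>v. classical_solution m p a b \<tau> \<phi> v \<longrightarrow> (\<forall>j. \<forall>z\<in>closure (half_strip \<tau>). v j z = u j z))"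
    if "\<forall>j. \<phi> j \<in> test_functions" for \<tau> \<phi>
    using classical_solution_exists[of \<phi> \<tau>] classical_solution_unique[of \<tau> \<phi>] that by blast
  show "L2_generalized_solution m p a b \<tau> \<phi> (\<lambda>t. blinfun_apply (evolution t \<tau>) \<phi>)" for \<tau> \<phi>
    unfolding L2_generalized_solution_def
  proof (intro conjI)
    show "continuous_on {\<tau>..} (\<lambda>t. blinfun_apply (evolution t \<tau>) \<phi>)"
      using evolved_continuous[of \<tau> \<phi>]
      by (rule continuous_on_cong[THEN iffD1, rotated -1]) (auto simp: evolution_apply)
    show "blinfun_apply (evolution \<tau> \<tau>) \<phi> = \<phi>" by (simp add: evolution_refl)
    obtain \<psi> v where v: "approximating_data \<phi> \<psi>" "\<And>l. classical_solution m p a b \<tau> (\<psi> l) (v l)"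
      using approximating_solutions[of \<phi> \<tau>] by metis
    then show "\<exists>\<psi> v. approximating_data \<phi> \<psi> \<and> (\<forall>l. classical_solution m p a b \<tau> (\<psi> l) (v l)) \<and>
        locally_uniform_L2_limit \<tau> v (\<lambda>t. blinfun_apply (evolution t \<tau>) \<phi>)"
      using evolution_approximated[OF v] by blast
  qed
  show "locally_uniform_L2_limit \<tau> v (\<lambda>t. blinfun_apply (evolution t \<tau>) \<phi>)"
    if "approximating_data \<phi> \<psi> \<and> (\<forall>l. classical_solution m p a b \<tau> (\<psi> l) (v l))" for \<tau> \<phi> \<psi> v
    using that evolution_approximated by blast
qed

lemma exponentially_bounded_evolution: "exponentially_bounded evolution"
  unfolding exponentially_bounded_def
  using amplif_ge evolution_norm by (auto simp: gain_def)

end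

theorem theorem2p3:
  fixes m :: nat
    and p :: "'n::{finite, linorder} \<Rightarrow> 'n \<Rightarrow> real"
    and a :: "'n \<Rightarrow> real \<times> real \<Rightarrow> real"
    and b :: "'n \<Rightarrow> 'n \<Rightarrow> real \<times> real \<Rightarrow> real"
    and \<Lambda>\<^sub>0 :: real
  assumes "CARD('n) \<ge> 2" and "m \<le> CARD('n)"
    and "\<And>j. a j \<in> BC1 strip" and "\<And>j k. b j k \<in> BC1 strip"
    and "\<Lambda>\<^sub>0 > 0"
    and "\<And>j. pos j \<le> m \<Longrightarrow> (INF z\<in>closure strip. a j z) \<ge> \<Lambda>\<^sub>0"
    and "\<And>j. pos j > m \<Longrightarrow> (SUP z\<in>closure strip. a j z) \<le> - \<Lambda>\<^sub>0"
  shows "\<exists>U. generates m p a b U \<and> exponentially_bounded U"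
proof -
  let ?S = "{0..1::real} \<times> (UNIV :: real set)"
  have "\<forall>j. \<exists>vx vt. has_partials_on (a j) vx vt ?S \<and> vx \<in> BC strip \<and> vt \<in> BC strip"
    using assms(3) by (simp add: BC1_def closure_strip)
  then obtain aX aT where a: "\<And>j. has_partials_on (a j) (aX j) (aT j) ?S"
    "\<And>j. aX j \<in> BC strip" "\<And>j. aT j \<in> BC strip" by metis
  have "\<forall>j k. \<exists>vx vt. has_partials_on (b j k) vx vt ?S \<and> vx \<in> BC strip \<and> vt \<in> BC strip"
    using assms(4) by (simp add: BC1_def closure_strip)
  then obtain bX bT where b: "\<And>j k. has_partials_on (b j k) (bX j k) (bT j k) ?S"
    "\<And>j k. bX j k \<in> BC strip" "\<And>j k. bT j k \<in> BC strip" by metis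
  have ab: "a j \<in> BC strip" "b j k \<in> BC strip" for j k
    using assms(3)[of j] assms(4)[of j k] by (simp_all add: BC1_def)
  \<comment> \<open>Finitely many bounded functions have a common bound; \<open>H\<close> collects
    the coefficients with all their partial derivatives.\<close>
  define H where "H = range a \<union> range aX \<union> range aT \<union> (\<Union>j. range (b j)) \<union> (\<Union>j. range (bX j)) \<union> (\<Union>j. range (bT j))"
  have "bounded (\<Union>h\<in>H. h ` ?S)"
  proof (rule bounded_UN)
    show "finite H" by (simp add: H_def)
    show "\<forall>h\<in>H. bounded (h ` ?S)"
      using ab a b by (auto simp: H_def BC_def closure_strip)
  qed
  then obtain B where B: "\<And>y. y \<in> (\<Union>h\<in>H. h ` ?S) \<Longrightarrow> norm y \<le> B"
    unfolding bounded_iff by blast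
  have le: "\<bar>h (x, t)\<bar> \<le> B" if "h \<in> H" "x \<in> {0..1}" for h and x t :: real
  proof -
    have "norm (h (x, t)) \<le> B" using that by (intro B) blast
    then show ?thesis by simp
  qed
  have H: "a j \<in> H" "aX j \<in> H" "aT j \<in> H" "b j k \<in> H" "bX j k \<in> H" "bT j k \<in> H" for j k
  proof -
    have "c j k \<in> (\<Union>j. range (c j))" for c :: "'n \<Rightarrow> 'n \<Rightarrow> real \<times> real \<Rightarrow> real"
      by (rule UN_I[of j]) auto
    from this[of b] this[of bX] this[of bT]
    show "a j \<in> H" "aX j \<in> H" "aT j \<in> H" "b j k \<in> H" "bX j k \<in> H" "bT j k \<in> H"
      unfolding H_def Un_iff by (simp_all only: rangeI simp_thms)
  qed
  have cont: "continuous_on ?S h" if "h \<in> BC strip" for h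
    using that by (simp add: BC_def closure_strip)
  have bdd: "bounded (a j ` ?S)" for j
    using ab(1)[of j] by (simp add: BC_def closure_strip)
  have "ibvp m a aX aT b bX bT \<Lambda>\<^sub>0 B"
  proof
    show "\<bar>a j (x, t)\<bar> \<le> B" "\<bar>aX j (x, t)\<bar> \<le> B" "\<bar>aT j (x, t)\<bar> \<le> B" if "x \<in> {0..1}" for j x t
      by (intro le H that)+
    show "\<bar>b j k (x, t)\<bar> \<le> B" "\<bar>bX j k (x, t)\<bar> \<le> B" "\<bar>bT j k (x, t)\<bar> \<le> B" if "x \<in> {0..1}" for j k x t
      by (intro le H that)+
    show "\<Lambda>\<^sub>0 \<le> a j (x, t)" if "pos j \<le> m" "x \<in> {0..1}" for j x t
    proof -
      \<comment> \<open>On the reals an infimum is a lower bound only for sets bounded below, which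
        the boundedness of \<open>a j\<close> provides.\<close>
      have "(INF z\<in>?S. a j z) \<le> a j (x, t)"
        using that bdd by (intro cINF_lower bounded_imp_bdd_below) auto
      then show ?thesis using assms(6)[OF that(1)] by (simp add: closure_strip)
    qed
    show "a j (x, t) \<le> - \<Lambda>\<^sub>0" if "\<not> pos j \<le> m" "x \<in> {0..1}" for j x t
    proof -
      have "a j (x, t) \<le> (SUP z\<in>?S. a j z)"
        using that bdd by (intro cSUP_upper bounded_imp_bdd_above) auto
      then show ?thesis using assms(7)[of j] that(1) by (simp add: closure_strip)
    qed
  qed (use a b ab assms(5) cont in auto)
  then interpret ibvp m p a aX aT b bX bT \<Lambda>\<^sub>0 B .
  show ?thesis using generates_evolution exponentially_bounded_evolution by blast
qed

end
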